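(* There exists a deterministic, combinatorial, polynomial-time algorithm that achieves an approximation ratio of $4m+1$ for the coflow-level coflow scheduling problem in identical parallel networks with (arbitrary) release times, where $m$ is the number of network cores.
   Context: Identical parallel network: $m$ identical network cores, each an $N\times N$ non-blocking switch; the $i$-th input port of every core is connected to source server $i\in\mathcal{I}=\{1,\dots,N\}$ and the $j$-th output port of every core to destination server $j\in\mathcal{J}=\{1,\dots,N\}$. All links have unit capacity, so on each core, at any time, each input port and each output port transmits data of at most one flow, at rate at most 1; transmission may be preempted. A set $\mathcal{K}$ of $n$ coflows is given; coflow $k$ has a demand matrix $D^{(k)}=(d_{i,j,k})_{i,j=1}^N$ of nonnegative integers, where $d_{i,j,k}$ is the size (equivalently, transmission time) of flow $(i,j,k)$ from source $i$ to destination $j$, a release time $r_k\ge 0$ before which none of its flows may be transmitted, and a positive weight $w_k$. The completion time $C_k$ of coflow $k$ is the time at which the last of its flows finishes. In the coflow-level scheduling problem, all flows of a given coflow must be transmitted on one and the same core (chosen by the scheduler). The objective is to minimize $\sum_{k\in\mathcal{K}} w_k C_k$. An algorithm has approximation ratio $\rho$ if on every instance its schedule has objective at most $\rho$ times the optimum. *)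

theory Defs
  imports "HOL-Analysis.Analysis" "HOL-Computational_Algebra.Polynomial" "HOL-Library.Log_Nat"
begin

section \<open>Coflow-level scheduling in identical parallel networks\<close>

text \<open>
  Cores, ports and coflows are numbered from 0. Release times and weights are rational because
  instances are inputs of an algorithm; schedules live in real time.
\<close>

record coflow_instance =
  cores :: nat
  ports :: nat
  coflows :: nat
  demand :: "nat \<Rightarrow> nat \<Rightarrow> nat \<Rightarrow> nat" \<comment> \<open>source, destination, coflow\<close>
  release :: "nat \<Rightarrow> rat"
  weight :: "nat \<Rightarrow> rat"

definition valid_instance :: "coflow_instance \<Rightarrow> bool" where
  "valid_instance I \<longleftrightarrow> cores I \<ge> 1 \<and> ports I \<ge> 1 \<and>
     (\<forall>k < coflows I. release I k \<ge> 0 \<and> weight I k > 0)"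

text \<open>
  The coflow-level constraint is built into the type: a schedule chooses one core per coflow,
  and \<open>rate S i j k t\<close> is the rate at which flow \<open>(i, j, k)\<close> is transmitted on
  that core at time \<open>t\<close>.
\<close>

record schedule =
  core :: "nat \<Rightarrow> nat"
  rate :: "nat \<Rightarrow> nat \<Rightarrow> nat \<Rightarrow> real \<Rightarrow> real"

definition sent :: "schedule \<Rightarrow> nat \<Rightarrow> nat \<Rightarrow> nat \<Rightarrow> real \<Rightarrow> real" where
  "sent S i j k T = integral {0..T} (rate S i j k)"

definition feasible :: "coflow_instance \<Rightarrow> schedule \<Rightarrow> bool" where
  "feasible I S \<longleftrightarrow>
     (\<forall>k < coflows I. core S k < cores I) \<and>
     (\<forall>i < ports I. \<forall>j < ports I. \<forall>k < coflows I.
        (\<forall>t. 0 \<le> rate S i j k t \<and> rate S i j k t \<le> 1) \<and>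
        (\<forall>t < real_of_rat (release I k). rate S i j k t = 0) \<and>
        (\<forall>T \<ge> 0. rate S i j k integrable_on {0..T}) \<and>
        (\<exists>T \<ge> 0. \<forall>T' \<ge> T. sent S i j k T' = real (demand I i j k))) \<and>
     (\<forall>i < ports I. \<forall>j < ports I. \<forall>j' < ports I. \<forall>k < coflows I. \<forall>k' < coflows I. \<forall>t.
        core S k = core S k' \<and> rate S i j k t > 0 \<and> rate S i j' k' t > 0
          \<longrightarrow> j = j' \<and> k = k') \<and>
     (\<forall>j < ports I. \<forall>i < ports I. \<forall>i' < ports I. \<forall>k < coflows I. \<forall>k' < coflows I. \<forall>t.
        core S k = core S k' \<and> rate S i j k t > 0 \<and> rate S i' j k' t > 0
          \<longrightarrow> i = i' \<and> k = k')"

text \<open>A flow of size 0 finishes when its coflow is released.\<close>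

definition flow_completion ::
  "coflow_instance \<Rightarrow> schedule \<Rightarrow> nat \<Rightarrow> nat \<Rightarrow> nat \<Rightarrow> real" where
  "flow_completion I S i j k =
     Inf {T. real_of_rat (release I k) \<le> T \<and> sent S i j k T = real (demand I i j k)}"

definition completion_time :: "coflow_instance \<Rightarrow> schedule \<Rightarrow> nat \<Rightarrow> real" where
  "completion_time I S k =
     Max ((\<lambda>(i, j). flow_completion I S i j k) ` ({..<ports I} \<times> {..<ports I}))"

definition objective :: "coflow_instance \<Rightarrow> schedule \<Rightarrow> real" where
  "objective I S = (\<Sum>k<coflows I. real_of_rat (weight I k) * completion_time I S k)"

definition optimum :: "coflow_instance \<Rightarrow> real" where
  "optimum I = Inf {objective I S |S. feasible I S}"


section \<open>Algorithms: a deterministic random access machine over the rationals\<close>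

text \<open>
  Structured programs over finitely many arrays of rationals; an array is addressed by rationals
  and a scalar variable is a single cell of an array. The only operations are the four arithmetic
  operations (division by 0 gives 0), comparison and access to cells. There is deliberately no
  rounding operation, which would not be an elementary operation for strong polynomiality.
\<close>

type_synonym memory = "nat \<Rightarrow> rat \<Rightarrow> rat"

datatype exp =
    Const rat
  | Cell nat exp
  | Add exp exp
  | Sub exp exp
  | Mul exp exp
  | Div exp exp

datatype prog =
    Skip
  | Assign nat exp exp \<comment> \<open>array, address, value\<close>
  | Seq prog prog
  | IfLess exp exp prog prog
  | WhileLess exp exp prog

fun val :: "exp \<Rightarrow> memory \<Rightarrow> rat" where
  "val (Const q) s = q"
| "val (Cell a e) s = s a (val e s)"
| "val (Add e f) s = val e s + val f s"
| "val (Sub e f) s = val e s - val f s"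
| "val (Mul e f) s = val e s * val f s"
| "val (Div e f) s = val e s / val f s"

text \<open>Length of the binary encoding of a reduced fraction (with a sign bit).\<close>

definition rat_bits :: "rat \<Rightarrow> nat" where
  "rat_bits q = 1 + floorlog 2 (nat \<bar>fst (quotient_of q)\<bar>) + floorlog 2 (nat (snd (quotient_of q)))"

fun exp_ops :: "exp \<Rightarrow> nat" where
  "exp_ops (Const q) = 1"
| "exp_ops (Cell a e) = 1 + exp_ops e"
| "exp_ops (Add e f) = 1 + exp_ops e + exp_ops f"
| "exp_ops (Sub e f) = 1 + exp_ops e + exp_ops f"
| "exp_ops (Mul e f) = 1 + exp_ops e + exp_ops f"
| "exp_ops (Div e f) = 1 + exp_ops e + exp_ops f"

text \<open>
  Logarithmic cost criterion: every operation is charged the length of its result, and (through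
  the recursive calls) of its operands and addresses.
\<close>

fun exp_bits :: "exp \<Rightarrow> memory \<Rightarrow> nat" where
  "exp_bits (Const q) s = rat_bits q"
| "exp_bits (Cell a e) s = rat_bits (val (Cell a e) s) + exp_bits e s"
| "exp_bits (Add e f) s = rat_bits (val (Add e f) s) + exp_bits e s + exp_bits f s"
| "exp_bits (Sub e f) s = rat_bits (val (Sub e f) s) + exp_bits e s + exp_bits f s"
| "exp_bits (Mul e f) s = rat_bits (val (Mul e f) s) + exp_bits e s + exp_bits f s"
| "exp_bits (Div e f) s = rat_bits (val (Div e f) s) + exp_bits e s + exp_bits f s"

text \<open>
  \<open>exec c s u b t\<close>: started in \<open>s\<close>, program \<open>c\<close> halts in \<open>t\<close> after \<open>u\<close> elementary
  operations, at logarithmic cost \<open>b\<close>.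
\<close>

inductive exec :: "prog \<Rightarrow> memory \<Rightarrow> nat \<Rightarrow> nat \<Rightarrow> memory \<Rightarrow> bool" where
  Skip: "exec Skip s 1 1 s"
| Assign: "exec (Assign a e f) s (1 + exp_ops e + exp_ops f) (1 + exp_bits e s + exp_bits f s)
             (s(a := (s a)(val e s := val f s)))"
| Seq: "exec c s u b s' \<Longrightarrow> exec d s' u' b' t \<Longrightarrow> exec (Seq c d) s (u + u') (b + b') t"
| IfTrue: "val e s < val f s \<Longrightarrow> exec c s u b t \<Longrightarrow>
    exec (IfLess e f c d) s (1 + exp_ops e + exp_ops f + u) (1 + exp_bits e s + exp_bits f s + b) t"
| IfFalse: "\<not> val e s < val f s \<Longrightarrow> exec d s u b t \<Longrightarrow>
    exec (IfLess e f c d) s (1 + exp_ops e + exp_ops f + u) (1 + exp_bits e s + exp_bits f s + b) t"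
| WhileFalse: "\<not> val e s < val f s \<Longrightarrow>
    exec (WhileLess e f c) s (1 + exp_ops e + exp_ops f) (1 + exp_bits e s + exp_bits f s) s"
| WhileTrue: "val e s < val f s \<Longrightarrow> exec c s u b s' \<Longrightarrow> exec (WhileLess e f c) s' u' b' t \<Longrightarrow>
    exec (WhileLess e f c) s (1 + exp_ops e + exp_ops f + u + u')
      (1 + exp_bits e s + exp_bits f s + b + b') t"

inductive_cases exec_SkipE: "exec Skip s u b t"
inductive_cases exec_AssignE: "exec (Assign a e f) s u b t"
inductive_cases exec_SeqE: "exec (Seq c d) s u b t"
inductive_cases exec_IfE: "exec (IfLess e f c d) s u b t"
inductive_cases exec_WhileE: "exec (WhileLess e f c) s u b t"

lemma exec_deterministic:
  "exec c s u b t \<Longrightarrow> exec c s u' b' t' \<Longrightarrow> u' = u \<and> b' = b \<and> t' = t"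
proof (induction arbitrary: u' b' t' rule: exec.induct)
  case Skip
  then show ?case by (auto elim: exec_SkipE)
next
  case Assign
  then show ?case by (auto elim: exec_AssignE)
next
  case (Seq c s u b s' d v b2 t)
  from Seq.prems obtain u1 b1 s1 u2 b3 where
    "exec c s u1 b1 s1" "exec d s1 u2 b3 t'" "u' = u1 + u2" "b' = b1 + b3"
    by (blast elim: exec_SeqE)
  with Seq.IH(1)[of u1 b1 s1] Seq.IH(2)[of u2 b3 t'] show ?case by simp
next
  case (IfTrue e s f c u b t d)
  from IfTrue.prems IfTrue.hyps(1) obtain u1 b1 where
    "exec c s u1 b1 t'" "u' = 1 + exp_ops e + exp_ops f + u1"
      "b' = 1 + exp_bits e s + exp_bits f s + b1"
    by (auto elim!: exec_IfE)
  with IfTrue.IH[of u1 b1 t'] show ?case by simp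
next
  case (IfFalse e s f d u b t c)
  from IfFalse.prems IfFalse.hyps(1) obtain u1 b1 where
    "exec d s u1 b1 t'" "u' = 1 + exp_ops e + exp_ops f + u1"
      "b' = 1 + exp_bits e s + exp_bits f s + b1"
    by (auto elim!: exec_IfE)
  with IfFalse.IH[of u1 b1 t'] show ?case by simp
next
  case (WhileFalse e s f c)
  then show ?case by (auto elim: exec_WhileE)
next
  case (WhileTrue e s f c u b s' v b2 t)
  from WhileTrue.prems WhileTrue.hyps(1) obtain u1 b1 s1 u2 b3 where
    "exec c s u1 b1 s1" "exec (WhileLess e f c) s1 u2 b3 t'"
      "u' = Suc (exp_ops e + exp_ops f + u1 + u2)"
      "b' = Suc (exp_bits e s + exp_bits f s + b1 + b3)"
    by (blast elim: exec_WhileE)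
  with WhileTrue.IH(1)[of u1 b1 s1] WhileTrue.IH(2)[of u2 b3 t'] show ?case by simp
qed


section \<open>Approximation algorithms for coflow-level scheduling\<close>

text \<open>
  Input: array 0 holds the numbers of cores, ports and coflows; array 1 holds the demand matrices
  one after the other, row by row; array 2 the release times; array 3 the weights.
  All other cells are 0.
\<close>

definition encode :: "coflow_instance \<Rightarrow> memory" where
  "encode I = (\<lambda>_ _. 0)
     (0 := (\<lambda>_. 0)(0 := of_nat (cores I), 1 := of_nat (ports I), 2 := of_nat (coflows I)),
      1 := (\<lambda>q. \<Sum>k<coflows I. \<Sum>i<ports I. \<Sum>j<ports I.
              if q = of_nat ((k * ports I + i) * ports I + j) then of_nat (demand I i j k) else 0),
      2 := (\<lambda>q. \<Sum>k<coflows I. if q = of_nat k then release I k else 0),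
      3 := (\<lambda>q. \<Sum>k<coflows I. if q = of_nat k then weight I k else 0))"

definition input_count :: "coflow_instance \<Rightarrow> nat" where
  "input_count I = 3 + coflows I * ports I * ports I + 2 * coflows I"

definition input_bits :: "coflow_instance \<Rightarrow> nat" where
  "input_bits I =
     rat_bits (of_nat (cores I)) + rat_bits (of_nat (ports I)) + rat_bits (of_nat (coflows I)) +
     (\<Sum>k<coflows I. \<Sum>i<ports I. \<Sum>j<ports I. rat_bits (of_nat (demand I i j k))) +
     (\<Sum>k<coflows I. rat_bits (release I k) + rat_bits (weight I k))"

text \<open>
  Output: array 4 holds the core of each coflow and cell 0 of array 5 the number of transmission
  intervals. During the \<open>l\<close>-th interval, which is half-open with endpoints in arrays 9 and 10,
  the flow whose source, destination and coflow are in arrays 6, 7, 8 is transmitted at rate 1.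
\<close>

definition outputs :: "coflow_instance \<Rightarrow> memory \<Rightarrow> schedule \<Rightarrow> bool" where
  "outputs I s S \<longleftrightarrow>
     (\<forall>k < coflows I. s 4 (of_nat k) = of_nat (core S k)) \<and>
     (\<forall>i < ports I. \<forall>j < ports I. \<forall>k < coflows I. \<forall>t.
        rate S i j k t =
          (if \<exists>l::nat. of_nat l < s 5 0 \<and>
                s 6 (of_nat l) = of_nat i \<and> s 7 (of_nat l) = of_nat j \<and> s 8 (of_nat l) = of_nat k \<and>
                real_of_rat (s 9 (of_nat l)) \<le> t \<and> t < real_of_rat (s 10 (of_nat l))
           then 1 else 0))"

definition approximation_ratio :: "prog \<Rightarrow> (coflow_instance \<Rightarrow> real) \<Rightarrow> bool" where
  "approximation_ratio A \<rho> \<longleftrightarrow>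
     (\<forall>I. valid_instance I \<longrightarrow>
        (\<exists>u b s S. exec A (encode I) u b s \<and> outputs I s S \<and> feasible I S \<and>
           objective I S \<le> \<rho> I * optimum I))"

definition polynomial_time :: "prog \<Rightarrow> bool" where
  "polynomial_time A \<longleftrightarrow>
     (\<exists>p :: nat poly. \<forall>I. valid_instance I \<longrightarrow>
        (\<exists>u b s. exec A (encode I) u b s \<and> b \<le> poly p (input_bits I)))"

text \<open>
  `Combinatorial' (as opposed to solving linear programs numerically) is rendered by its usual
  quantitative content: the number of elementary operations is bounded by a polynomial in the
  number of input numbers, irrespective of their magnitude. Together with
  \<open>polynomial_time\<close> this is strong polynomiality.
\<close>

definition combinatorial :: "prog \<Rightarrow> bool" where
  "combinatorial A \<longleftrightarrow>
     (\<exists>p :: nat poly. \<forall>I. valid_instance I \<longrightarrow>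
        (\<exists>u b s. exec A (encode I) u b s \<and> u \<le> poly p (input_count I)))"

end

theory Submission imports Defs begin

text \<open>
  All coflows are transmitted on a single core. Let $L_p(U)$ be the total demand of the coflows in
  $U$ at port $p$. Since $m$ cores process at most $m$ units per time unit at a port, the completion
  times $C_k$ of any feasible schedule satisfy $L_p(U)^2 \le 2m \sum_{k \in U} L_p(\{k\}) C_k$.
  Build an order of the coflows from the last to the first position: take a port $p$ of maximal load
  in the set $U$ of the remaining coflows, let $k \in U$ minimise the ratio of residual weight and
  load at $p$, subtract this ratio times the loads at $p$ from the residual weights in $U$, and put
  $k$ last. This is a local-ratio argument: charging each subtracted part separately gives
  $\sum_k w_k \max_p L_p(\{1,\dots,k\}) \le 2m \sum_k w_k C_k$. Scheduling the flows greedily and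
  preemptively by priority in that order, flow $(i,j,k)$ waits after its release only while port $i$
  or port $j$ serves a flow of at least its priority, so that coflow $k$ is finished by
  $r_k + 2 \max_p L_p(\{1,\dots,k\})$. Together with $r_k \le C_k$ this yields the ratio $4m+1$.

  The residual weights and event times stay short because they have a common denominator: the input
  denominators, multiplied by one load for each coflow already placed.
\<close>

subsection \<open>Size of rational numbers\<close>

text \<open>One core can suffice because the comparison with \<open>m\<close> cores loses only the
  factor \<open>m\<close> that the lower bound contains anyway. The other factors are 2 from
  counting pairs in both orders, 2 from the two ports of a flow, and 1 for the release time:
  \<open>2 * 2 * m + 1\<close>.

  The obstacle to polynomial time is the length of the numbers. The bounds for single operations
  would let the length of the residual weights double with each coflow placed, because each update
  combines two residual weights. Hence magnitudes and denominators are bounded separately, and one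
  bound \<open>h\<close> is maintained for all memory cells; it is quadratic in the input length
  because every coflow placed can add that many bits to the denominator. Given \<open>h\<close>, the
  cost per operation is a constant times \<open>h + 1\<close>, with a constant read off the program
  text, so only operations remain to be counted.

  Operation counts may not depend on magnitudes. All loops therefore run over coflows, ports, flows
  or a number of events fixed in advance, and surplus events have length 0. Memory that is initially
  0 is exploited: the array of cores is never written, which puts every coflow on core 0.\<close>

definition fits :: "nat \<Rightarrow> rat \<Rightarrow> bool" where
  "fits h q \<longleftrightarrow> (\<exists>a b::int. q = of_int a / of_int b \<and> \<bar>a\<bar> \<le> 2 ^ h \<and> 0 < b \<and> b \<le> 2 ^ h)"

lemma fitsI: "q = of_int a / of_int b \<Longrightarrow> \<bar>a\<bar> \<le> 2 ^ h \<Longrightarrow> 0 < b \<Longrightarrow> b \<le> 2 ^ h \<Longrightarrow> fits h q"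
  unfolding fits_def by blast

lemma fits_mono: "fits h q \<Longrightarrow> h \<le> h' \<Longrightarrow> fits h' q"
proof -
  assume "fits h q" "h \<le> h'"
  then obtain a b where "q = of_int a / of_int b" "\<bar>a\<bar> \<le> 2 ^ h" "0 < b" "b \<le> 2 ^ h"
    unfolding fits_def by blast
  moreover have "(2::int) ^ h \<le> 2 ^ h'" using \<open>h \<le> h'\<close> by (intro power_increasing) auto
  ultimately show ?thesis by (intro fitsI[of q a b]) linarith+
qed

lemma fits_of_nat:
  assumes "x \<le> 2 ^ h"
  shows "fits h (of_nat x)"
proof -
  have "int x \<le> 2 ^ h" using assms by (metis of_nat_le_iff of_nat_numeral of_nat_power)
  then show ?thesis by (intro fitsI[of _ "int x" 1]) auto
qed

lemma fits_0 [simp]: "fits h 0" and fits_1 [simp]: "fits h 1"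
  using fits_of_nat[of 0 h] fits_of_nat[of 1 h] by auto

text \<open>Reducing a fraction never lengthens it: the reduced numerator divides \<open>a\<close>
  and the reduced denominator divides \<open>b\<close>. Since \<open>fits\<close> admits unreduced
  witnesses, closure under arithmetic is a matter of multiplying out. The 3 is the sign bit and one
  further digit for each of two numbers that may equal \<open>2 ^ h\<close>.\<close>

lemma rat_bits_le_if_fits:
  assumes "fits h q"
  shows "rat_bits q \<le> 2 * h + 3"
proof -
  obtain a b where ab: "q = of_int a / of_int b" "\<bar>a\<bar> \<le> 2 ^ h" "0 < b" "b \<le> 2 ^ h"
    using assms unfolding fits_def by blast
  obtain c d where cd: "quotient_of q = (c, d)" by fastforce
  have d: "d > 0" and cop: "coprime c d" and q: "q = of_int c / of_int d"
    using quotient_of_denom_pos[OF cd] quotient_of_coprime[OF cd] quotient_of_div[OF cd] by auto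
  have "(of_int a :: rat) * of_int d = of_int c * of_int b"
    using ab(1,3) d q by (simp add: field_simps)
  then have eq: "a * d = c * b" by (metis of_int_eq_iff of_int_mult)
  have "d dvd b" using eq cop by (metis coprime_commute coprime_dvd_mult_right_iff dvd_triv_right)
  then have db: "d \<le> b" using ab(3) by (simp add: zdvd_imp_le)
  have "c dvd a" using eq cop by (metis coprime_dvd_mult_left_iff dvd_triv_left)
  then have ca: "\<bar>c\<bar> \<le> \<bar>a\<bar>"
  proof (cases "a = 0")
    case True
    then show ?thesis using eq ab(3) by simp
  qed (simp add: dvd_imp_le_int)
  have pw: "floorlog 2 y \<le> h + 1" if "y \<le> 2 ^ h" for y
  proof (rule floorlog_leI)
    have "(2::nat) ^ h < 2 ^ (h + 1)" by simp
    then show "y < 2 ^ (h + 1)" using that by linarith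
  qed auto
  have "nat \<bar>c\<bar> \<le> 2 ^ h" "nat d \<le> 2 ^ h"
    using ca ab db by (simp_all add: nat_le_iff)
  then show ?thesis using pw[of "nat \<bar>c\<bar>"] pw[of "nat d"] unfolding rat_bits_def cd by simp
qed

lemma quotient_of_le_rat_bits:
  "\<bar>fst (quotient_of q)\<bar> \<le> 2 ^ rat_bits q" "snd (quotient_of q) \<le> 2 ^ rat_bits q"
proof -
  have pw: "int x \<le> 2 ^ k" if "floorlog 2 x \<le> k" for x k
  proof -
    have "x < 2 ^ k" using floorlog_leD[OF that] by simp
    then have "x \<le> 2 ^ k" by simp
    then show ?thesis by (metis of_nat_le_iff of_nat_numeral of_nat_power)
  qed
  show "\<bar>fst (quotient_of q)\<bar> \<le> 2 ^ rat_bits q"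
    using pw[of "nat \<bar>fst (quotient_of q)\<bar>" "rat_bits q"] unfolding rat_bits_def by simp
  show "snd (quotient_of q) \<le> 2 ^ rat_bits q"
    using pw[of "nat (snd (quotient_of q))" "rat_bits q"] quotient_of_denom_pos'[of q]
    unfolding rat_bits_def by simp
qed

lemma fits_rat_bits: "fits (rat_bits q) q"
proof (rule fitsI)
  show "q = of_int (fst (quotient_of q)) / of_int (snd (quotient_of q))"
    by (rule quotient_of_div) simp
qed (auto simp: quotient_of_le_rat_bits quotient_of_denom_pos')

lemma rat_bits_ge_1: "rat_bits q \<ge> 1"
  unfolding rat_bits_def by simp

lemma fits_mult: "fits h p \<Longrightarrow> fits k q \<Longrightarrow> fits (h + k) (p * q)"
  unfolding fits_def
proof (elim exE conjE)
  fix a b c d :: int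
  assume "p = of_int a / of_int b" "\<bar>a\<bar> \<le> 2 ^ h" "0 < b" "b \<le> 2 ^ h"
    "q = of_int c / of_int d" "\<bar>c\<bar> \<le> 2 ^ k" "0 < d" "d \<le> 2 ^ k"
  then show "\<exists>a b::int. p * q = of_int a / of_int b \<and> \<bar>a\<bar> \<le> 2 ^ (h + k) \<and> 0 < b \<and> b \<le> 2 ^ (h + k)"
    by (intro exI[of _ "a * c"] exI[of _ "b * d"]) (auto simp: abs_mult power_add intro!: mult_mono)
qed

text \<open>The sign moves into the new numerator. The convention \<open>inverse 0 = 0\<close> is
  met by the witness \<open>0 / 1\<close>.\<close>

lemma fits_inverse: "fits h q \<Longrightarrow> fits h (inverse q)"
  unfolding fits_def
proof (elim exE conjE)
  fix a b :: int
  assume q: "q = of_int a / of_int b" "\<bar>a\<bar> \<le> 2 ^ h" "0 < b" "b \<le> 2 ^ h"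
  consider "a = 0" | "a > 0" | "a < 0" by linarith
  then show "\<exists>a b::int. inverse q = of_int a / of_int b \<and> \<bar>a\<bar> \<le> 2 ^ h \<and> 0 < b \<and> b \<le> 2 ^ h"
  proof cases
    case 1
    then show ?thesis using q by (intro exI[of _ 0] exI[of _ 1]) auto
  next
    case 2
    then show ?thesis using q by (intro exI[of _ b] exI[of _ a]) auto
  next
    case 3
    then show ?thesis using q by (intro exI[of _ "-b"] exI[of _ "-a"]) auto
  qed
qed

lemma fits_divide: "fits h p \<Longrightarrow> fits k q \<Longrightarrow> fits (h + k) (p / q)"
  using fits_mult[OF _ fits_inverse] by (simp add: divide_inverse)

lemma fits_uminus: "fits h q \<Longrightarrow> fits h (- q)"
  using fits_mult[of h q 0 "- 1"] fitsI[of "- 1" "- 1" 1 0] by simp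

lemma fits_add: "fits h p \<Longrightarrow> fits k q \<Longrightarrow> fits (h + k + 1) (p + q)"
  unfolding fits_def
proof (elim exE conjE)
  fix a b c d :: int
  assume *: "p = of_int a / of_int b" "\<bar>a\<bar> \<le> 2 ^ h" "0 < b" "b \<le> 2 ^ h"
    "q = of_int c / of_int d" "\<bar>c\<bar> \<le> 2 ^ k" "0 < d" "d \<le> 2 ^ k"
  have "\<bar>a\<bar> * d \<le> 2 ^ h * 2 ^ k" "\<bar>c\<bar> * b \<le> 2 ^ k * 2 ^ h" "b * d \<le> 2 ^ h * 2 ^ k"
    using * by (auto intro!: mult_mono)
  moreover have "\<bar>a * d + c * b\<bar> \<le> \<bar>a\<bar> * d + \<bar>c\<bar> * b"
    using * abs_triangle_ineq[of "a * d" "c * b"] by (simp add: abs_mult)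
  moreover have "p + q = of_int (a * d + c * b) / of_int (b * d)"
    using * by (simp add: field_simps)
  ultimately show "\<exists>a b::int. p + q = of_int a / of_int b \<and>
      \<bar>a\<bar> \<le> 2 ^ (h + k + 1) \<and> 0 < b \<and> b \<le> 2 ^ (h + k + 1)"
    using * by (intro exI[of _ "a * d + c * b"] exI[of _ "b * d"]) (auto simp: power_add mult.commute)
qed

lemma fits_diff: "fits h p \<Longrightarrow> fits k q \<Longrightarrow> fits (h + k + 1) (p - q)"
  using fits_add[OF _ fits_uminus] by simp

text \<open>Repeated use of \<open>fits_add\<close> and \<open>fits_mult\<close> would let the
  exponent grow with every operation. A number of known magnitude and known denominator escapes
  this, whatever computation produced it, because its numerator is at most
  \<open>2 ^ k * D\<close>.\<close>

lemma fits_common_denominator: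
  assumes "q * of_int D \<in> \<int>" "0 < D" "D \<le> 2 ^ h" "\<bar>q\<bar> \<le> 2 ^ k"
  shows "fits (h + k) q"
proof -
  obtain a where a: "q * of_int D = of_int a" using assms(1) Ints_cases by blast
  have "\<bar>q * of_int D\<bar> \<le> 2 ^ k * of_int D"
    using assms(2,4) by (simp add: abs_mult mult_right_mono)
  also have "\<dots> = of_int (2 ^ k * D)" by simp
  finally have "\<bar>a\<bar> \<le> 2 ^ k * D" unfolding a by linarith
  also have "\<dots> \<le> 2 ^ k * 2 ^ h" using assms by (intro mult_left_mono) auto
  finally have A: "\<bar>a\<bar> \<le> 2 ^ (h + k)" by (simp add: power_add mult.commute)
  have "(2::int) ^ h \<le> 2 ^ (h + k)" by (intro power_increasing) auto
  then have "D \<le> 2 ^ (h + k)" using assms(3) by linarith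
  then show ?thesis using a A assms by (intro fitsI[of _ a D]) (auto simp: field_simps)
qed


subsection \<open>A program logic with cost bounds\<close>

definition all_fit :: "nat \<Rightarrow> memory \<Rightarrow> bool" where
  "all_fit h s \<longleftrightarrow> (\<forall>a q. fits h (s a q))"

text \<open>Measures the result only. A cell has a value that fits into \<open>h\<close> whatever
  its address, so the address expression does not enter.\<close>

fun val_size :: "exp \<Rightarrow> nat" where
  "val_size (Const q) = rat_bits q"
| "val_size (Cell a e) = 1"
| "val_size (Add e f) = val_size e + val_size f + 1"
| "val_size (Sub e f) = val_size e + val_size f + 1"
| "val_size (Mul e f) = val_size e + val_size f"
| "val_size (Div e f) = val_size e + val_size f"

text \<open>Coefficient of \<open>h + 1\<close> in the logarithmic cost: a result of size
  \<open>v\<close> contributes \<open>2 * v + 3\<close>, as in \<open>rat_bits_le_if_fits\<close>.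
  The 5 of \<open>Cell\<close> is this term for \<open>v = 1\<close>.\<close>

fun bits_factor :: "exp \<Rightarrow> nat" where
  "bits_factor (Const q) = rat_bits q"
| "bits_factor (Cell a e) = 5 + bits_factor e"
| "bits_factor (Add e f) = 2 * val_size (Add e f) + 3 + bits_factor e + bits_factor f"
| "bits_factor (Sub e f) = 2 * val_size (Sub e f) + 3 + bits_factor e + bits_factor f"
| "bits_factor (Mul e f) = 2 * val_size (Mul e f) + 3 + bits_factor e + bits_factor f"
| "bits_factor (Div e f) = 2 * val_size (Div e f) + 3 + bits_factor e + bits_factor f"

lemma fits_val:
  assumes "all_fit h s"
  shows "fits (val_size e * (h + 1)) (val e s)"
proof (induction e)
  case (Const q)
  show ?case by (rule fits_mono[of "rat_bits q"]) (simp_all add: fits_rat_bits)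
next
  case (Cell a e)
  show ?case by (rule fits_mono[of h]) (use assms in \<open>simp_all add: all_fit_def\<close>)
next
  case (Add e f)
  from fits_mono[OF fits_add[OF this], of "val_size (Add e f) * (h + 1)"] show ?case
    by (simp add: algebra_simps)
next
  case (Sub e f)
  from fits_mono[OF fits_diff[OF this], of "val_size (Sub e f) * (h + 1)"] show ?case
    by (simp add: algebra_simps)
next
  case (Mul e f)
  from fits_mono[OF fits_mult[OF this], of "val_size (Mul e f) * (h + 1)"] show ?case
    by (simp add: algebra_simps)
next
  case (Div e f)
  from fits_mono[OF fits_divide[OF this], of "val_size (Div e f) * (h + 1)"] show ?case
    by (simp add: algebra_simps)
qed

lemma exp_bits_le:
  assumes "all_fit h s"
  shows "exp_bits e s \<le> bits_factor e * (h + 1)"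
proof -
  have v: "rat_bits (val e s) \<le> (2 * val_size e + 3) * (h + 1)" for e
    using rat_bits_le_if_fits[OF fits_val[OF assms, of e]] by (simp add: algebra_simps)
  show ?thesis
  proof (induction e)
    case (Cell a e)
    then show ?case using v[of "Cell a e"] by (simp add: algebra_simps)
  next
    case (Add e f)
    then show ?case using v[of "Add e f"] by (simp add: algebra_simps)
  next
    case (Sub e f)
    then show ?case using v[of "Sub e f"] by (simp add: algebra_simps)
  next
    case (Mul e f)
    then show ?case using v[of "Mul e f"] by (simp add: algebra_simps)
  next
    case (Div e f)
    then show ?case using v[of "Div e f"] by (simp add: algebra_simps)
  qed simp
qed

fun writes :: "prog \<Rightarrow> nat set" where
  "writes Skip = {}"
| "writes (Assign a e f) = {a}"
| "writes (Seq c d) = writes c \<union> writes d"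
| "writes (IfLess e f c d) = writes c \<union> writes d"
| "writes (WhileLess e f c) = writes c"

text \<open>Bounds the cost per elementary operation, not the total cost. A loop therefore does not
  multiply the factor of its body by the number of iterations.\<close>

fun prog_factor :: "prog \<Rightarrow> nat" where
  "prog_factor Skip = 1"
| "prog_factor (Assign a e f) = 1 + bits_factor e + bits_factor f"
| "prog_factor (Seq c d) = prog_factor c + prog_factor d"
| "prog_factor (IfLess e f c d) = 1 + bits_factor e + bits_factor f + prog_factor c + prog_factor d"
| "prog_factor (WhileLess e f c) = 1 + bits_factor e + bits_factor f + prog_factor c"

text \<open>The number of operations when every loop is iterated at most \<open>M\<close> times, as a
  polynomial in \<open>M\<close>.\<close>

fun ops_poly :: "prog \<Rightarrow> nat poly" where
  "ops_poly Skip = 1"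
| "ops_poly (Assign a e f) = [:1 + exp_ops e + exp_ops f:]"
| "ops_poly (Seq c d) = ops_poly c + ops_poly d"
| "ops_poly (IfLess e f c d) = [:1 + exp_ops e + exp_ops f:] + ops_poly c + ops_poly d"
| "ops_poly (WhileLess e f c) = [:1, 1:] * ([:1 + exp_ops e + exp_ops f:] + ops_poly c)"

definition same_outside :: "nat set \<Rightarrow> memory \<Rightarrow> memory \<Rightarrow> bool" where
  "same_outside W s t \<longleftrightarrow> (\<forall>a. a \<notin> W \<longrightarrow> t a = s a)"

lemma same_outside_trans:
  "same_outside V s t \<Longrightarrow> same_outside W t r \<Longrightarrow> V \<subseteq> X \<Longrightarrow> W \<subseteq> X \<Longrightarrow> same_outside X s r"
  unfolding same_outside_def by (metis subsetD)

text \<open>Total correctness together with both resource bounds. The frame condition works at the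
  level of whole arrays, so facts about data that a subprogram does not write survive without being
  part of its invariant; scalars get arrays of their own for this reason.\<close>

definition run :: "nat \<Rightarrow> nat \<Rightarrow> prog \<Rightarrow> memory \<Rightarrow> (memory \<Rightarrow> bool) \<Rightarrow> bool" where
  "run M h c s Q \<longleftrightarrow> (\<exists>u b t. exec c s u b t \<and> u \<le> poly (ops_poly c) M \<and>
     b \<le> prog_factor c * (h + 1) * u \<and> all_fit h t \<and> same_outside (writes c) s t \<and> Q t)"

lemma run_conseq:
  assumes "run M h c s P" "\<And>t. all_fit h t \<Longrightarrow> same_outside (writes c) s t \<Longrightarrow> P t \<Longrightarrow> Q t"
  shows "run M h c s Q"
  using assms unfolding run_def by blast

lemma run_Skip: "all_fit h s \<Longrightarrow> Q s \<Longrightarrow> run M h Skip s Q"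
  unfolding run_def
  by (intro exI[of _ 1] exI[of _ s]) (auto simp: exec.Skip[simplified] same_outside_def)

text \<open>Only the stored value has to fit into \<open>h\<close>. Intermediate results and
  addresses may be longer; \<open>exp_bits_le\<close> bounds their cost by the syntax of the two
  expressions.\<close>

lemma run_Assign:
  assumes "all_fit h s" "val e s = q" "val f s = v" "fits h v" "Q (s(a := (s a)(q := v)))"
  shows "run M h (Assign a e f) s Q"
proof -
  have "exp_bits e s + exp_bits f s + 1 \<le> (1 + bits_factor e + bits_factor f) * (h + 1)"
    using exp_bits_le[OF assms(1), of e] exp_bits_le[OF assms(1), of f] by (simp add: algebra_simps)
  also have "\<dots> \<le> \<dots> * (1 + exp_ops e + exp_ops f)" by simp
  finally have b: "1 + exp_bits e s + exp_bits f s \<le>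
      prog_factor (Assign a e f) * (h + 1) * (1 + exp_ops e + exp_ops f)" by simp
  show ?thesis unfolding run_def
    by (rule exI, rule exI, rule exI, rule conjI, rule exec.Assign)
      (use b assms in \<open>auto simp: all_fit_def same_outside_def\<close>)
qed

lemma run_Seq:
  assumes "run M h c s (\<lambda>t. run M h d t Q)"
  shows "run M h (Seq c d) s Q"
proof -
  obtain u b t where 1: "exec c s u b t" "u \<le> poly (ops_poly c) M"
    "b \<le> prog_factor c * (h + 1) * u" "same_outside (writes c) s t" "run M h d t Q"
    using assms unfolding run_def by blast
  then obtain u' b' t' where 2: "exec d t u' b' t'" "u' \<le> poly (ops_poly d) M"
    "b' \<le> prog_factor d * (h + 1) * u'" "all_fit h t'" "same_outside (writes d) t t'" "Q t'"
    unfolding run_def by blast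
  have "prog_factor c * (h + 1) * u \<le> (prog_factor c + prog_factor d) * (h + 1) * u"
    "prog_factor d * (h + 1) * u' \<le> (prog_factor c + prog_factor d) * (h + 1) * u'"
    by (intro mult_right_mono; simp)+
  then have "b + b' \<le> prog_factor (Seq c d) * (h + 1) * (u + u')"
    using 1(3) 2(3) by (simp add: algebra_simps)
  then show ?thesis unfolding run_def using 1 2 exec.Seq[OF 1(1) 2(1)]
    by (intro exI[of _ "u + u'"] exI[of _ "b + b'"] exI[of _ t'])
      (auto intro: same_outside_trans)
qed

lemma run_IfLess:
  assumes fit: "all_fit h s"
    and "val e s < val f s \<Longrightarrow> run M h c s Q" "\<not> val e s < val f s \<Longrightarrow> run M h d s Q"
  shows "run M h (IfLess e f c d) s Q"
proof -
  have test: "1 + exp_bits e s + exp_bits f s \<le> (1 + bits_factor e + bits_factor f) * (h + 1)"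
    using exp_bits_le[OF fit, of e] exp_bits_le[OF fit, of f] by (simp add: algebra_simps)
  have bound: "1 + exp_bits e s + exp_bits f s + b \<le>
      prog_factor (IfLess e f c d) * (h + 1) * (1 + exp_ops e + exp_ops f + u)"
    if "b \<le> k * (h + 1) * u" "k \<le> prog_factor c + prog_factor d" for b u k
  proof -
    have "1 + exp_bits e s + exp_bits f s \<le> prog_factor (IfLess e f c d) * (h + 1) * 1"
      using test by (simp add: algebra_simps)
    also have "\<dots> \<le> prog_factor (IfLess e f c d) * (h + 1) * (1 + exp_ops e + exp_ops f)"
      by (intro mult_left_mono) auto
    finally have 1: "1 + exp_bits e s + exp_bits f s
      \<le> prog_factor (IfLess e f c d) * (h + 1) * (1 + exp_ops e + exp_ops f)" .
    have "b \<le> prog_factor (IfLess e f c d) * (h + 1) * u"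
      using that(1) by (rule order_trans) (use that(2) in \<open>intro mult_right_mono; simp\<close>)
    from add_mono[OF 1 this] show ?thesis by (simp only: distrib_left)
  qed
  show ?thesis
  proof (cases "val e s < val f s")
    case True
    then obtain u b t where "exec c s u b t" "u \<le> poly (ops_poly c) M"
      "b \<le> prog_factor c * (h + 1) * u" "all_fit h t" "same_outside (writes c) s t" "Q t"
      using assms(2) unfolding run_def by blast
    then show ?thesis unfolding run_def
      using exec.IfTrue[OF True, of c u b t d] bound[of b "prog_factor c" u]
      by (intro exI[of _ "1 + exp_ops e + exp_ops f + u"]
          exI[of _ "1 + exp_bits e s + exp_bits f s + b"] exI[of _ t])
        (auto simp: same_outside_def)
  next
    case False
    then obtain u b t where "exec d s u b t" "u \<le> poly (ops_poly d) M"
      "b \<le> prog_factor d * (h + 1) * u" "all_fit h t" "same_outside (writes d) s t" "Q t"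
      using assms(3) unfolding run_def by blast
    then show ?thesis unfolding run_def
      using exec.IfFalse[OF False, of d u b t c] bound[of b "prog_factor d" u]
      by (intro exI[of _ "1 + exp_ops e + exp_ops f + u"]
          exI[of _ "1 + exp_bits e s + exp_bits f s + b"] exI[of _ t])
        (auto simp: same_outside_def)
  qed
qed

text \<open>The invariant is indexed by the number of completed iterations and the guard holds
  exactly below \<open>K\<close>, so termination and the iteration count both come from induction on
  \<open>K - k\<close>. The extra 1 in the count pays for the final failing test.\<close>

lemma exec_WhileLess_bounded:
  assumes test: "\<And>k t. k \<le> K \<Longrightarrow> Inv k t \<Longrightarrow> val e t < val f t \<longleftrightarrow> k < K"
    and fit: "\<And>k t. Inv k t \<Longrightarrow> all_fit h t"
    and step: "\<And>k t. k < K \<Longrightarrow> Inv k t \<Longrightarrow> run M h c t (Inv (Suc k))"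
    and "k \<le> K" "Inv k s"
  shows "\<exists>u b t. exec (WhileLess e f c) s u b t \<and>
    u \<le> (K - k + 1) * (1 + exp_ops e + exp_ops f + poly (ops_poly c) M) \<and>
    b \<le> prog_factor (WhileLess e f c) * (h + 1) * u \<and> same_outside (writes c) s t \<and> Inv K t"
  using \<open>k \<le> K\<close> \<open>Inv k s\<close>
proof (induction "K - k" arbitrary: k s)
  case (0 k s)
  then have k: "k = K" "\<not> val e s < val f s" using test by auto
  have "1 + exp_bits e s + exp_bits f s \<le> prog_factor (WhileLess e f c) * (h + 1) * 1"
    using exp_bits_le[OF fit[OF "0.prems"(2)], of e] exp_bits_le[OF fit[OF "0.prems"(2)], of f]
    by (simp add: algebra_simps)
  also have "\<dots> \<le> prog_factor (WhileLess e f c) * (h + 1) * (1 + exp_ops e + exp_ops f)"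
    by (intro mult_left_mono) auto
  finally show ?case using exec.WhileFalse[OF k(2), of c] k 0
    by (intro exI[of _ "1 + exp_ops e + exp_ops f"] exI[of _ "1 + exp_bits e s + exp_bits f s"]
        exI[of _ s]) (auto simp: same_outside_def)
next
  case (Suc d k s)
  then have k: "k < K" "val e s < val f s" using test by auto
  obtain u b t where 1: "exec c s u b t" "u \<le> poly (ops_poly c) M"
    "b \<le> prog_factor c * (h + 1) * u" "same_outside (writes c) s t" "Inv (Suc k) t"
    using step[OF k(1) Suc.prems(2)] unfolding run_def by blast
  have "d = K - Suc k" "Suc k \<le> K" using Suc k by auto
  from Suc.hyps(1)[OF this 1(5)] obtain u' b' t' where
    2: "exec (WhileLess e f c) t u' b' t'"
      "u' \<le> (K - Suc k + 1) * (1 + exp_ops e + exp_ops f + poly (ops_poly c) M)"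
      "b' \<le> prog_factor (WhileLess e f c) * (h + 1) * u'" "same_outside (writes c) t t'" "Inv K t'"
    by blast
  let ?P = "prog_factor (WhileLess e f c) * (h + 1)"
  have "1 + exp_bits e s + exp_bits f s \<le> ?P * 1"
    using exp_bits_le[OF fit[OF Suc.prems(2)], of e] exp_bits_le[OF fit[OF Suc.prems(2)], of f]
    by (simp add: algebra_simps)
  also have "\<dots> \<le> ?P * (1 + exp_ops e + exp_ops f)"
    by (intro mult_left_mono) auto
  finally have b1: "1 + exp_bits e s + exp_bits f s \<le> ?P * (1 + exp_ops e + exp_ops f)" .
  have "prog_factor c * (h + 1) * u \<le> ?P * u" by (intro mult_right_mono) auto
  then have b2: "b \<le> ?P * u" using 1(3) by linarith
  have bits: "1 + exp_bits e s + exp_bits f s + b + b' \<le> ?P * (1 + exp_ops e + exp_ops f + u + u')"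
    using add_mono[OF add_mono[OF b1 b2] 2(3)] by (simp only: distrib_left)
  define X where "X = 1 + exp_ops e + exp_ops f + poly (ops_poly c) M"
  have "K - k + 1 = (K - Suc k + 1) + 1" using k by simp
  then have "(K - k + 1) * X = (K - Suc k + 1) * X + X" by (simp only: distrib_right mult_1)
  moreover have "u' \<le> (K - Suc k + 1) * X" using 2(2) unfolding X_def .
  moreover have "1 + exp_ops e + exp_ops f + u \<le> X" using 1(2) unfolding X_def by simp
  ultimately have "1 + exp_ops e + exp_ops f + u + u' \<le>
      (K - k + 1) * (1 + exp_ops e + exp_ops f + poly (ops_poly c) M)"
    unfolding X_def[symmetric] by linarith
  moreover have "same_outside (writes c) s t'" using 1(4) 2(4) by (rule same_outside_trans) auto
  ultimately show ?case
    using exec.WhileTrue[OF k(2) 1(1) 2(1)] bits 2(5) by blast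
qed

definition For :: "nat \<Rightarrow> exp \<Rightarrow> prog \<Rightarrow> prog" where
  "For i e c = Seq (Assign i (Const 0) (Const 0))
     (WhileLess (Cell i (Const 0)) e
       (Seq c (Assign i (Const 0) (Add (Cell i (Const 0)) (Const 1)))))"

lemma writes_For [simp]: "writes (For i e c) = insert i (writes c)"
  by (auto simp: For_def)

text \<open>The bound expression is evaluated again before every iteration. Hence it must have the
  value \<open>K\<close> in every memory that agrees with \<open>s\<close> outside the counter and
  the arrays written by the body. \<open>indep\<close> carries the invariant over the increment of
  the counter.\<close>

lemma run_For:
  assumes s: "all_fit h s" and K: "K \<le> M" "K \<le> 2 ^ h" and i: "i \<notin> writes c"
    and bound: "\<And>t. same_outside (insert i (writes c)) s t \<Longrightarrow> val e t = of_nat K"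
    and indep: "\<And>k t v. Inv k (t(i := v)) = Inv k t"
    and init: "Inv 0 s"
    and step: "\<And>k t. k < K \<Longrightarrow> all_fit h t \<Longrightarrow> same_outside (insert i (writes c)) s t \<Longrightarrow>
      t i 0 = of_nat k \<Longrightarrow> Inv k t \<Longrightarrow> run M h c t (Inv (Suc k))"
    and fin: "\<And>t. all_fit h t \<Longrightarrow> same_outside (insert i (writes c)) s t \<Longrightarrow> Inv K t \<Longrightarrow> Q t"
  shows "run M h (For i e c) s Q"
proof -
  let ?W = "insert i (writes c)"
  let ?body = "Seq c (Assign i (Const 0) (Add (Cell i (Const 0)) (Const 1)))"
  define J where "J = (\<lambda>k t. all_fit h t \<and> same_outside ?W s t \<and> t i 0 = of_nat k \<and> Inv k t)"
  have test: "val (Cell i (Const 0)) t < val e t \<longleftrightarrow> k < K" if "J k t" for k t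
    using that bound[of t] unfolding J_def by simp
  have J_step: "run M h ?body t (J (Suc k))" if "k < K" "J k t" for k t
  proof (rule run_Seq, rule run_conseq[OF step[of k t]])
    fix r assume r: "all_fit h r" "same_outside (writes c) t r" "Inv (Suc k) r"
    have ri: "r i 0 = of_nat k" using r(2) i that(2) unfolding same_outside_def J_def by simp
    show "run M h (Assign i (Const 0) (Add (Cell i (Const 0)) (Const 1))) r (J (Suc k))"
    proof (rule run_Assign[OF r(1)])
      show "val (Add (Cell i (Const 0)) (Const 1)) r = of_nat (Suc k)" using ri by simp
      show f: "fits h (of_nat (Suc k))" using that(1) K(2) by (intro fits_of_nat) simp
      have "same_outside ?W s (r(i := v))" for v
        using that(2) r(2) unfolding J_def same_outside_def by auto
      then show "J (Suc k) (r(i := (r i)(0 := of_nat (Suc k))))"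
        using r f unfolding J_def by (simp add: indep all_fit_def)
    qed simp
  qed (use that in \<open>auto simp: J_def\<close>)
  have while: "run M h (WhileLess (Cell i (Const 0)) e ?body) t Q" if J0: "J 0 t" for t
  proof -
    obtain u b r where r: "exec (WhileLess (Cell i (Const 0)) e ?body) t u b r"
      "u \<le> (K - 0 + 1) * (1 + exp_ops (Cell i (Const 0)) + exp_ops e + poly (ops_poly ?body) M)"
      "b \<le> prog_factor (WhileLess (Cell i (Const 0)) e ?body) * (h + 1) * u"
      "same_outside (writes ?body) t r" "J K r"
      using exec_WhileLess_bounded[of K J "Cell i (Const 0)" e h M ?body 0 t] test J_step J0
      unfolding J_def by blast
    have "u \<le> (M + 1) * (1 + exp_ops (Cell i (Const 0)) + exp_ops e + poly (ops_poly ?body) M)"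
      using r(2) by (rule order_trans) (use K in \<open>intro mult_right_mono; simp\<close>)
    then have "u \<le> poly (ops_poly (WhileLess (Cell i (Const 0)) e ?body)) M"
      by (simp add: algebra_simps)
    then show ?thesis
      using r fin[of r] unfolding run_def by (auto simp: J_def)
  qed
  show ?thesis unfolding For_def
  proof (rule run_Seq, rule run_Assign[OF s])
    have "J 0 (s(i := (s i)(0 := 0)))"
      using s init unfolding J_def by (auto simp: indep all_fit_def same_outside_def)
    then show "run M h (WhileLess (Cell i (Const 0)) e ?body) (s(i := (s i)(0 := 0))) Q"
      by (rule while)
  qed simp_all
qed


subsection \<open>A lower bound on completion times\<close>

text \<open>Source \<open>i\<close> is port \<open>i\<close> and destination \<open>j\<close> is
  port \<open>N + j\<close>, with \<open>N\<close> the number of ports per side. One family of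
  \<open>2 * N\<close> ports allows a single maximum and a single loop over both sides.\<close>

definition port_load :: "coflow_instance \<Rightarrow> nat \<Rightarrow> nat \<Rightarrow> nat" where
  "port_load I p k = (if p < ports I then (\<Sum>j<ports I. demand I p j k)
     else (\<Sum>i<ports I. demand I i (p - ports I) k))"

lemma feasibleD:
  assumes "feasible I S" "i < ports I" "j < ports I" "k < coflows I"
  shows "core S k < cores I" "0 \<le> rate S i j k t" "rate S i j k t \<le> 1"
    "0 \<le> T \<Longrightarrow> rate S i j k integrable_on {0..T}"
    "\<exists>T \<ge> 0. \<forall>T' \<ge> T. sent S i j k T' = real (demand I i j k)"
proof -
  have "\<forall>k < coflows I. core S k < cores I"
    using assms(1) unfolding feasible_def by (rule conjunct1)
  then show "core S k < cores I" using assms(4) by blast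
  have *: "(\<forall>t. 0 \<le> rate S i j k t \<and> rate S i j k t \<le> 1) \<and>
      (\<forall>t < real_of_rat (release I k). rate S i j k t = 0) \<and>
      (\<forall>T \<ge> 0. rate S i j k integrable_on {0..T}) \<and>
      (\<exists>T \<ge> 0. \<forall>T' \<ge> T. sent S i j k T' = real (demand I i j k))"
    using assms(1)[unfolded feasible_def, THEN conjunct2, THEN conjunct1] assms(2-4) by blast
  show "0 \<le> rate S i j k t" "rate S i j k t \<le> 1" using * by blast+
  show "0 \<le> T \<Longrightarrow> rate S i j k integrable_on {0..T}" using * by blast
  show "\<exists>T \<ge> 0. \<forall>T' \<ge> T. sent S i j k T' = real (demand I i j k)" using * by blast
qed

lemma sent_mono:
  assumes "feasible I S" "i < ports I" "j < ports I" "k < coflows I" "0 \<le> x" "x \<le> y"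
  shows "sent S i j k x \<le> sent S i j k y"
  unfolding sent_def
  by (rule integral_subset_le) (use assms feasibleD[OF assms(1-4)] in auto)

lemma release_le_flow_completion:
  assumes "feasible I S" "i < ports I" "j < ports I" "k < coflows I"
  shows "real_of_rat (release I k) \<le> flow_completion I S i j k"
proof -
  obtain T where "\<forall>T' \<ge> T. sent S i j k T' = real (demand I i j k)"
    using feasibleD(5)[OF assms] by blast
  then have "max T (real_of_rat (release I k)) \<in>
      {T. real_of_rat (release I k) \<le> T \<and> sent S i j k T = real (demand I i j k)}"
    by simp
  then have "{T. real_of_rat (release I k) \<le> T \<and> sent S i j k T = real (demand I i j k)} \<noteq> {}"
    by blast
  then show ?thesis unfolding flow_completion_def by (rule cInf_greatest) auto
qed

text \<open>The completion time is an infimum, so some instant before \<open>T\<close> has the full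
  demand sent already. By monotonicity the amount at \<open>T\<close> lies between the amount at
  that instant and the final amount, which are equal. Strictness of the bound on \<open>T\<close>
  avoids the question whether the infimum is attained.\<close>

lemma sent_after_flow_completion:
  assumes I: "valid_instance I"
    and f: "feasible I S" "i < ports I" "j < ports I" "k < coflows I"
    and T: "flow_completion I S i j k < T"
  shows "sent S i j k T = real (demand I i j k)"
proof -
  let ?A = "{T. real_of_rat (release I k) \<le> T \<and> sent S i j k T = real (demand I i j k)}"
  obtain T0 where T0: "\<forall>T' \<ge> T0. sent S i j k T' = real (demand I i j k)"
    using feasibleD(5)[OF f] by blast
  then have "max T0 (real_of_rat (release I k)) \<in> ?A" by simp
  then have "?A \<noteq> {}" by blast
  from cInf_lessD[OF this T[unfolded flow_completion_def]] obtain a where a: "a \<in> ?A" "a < T"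
    by (rule bexE)
  have "0 \<le> release I k" using I f(4) unfolding valid_instance_def by blast
  then have "0 \<le> a" using a(1) by (intro order_trans[of 0 "real_of_rat (release I k)" a]) simp_all
  have "sent S i j k T \<ge> real (demand I i j k)"
    using sent_mono[OF f \<open>0 \<le> a\<close>, of T] a by auto
  moreover have "sent S i j k T \<le> real (demand I i j k)"
    using sent_mono[OF f, of T "max T T0"] T0 a(2) \<open>0 \<le> a\<close> by auto
  ultimately show ?thesis by simp
qed

lemma flow_completion_le_completion_time:
  assumes "i < ports I" "j < ports I"
  shows "flow_completion I S i j k \<le> completion_time I S k"
  unfolding completion_time_def
  by (rule Max_ge) (use assms in \<open>auto intro!: image_eqI[of _ _ "(i, j)"]\<close>)

lemma release_le_completion_time:
  assumes "valid_instance I" "feasible I S" "k < coflows I"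
  shows "real_of_rat (release I k) \<le> completion_time I S k"
proof -
  have "0 < ports I" using assms(1) unfolding valid_instance_def by simp
  then show ?thesis
    using release_le_flow_completion[OF assms(2) _ _ assms(3), of 0 0]
      flow_completion_le_completion_time[of 0 I 0 S k] by linarith
qed

text \<open>At any instant the transmitted flows of \<open>X\<close> lie on pairwise different
  cores, so their total rate is at most the number of cores; integration over \<open>{0..T}\<close>
  does the rest. The condition \<open>excl\<close> is what feasibility provides for the flows at one
  common port.\<close>

lemma sum_demand_le:
  assumes I: "valid_instance I" and f: "feasible I S"
    and X: "X \<subseteq> {..<ports I} \<times> {..<ports I} \<times> {..<coflows I}"
    and excl: "\<And>i j k i' j' k' t. (i, j, k) \<in> X \<Longrightarrow> (i', j', k') \<in> X \<Longrightarrow> core S k = core S k' \<Longrightarrow>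
      rate S i j k t > 0 \<Longrightarrow> rate S i' j' k' t > 0 \<Longrightarrow> (i, j, k) = (i', j', k')"
    and T: "0 \<le> T" "\<And>i j k. (i, j, k) \<in> X \<Longrightarrow> completion_time I S k < T"
  shows "(\<Sum>(i, j, k)\<in>X. real (demand I i j k)) \<le> real (cores I) * T"
proof -
  have fin: "finite X" using X finite_subset by blast
  define g where "g = (\<lambda>(i, j, k). rate S i j k)"
  have bnd: "0 \<le> g x t" "g x t \<le> 1" "g x integrable_on {0..T}" if "x \<in> X" for x t
    using that X feasibleD(2,3,4)[OF f] T(1) unfolding g_def by auto
  have pointwise: "(\<Sum>x\<in>X. g x t) \<le> real (cores I)" for t
  proof -
    define P where "P = {x \<in> X. g x t > 0}"
    have "(\<Sum>x\<in>X. g x t) = (\<Sum>x\<in>P. g x t)"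
      using fin bnd(1) unfolding P_def by (intro sum.mono_neutral_right) (auto simp: less_le)
    also have "\<dots> \<le> (\<Sum>x\<in>P. 1)" using bnd(2) unfolding P_def by (intro sum_mono) auto
    also have "\<dots> = real (card P)" by simp
    also have "card P \<le> card {..<cores I}"
    proof (rule card_inj_on_le)
      show "inj_on (\<lambda>(i, j, k). core S k) P"
        using excl unfolding P_def g_def inj_on_def by fastforce
      show "(\<lambda>(i, j, k). core S k) ` P \<subseteq> {..<cores I}"
        using X f unfolding P_def feasible_def by auto
    qed simp
    finally show ?thesis by simp
  qed
  have "real (demand I i j k) = integral {0..T} (g (i, j, k))" if "(i, j, k) \<in> X" for i j k
  proof -
    have "i < ports I" "j < ports I" "k < coflows I" using that X by auto
    moreover from this have "flow_completion I S i j k < T"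
      using flow_completion_le_completion_time[of i I j S k] T(2)[OF that] by linarith
    ultimately show ?thesis
      using sent_after_flow_completion[OF I f] unfolding g_def sent_def by simp
  qed
  then have "(\<Sum>(i, j, k)\<in>X. real (demand I i j k)) = (\<Sum>x\<in>X. integral {0..T} (g x))"
    by (intro sum.cong) auto
  also have "\<dots> = integral {0..T} (\<lambda>t. \<Sum>x\<in>X. g x t)"
    using integral_sum[OF fin, of g "{0..T}"] bnd(3) by simp
  also have "\<dots> \<le> integral {0..T} (\<lambda>t. real (cores I))"
    by (rule integral_le) (use fin bnd pointwise in \<open>auto intro!: integrable_sum\<close>)
  also have "\<dots> = real (cores I) * T" using T(1) by simp
  finally show ?thesis .
qed

lemma sum_port_load_le:
  assumes I: "valid_instance I" and f: "feasible I S" and p: "p < 2 * ports I"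
    and U: "U \<subseteq> {..<coflows I}"
    and T: "0 \<le> T" "\<And>k. k \<in> U \<Longrightarrow> completion_time I S k < T"
  shows "(\<Sum>k\<in>U. real (port_load I p k)) \<le> real (cores I) * T"
proof (cases "p < ports I")
  case True
  let ?X = "{p} \<times> {..<ports I} \<times> U"
  have "(\<Sum>k\<in>U. real (port_load I p k)) = (\<Sum>k\<in>U. \<Sum>j<ports I. real (demand I p j k))"
    using True by (simp add: port_load_def)
  also have "\<dots> = (\<Sum>(i, j, k)\<in>?X. real (demand I i j k))"
    by (subst sum.swap) (simp add: sum.cartesian_product[symmetric])
  also have "\<dots> \<le> real (cores I) * T"
  proof (rule sum_demand_le[OF I f _ _ T(1)])
    show "(i, j, k) = (i', j', k')" if "(i, j, k) \<in> ?X" "(i', j', k') \<in> ?X"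
      "core S k = core S k'" "rate S i j k t > 0" "rate S i' j' k' t > 0" for i j k i' j' k' t
    proof -
      have "i = p" "i' = p" "j < ports I" "j' < ports I" "k < coflows I" "k' < coflows I"
        using that U by auto
      then show ?thesis using f that True unfolding feasible_def by metis
    qed
  qed (use True U T(2) in auto)
  finally show ?thesis .
next
  case False
  define q where "q = p - ports I"
  have q: "q < ports I" using p False unfolding q_def by simp
  let ?X = "{..<ports I} \<times> {q} \<times> U"
  have "(\<Sum>k\<in>U. real (port_load I p k)) = (\<Sum>k\<in>U. \<Sum>i<ports I. real (demand I i q k))"
    using False by (simp add: port_load_def q_def)
  also have "\<dots> = (\<Sum>(i, j, k)\<in>?X. real (demand I i j k))"
    by (subst sum.swap) (simp add: sum.cartesian_product[symmetric])
  also have "\<dots> \<le> real (cores I) * T"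
  proof (rule sum_demand_le[OF I f _ _ T(1)])
    show "(i, j, k) = (i', j', k')" if "(i, j, k) \<in> ?X" "(i', j', k') \<in> ?X"
      "core S k = core S k'" "rate S i j k t > 0" "rate S i' j' k' t > 0" for i j k i' j' k' t
    proof -
      have "j = q" "j' = q" "i < ports I" "i' < ports I" "k < coflows I" "k' < coflows I"
        using that U by auto
      then show ?thesis using f that q unfolding feasible_def by metis
    qed
  qed (use q U T(2) in auto)
  finally show ?thesis .
qed

text \<open>Every pair of indices is counted in at least one of its two orders.\<close>

lemma square_sum_le_weighted_sum:
  fixes a C :: "'a \<Rightarrow> real"
  assumes fin: "finite U" and a: "\<And>k. k \<in> U \<Longrightarrow> 0 \<le> a k"
    and le: "\<And>k. k \<in> U \<Longrightarrow> (\<Sum>l | l \<in> U \<and> C l \<le> C k. a l) \<le> m * C k"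
  shows "(\<Sum>k\<in>U. a k)\<^sup>2 \<le> (\<Sum>k\<in>U. a k * (2 * m * C k))"
proof -
  let ?A = "\<Sum>k\<in>U. \<Sum>l\<in>U. if C l \<le> C k then a k * a l else 0"
  have "(\<Sum>k\<in>U. a k)\<^sup>2 = (\<Sum>k\<in>U. \<Sum>l\<in>U. a k * a l)"
    by (simp add: power2_eq_square sum_product)
  also have "\<dots> \<le> (\<Sum>k\<in>U. \<Sum>l\<in>U. (if C l \<le> C k then a k * a l else 0) +
      (if C k \<le> C l then a k * a l else 0))"
    using a by (intro sum_mono) auto
  also have "\<dots> = ?A + (\<Sum>k\<in>U. \<Sum>l\<in>U. if C k \<le> C l then a k * a l else 0)"
    by (simp add: sum.distrib)
  also have "(\<Sum>k\<in>U. \<Sum>l\<in>U. if C k \<le> C l then a k * a l else 0) = ?A"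
    by (subst sum.swap) (simp add: mult.commute cong: if_cong)
  finally have "(\<Sum>k\<in>U. a k)\<^sup>2 \<le> 2 * ?A" by simp
  moreover have "?A = (\<Sum>k\<in>U. a k * (\<Sum>l | l \<in> U \<and> C l \<le> C k. a l))"
  proof (rule sum.cong[OF refl])
    fix k
    have "(\<Sum>l | l \<in> U \<and> C l \<le> C k. a l) = (\<Sum>l\<in>U. if C l \<le> C k then a l else 0)"
      using sum.inter_filter[OF fin, of a "\<lambda>l. C l \<le> C k"] by simp
    then show "(\<Sum>l\<in>U. if C l \<le> C k then a k * a l else 0)
        = a k * (\<Sum>l | l \<in> U \<and> C l \<le> C k. a l)"
      by (simp add: sum_distrib_left if_distrib cong: if_cong)
  qed
  moreover have "\<dots> \<le> (\<Sum>k\<in>U. a k * (m * C k))"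
    by (intro sum_mono mult_left_mono le a)
  moreover have "(\<Sum>k\<in>U. a k * (2 * m * C k)) = 2 * (\<Sum>k\<in>U. a k * (m * C k))"
    by (simp add: sum_distrib_left algebra_simps)
  ultimately show ?thesis by simp
qed

text \<open>All that the analysis of the order uses about a competing schedule, with
  \<open>c k\<close> standing for \<open>2 * m * C k\<close>. Quantifying over such \<open>c\<close>
  keeps schedules out of the local-ratio argument; the subtracted ratios act as multipliers of these
  inequalities.\<close>

definition dual_bound :: "coflow_instance \<Rightarrow> (nat \<Rightarrow> real) \<Rightarrow> bool" where
  "dual_bound I c \<longleftrightarrow> (\<forall>k<coflows I. 0 \<le> c k) \<and> (\<forall>p<2 * ports I. \<forall>U\<subseteq>{..<coflows I}.
     (\<Sum>k\<in>U. real (port_load I p k))\<^sup>2 \<le> (\<Sum>k\<in>U. real (port_load I p k) * c k))"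

lemma dual_bound_completion_time:
  assumes I: "valid_instance I" and f: "feasible I S"
  shows "dual_bound I (\<lambda>k. 2 * real (cores I) * completion_time I S k)"
  unfolding dual_bound_def
proof (intro conjI allI impI)
  have nonneg: "0 \<le> completion_time I S k" if "k < coflows I" for k
  proof -
    have "0 \<le> real_of_rat (release I k)" using I that unfolding valid_instance_def by simp
    then show ?thesis using release_le_completion_time[OF I f that] by linarith
  qed
  then show "0 \<le> 2 * real (cores I) * completion_time I S k" if "k < coflows I" for k
    using that by simp
  fix p U assume p: "p < 2 * ports I" and U: "U \<subseteq> {..<coflows I}"
  show "(\<Sum>k\<in>U. real (port_load I p k))\<^sup>2
    \<le> (\<Sum>k\<in>U. real (port_load I p k) * (2 * real (cores I) * completion_time I S k))"
  proof (rule square_sum_le_weighted_sum)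
    show "finite U" using U finite_subset by blast
    fix k assume k: "k \<in> U"
    have m: "0 < real (cores I)" using I unfolding valid_instance_def by simp
    show "(\<Sum>l | l \<in> U \<and> completion_time I S l \<le> completion_time I S k. real (port_load I p l))
      \<le> real (cores I) * completion_time I S k" (is "?L \<le> _")
    \<comment> \<open>The volume bound needs a deadline strictly after all completion times
      involved. A slack of \<open>e / m\<close> in the deadline costs only \<open>e\<close> in the
      bound.\<close>
    proof (rule field_le_epsilon)
      fix e :: real assume e: "0 < e"
      have "?L \<le> real (cores I) * (completion_time I S k + e / real (cores I))"
      proof (rule sum_port_load_le[OF I f p])
        show "0 \<le> completion_time I S k + e / real (cores I)"
          using nonneg[of k] k U e m by auto
        have "0 < e / real (cores I)" using e m by simp
        then show "completion_time I S l < completion_time I S k + e / real (cores I)"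
          if "l \<in> {l \<in> U. completion_time I S l \<le> completion_time I S k}" for l
          using that by simp
      qed (use U in auto)
      also have "\<dots> = real (cores I) * completion_time I S k + e"
        using m by (simp add: field_simps)
      finally show "?L \<le> real (cores I) * completion_time I S k + e" .
    qed
  qed simp
qed


subsection \<open>The primal-dual order\<close>

definition peak_load :: "coflow_instance \<Rightarrow> nat set \<Rightarrow> nat" where
  "peak_load I U = Max ((\<lambda>p. \<Sum>k\<in>U. port_load I p k) ` {..<2 * ports I})"

lemma port_load_le_peak_load:
  "p < 2 * ports I \<Longrightarrow> (\<Sum>k\<in>U. port_load I p k) \<le> peak_load I U"
  unfolding peak_load_def by (rule Max_ge) auto

lemma peak_loadI:
  assumes "p < 2 * ports I" "\<And>q. q < 2 * ports I \<Longrightarrow> (\<Sum>k\<in>U. port_load I q k) \<le> (\<Sum>k\<in>U. port_load I p k)"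
  shows "(\<Sum>k\<in>U. port_load I p k) = peak_load I U"
  unfolding peak_load_def using assms by (intro Max_eqI[symmetric]) auto

lemma peak_load_mono:
  assumes "0 < ports I" "finite V" "U \<subseteq> V"
  shows "peak_load I U \<le> peak_load I V"
  unfolding peak_load_def[of I U]
proof (rule Max.boundedI)
  show "a \<le> peak_load I V" if a: "a \<in> (\<lambda>p. \<Sum>k\<in>U. port_load I p k) ` {..<2 * ports I}" for a
  proof -
    obtain p where p: "p < 2 * ports I" "a = (\<Sum>k\<in>U. port_load I p k)" using a by auto
    have "a \<le> (\<Sum>k\<in>V. port_load I p k)" unfolding p(2) by (rule sum_mono2) (use assms in auto)
    then show ?thesis using port_load_le_peak_load[OF p(1), of V] by linarith
  qed
qed (use assms in \<open>auto simp: lessThan_empty_iff\<close>)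

text \<open>The positions from \<open>m\<close> on of the order \<open>\<pi>\<close> are final and \<open>w\<close> are the residual weights of
  the other coflows. The part of the weight already charged is bounded by the current peak load.\<close>

definition order_inv :: "coflow_instance \<Rightarrow> nat \<Rightarrow> (nat \<Rightarrow> nat) \<Rightarrow> (nat \<Rightarrow> real) \<Rightarrow> bool" where
  "order_inv I m \<pi> w \<longleftrightarrow> bij_betw \<pi> {..<coflows I} {..<coflows I} \<and>
     (\<forall>k\<in>\<pi> ` {..<m}. 0 \<le> w k \<and> w k \<le> real_of_rat (weight I k)) \<and>
     (\<forall>c. dual_bound I c \<longrightarrow>
        (\<Sum>k\<in>\<pi> ` {..<m}. w k * c k + (real_of_rat (weight I k) - w k) * real (peak_load I (\<pi> ` {..<m}))) +
        (\<Sum>x\<in>{m..<coflows I}. real_of_rat (weight I (\<pi> x)) * real (peak_load I (\<pi> ` {..<Suc x})))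
        \<le> (\<Sum>k<coflows I. real_of_rat (weight I k) * c k))"

lemma order_inv_init:
  assumes "valid_instance I"
  shows "order_inv I (coflows I) id (\<lambda>k. real_of_rat (weight I k))"
  using assms unfolding order_inv_def valid_instance_def by (auto simp: less_imp_le)

text \<open>Write \<open>L\<close> for the load at \<open>p\<close> and \<open>V\<close> for the
  peak load, so \<open>L\<close> sums to \<open>V\<close> over the remaining coflows. Replacing
  \<open>w\<close> by \<open>w' + \<theta> * L\<close> in the old bound leaves the surplus
  \<open>\<theta> * (sum of L * c) - \<theta> * V * V\<close>, which is nonnegative by
  \<open>dual_bound\<close>. The coflow \<open>\<pi> m\<close> can then leave the sum with its full
  weight charged at \<open>V\<close>, and for the others \<open>V\<close> may be lowered to the peak
  load of the smaller set.\<close>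

lemma order_inv_step:
  assumes I: "valid_instance I" and inv: "order_inv I (Suc m) \<pi> w" and m: "m < coflows I"
    and p: "p < 2 * ports I"
    and peak: "(\<Sum>k\<in>\<pi> ` {..<Suc m}. port_load I p k) = peak_load I (\<pi> ` {..<Suc m})"
    and \<theta>: "0 \<le> \<theta>"
    and w': "\<And>k. k \<in> \<pi> ` {..<Suc m} \<Longrightarrow> w' k = w k - \<theta> * real (port_load I p k)"
    and nonneg: "\<And>k. k \<in> \<pi> ` {..<Suc m} \<Longrightarrow> 0 \<le> w' k"
    and tight: "w' (\<pi> m) = 0 \<or> peak_load I (\<pi> ` {..<Suc m}) = 0"
  shows "order_inv I m \<pi> w'"
proof -
  let ?U = "\<pi> ` {..<Suc m}" and ?U' = "\<pi> ` {..<m}" and ?w0 = "\<lambda>k. real_of_rat (weight I k)"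
  let ?L = "\<lambda>k. real (port_load I p k)"
  define V where "V = real (peak_load I ?U)"
  define V' where "V' = real (peak_load I ?U')"
  have bij: "bij_betw \<pi> {..<coflows I} {..<coflows I}" using inv unfolding order_inv_def by blast
  have "inj_on \<pi> {..<Suc m}" using bij m unfolding bij_betw_def by (auto intro: inj_on_subset)
  then have ni: "\<pi> m \<notin> ?U'" using inj_onD[of \<pi> "{..<Suc m}" m] by fastforce
  have ins: "?U = insert (\<pi> m) ?U'" by (simp add: lessThan_Suc)
  have sub: "?U \<subseteq> {..<coflows I}" using bij m unfolding bij_betw_def by auto
  have w0: "w' k \<le> ?w0 k" if "k \<in> ?U" for k
  proof -
    have "w k \<le> ?w0 k" using inv that unfolding order_inv_def by blast
    moreover have "0 \<le> \<theta> * ?L k" using \<theta> by simp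
    ultimately show ?thesis using w'[OF that] by linarith
  qed
  have VV: "V' \<le> V" unfolding V_def V'_def
    using I peak_load_mono[of I ?U ?U'] ins unfolding valid_instance_def by auto
  have sumL: "(\<Sum>k\<in>?U. ?L k) = V" unfolding V_def peak[symmetric] by simp
  have step: "(\<Sum>k\<in>?U'. w' k * c k + (?w0 k - w' k) * V') + ?w0 (\<pi> m) * V
      \<le> (\<Sum>k\<in>?U. w k * c k + (?w0 k - w k) * V)" if c: "dual_bound I c" for c
  proof -
    have "0 \<le> c (\<pi> m)" using c sub ins unfolding dual_bound_def by auto
    have sq: "V * V \<le> (\<Sum>k\<in>?U. ?L k * c k)"
      using c p sub unfolding dual_bound_def sumL[symmetric] by (simp add: power2_eq_square)
    have "(\<Sum>k\<in>?U'. w' k * c k + (?w0 k - w' k) * V') \<le> (\<Sum>k\<in>?U'. w' k * c k + (?w0 k - w' k) * V)"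
      using VV w0 by (intro sum_mono add_left_mono mult_left_mono) auto
    moreover have "(\<Sum>k\<in>?U. w' k * c k + (?w0 k - w' k) * V)
        = w' (\<pi> m) * c (\<pi> m) + (?w0 (\<pi> m) - w' (\<pi> m)) * V + (\<Sum>k\<in>?U'. w' k * c k + (?w0 k - w' k) * V)"
      unfolding ins by (subst sum.insert) (use ni in auto)
    \<comment> \<open>Either no weight of \<open>\<pi> m\<close> is left or the peak load vanishes.
      In both cases nothing of this coflow remains uncharged at \<open>V\<close>.\<close>
    moreover have "w' (\<pi> m) * V = 0" using tight unfolding V_def by auto
    moreover have "0 \<le> w' (\<pi> m) * c (\<pi> m)" using nonneg[of "\<pi> m"] \<open>0 \<le> c (\<pi> m)\<close> by auto
    moreover have "(\<Sum>k\<in>?U. w k * c k + (?w0 k - w k) * V)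
        = (\<Sum>k\<in>?U. w' k * c k + (?w0 k - w' k) * V + \<theta> * (?L k * c k) - \<theta> * V * ?L k)"
      by (rule sum.cong) (simp_all add: w' algebra_simps)
    moreover have "\<dots> = (\<Sum>k\<in>?U. w' k * c k + (?w0 k - w' k) * V) + \<theta> * (\<Sum>k\<in>?U. ?L k * c k) - \<theta> * V * V"
      by (simp add: sum.distrib sum_subtractf sum_distrib_left[symmetric] sumL)
    moreover have "\<theta> * (V * V) \<le> \<theta> * (\<Sum>k\<in>?U. ?L k * c k)" by (rule mult_left_mono[OF sq \<theta>])
    moreover have "(?w0 (\<pi> m) - w' (\<pi> m)) * V = ?w0 (\<pi> m) * V - w' (\<pi> m) * V"
      by (rule left_diff_distrib)
    moreover have "\<theta> * V * V = \<theta> * (V * V)" by (rule mult.assoc)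
    ultimately show ?thesis by linarith
  qed
  have split: "{m..<coflows I} = insert m {Suc m..<coflows I}" using m by auto
  have "(\<Sum>k\<in>?U'. w' k * c k + (?w0 k - w' k) * V') +
      (\<Sum>x\<in>{m..<coflows I}. ?w0 (\<pi> x) * real (peak_load I (\<pi> ` {..<Suc x})))
      \<le> (\<Sum>k<coflows I. ?w0 k * c k)" if c: "dual_bound I c" for c
  proof -
    have "(\<Sum>k\<in>?U. w k * c k + (?w0 k - w k) * V) +
        (\<Sum>x\<in>{Suc m..<coflows I}. ?w0 (\<pi> x) * real (peak_load I (\<pi> ` {..<Suc x})))
        \<le> (\<Sum>k<coflows I. ?w0 k * c k)"
      using inv c unfolding order_inv_def V_def by blast
    then show ?thesis using step[OF c] unfolding split V_def by simp
  qed
  then show ?thesis unfolding order_inv_def V'_def[symmetric]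
    using bij nonneg w0 ins by (auto simp: V'_def)
qed

lemma image_swap:
  fixes m x :: nat
  assumes "b \<le> m" "m < x"
  shows "(\<pi>(b := \<pi> m, m := \<pi> b)) ` {..<x} = \<pi> ` {..<x}"
proof -
  define \<rho> where "\<rho> = \<pi>(b := \<pi> m, m := \<pi> b)"
  have "{..<x} = {b, m} \<union> ({..<x} - {b, m})" using assms by auto
  then have "\<rho> ` {..<x} = \<rho> ` {b, m} \<union> \<rho> ` ({..<x} - {b, m})"
    "\<pi> ` {..<x} = \<pi> ` {b, m} \<union> \<pi> ` ({..<x} - {b, m})" by (metis image_Un)+
  moreover have "\<rho> ` {b, m} = \<pi> ` {b, m}" unfolding \<rho>_def by auto
  moreover have "\<rho> ` ({..<x} - {b, m}) = \<pi> ` ({..<x} - {b, m})"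
    unfolding \<rho>_def by (intro image_cong) auto
  ultimately show ?thesis unfolding \<rho>_def[symmetric] by (simp only:)
qed

text \<open>Both exchanged positions lie in the prefix of length \<open>Suc m\<close>. This prefix
  and all longer ones are unchanged as sets, and the invariant sees the undecided positions only
  through them.\<close>

lemma order_inv_swap:
  assumes inv: "order_inv I (Suc m) \<pi> w" and m: "m < coflows I" "b \<le> m"
  shows "order_inv I (Suc m) (\<pi>(b := \<pi> m, m := \<pi> b)) w"
proof -
  define \<rho> where "\<rho> = \<pi>(b := \<pi> m, m := \<pi> b)"
  have im: "\<rho> ` {..<x} = \<pi> ` {..<x}" if "m < x" for x
    unfolding \<rho>_def by (rule image_swap[OF m(2) that])
  have bij: "bij_betw \<pi> {..<coflows I} {..<coflows I}" using inv unfolding order_inv_def by blast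
  have "inj_on \<rho> {..<coflows I}"
    using bij m unfolding bij_betw_def inj_on_def \<rho>_def by (auto split: if_splits)
  then have bij': "bij_betw \<rho> {..<coflows I} {..<coflows I}"
    using im[OF m(1)] bij unfolding bij_betw_def by simp
  have fixed: "(\<Sum>x\<in>{Suc m..<coflows I}. real_of_rat (weight I (\<rho> x)) * real (peak_load I (\<rho> ` {..<Suc x})))
      = (\<Sum>x\<in>{Suc m..<coflows I}. real_of_rat (weight I (\<pi> x)) * real (peak_load I (\<pi> ` {..<Suc x})))"
  proof (rule sum.cong[OF refl])
    fix x assume "x \<in> {Suc m..<coflows I}"
    moreover from this have "\<rho> x = \<pi> x" using m unfolding \<rho>_def by auto
    ultimately show "real_of_rat (weight I (\<rho> x)) * real (peak_load I (\<rho> ` {..<Suc x}))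
      = real_of_rat (weight I (\<pi> x)) * real (peak_load I (\<pi> ` {..<Suc x}))" by (simp add: im)
  qed
  have imm: "\<rho> ` {..<Suc m} = \<pi> ` {..<Suc m}" by (rule im) simp
  show ?thesis using inv bij' unfolding order_inv_def \<rho>_def[symmetric] imm fixed by blast
qed

lemma order_inv_final:
  assumes "order_inv I 0 \<pi> w" "dual_bound I c"
  shows "(\<Sum>x<coflows I. real_of_rat (weight I (\<pi> x)) * real (peak_load I (\<pi> ` {..<Suc x})))
    \<le> (\<Sum>k<coflows I. real_of_rat (weight I k) * c k)"
  using assms unfolding order_inv_def by (auto simp: atLeast0LessThan)


subsection \<open>Preemptive list scheduling of flows\<close>

text \<open>Flows are numbered by decreasing priority. The set of active flows is recomputed greedily
  whenever an active flow is finished or a flow is released.\<close>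

locale list_scheduling =
  fixes F :: nat and src dst :: "nat \<Rightarrow> nat" and d :: "nat \<Rightarrow> nat" and r :: "nat \<Rightarrow> rat"
  assumes r_nonneg: "\<And>z. z < F \<Longrightarrow> 0 \<le> r z"
begin

definition ready :: "rat \<Rightarrow> (nat \<Rightarrow> rat) \<Rightarrow> nat \<Rightarrow> bool" where
  "ready T l z \<longleftrightarrow> 0 < l z \<and> r z \<le> T"

text \<open>With flows as edges between sources and destinations, this is the greedy matching among
  the candidates \<open>ok\<close>, built by decreasing priority. The length of the scan is a
  parameter so that the loop of the program can be followed flow by flow.\<close>

primrec chosen :: "(nat \<Rightarrow> bool) \<Rightarrow> nat \<Rightarrow> nat set" where
  "chosen ok 0 = {}"
| "chosen ok (Suc z) = (if ok z \<and> (\<forall>y\<in>chosen ok z. src y \<noteq> src z \<and> dst y \<noteq> dst z)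
     then insert z (chosen ok z) else chosen ok z)"

lemma chosenD: "z \<in> chosen ok m \<Longrightarrow> z < m \<and> ok z"
  by (induction m) (auto split: if_splits intro: less_SucI)

lemma finite_chosen [simp]: "finite (chosen ok m)"
  by (induction m) auto

lemma chosen_mono: "m \<le> m' \<Longrightarrow> chosen ok m \<subseteq> chosen ok m'"
  by (induction m' rule: dec_induct) auto

text \<open>The decision on \<open>y\<close> depends only on flows before it. A flag written during
  the scan is therefore final.\<close>

lemma chosen_stable:
  assumes "y < m" "m \<le> m'"
  shows "y \<in> chosen ok m' \<longleftrightarrow> y \<in> chosen ok m"
  using assms(2) by (induction m' rule: dec_induct) (use assms(1) in auto)

lemma chosen_no_conflict:
  "y \<in> chosen ok m \<Longrightarrow> z \<in> chosen ok m \<Longrightarrow> src y = src z \<or> dst y = dst z \<Longrightarrow> y = z"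
  by (induction m) (auto split: if_splits; metis)+

text \<open>Maximality of the greedy matching, in the form that pays for waiting: time lost by
  \<open>z\<close> is spent on work at one of its own two ports with at least its priority. The case
  \<open>y = z\<close> is progress of \<open>z\<close> itself.\<close>

lemma chosen_blocked:
  assumes "z < m" "ok z"
  shows "\<exists>y\<in>chosen ok m. y \<le> z \<and> (src y = src z \<or> dst y = dst z)"
proof (cases "z \<in> chosen ok (Suc z)")
  case True
  then show ?thesis using chosen_mono[of "Suc z" m ok] assms(1) by auto
next
  case False
  then obtain y where y: "y \<in> chosen ok z" "src y = src z \<or> dst y = dst z"
    using assms(2) by (auto split: if_splits)
  moreover have "y \<in> chosen ok m" using y(1) chosen_mono[of z m ok] assms(1) by auto
  ultimately show ?thesis using chosenD[OF y(1)] by (intro bexI[of _ y]) auto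
qed

definition gaps :: "rat \<Rightarrow> (nat \<Rightarrow> rat) \<Rightarrow> nat \<Rightarrow> rat set" where
  "gaps T l m = l ` chosen (ready T l) m \<union> (\<lambda>z. r z - T) ` {z. z < m \<and> 0 < l z \<and> T < r z}"

text \<open>The value 0 for an empty set of candidates is unambiguous because all candidates are
  positive. The program uses the same 0 for "no candidate yet", and \<open>gap_insert\<close> has
  the form of its update.\<close>

definition gap :: "rat \<Rightarrow> (nat \<Rightarrow> rat) \<Rightarrow> nat \<Rightarrow> rat" where
  "gap T l m = (if gaps T l m = {} then 0 else Min (gaps T l m))"

lemma finite_gaps [simp]: "finite (gaps T l m)"
  unfolding gaps_def by simp

lemma gaps_pos: "x \<in> gaps T l m \<Longrightarrow> 0 < x"
  unfolding gaps_def by (auto simp: ready_def dest: chosenD)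

lemma gap_in: "gaps T l m \<noteq> {} \<Longrightarrow> gap T l m \<in> gaps T l m"
  unfolding gap_def by simp

lemma gap_le: "x \<in> gaps T l m \<Longrightarrow> gap T l m \<le> x"
  unfolding gap_def by auto

lemma gap_nonneg: "0 \<le> gap T l m"
  using gap_in[of T l m] gaps_pos[of _ T l m] unfolding gap_def by (auto simp: less_imp_le)

lemma gap_insert:
  assumes "gaps T l (Suc m) = insert v (gaps T l m)"
  shows "gap T l (Suc m) = (if 0 < gap T l m \<and> gap T l m \<le> v then gap T l m else v)"
proof (cases "gaps T l m = {}")
  case True
  then show ?thesis using assms unfolding gap_def by simp
next
  case False
  then have "0 < gap T l m" using gaps_pos gap_in by blast
  moreover have "gap T l (Suc m) = min v (gap T l m)"
    using assms False unfolding gap_def by simp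
  ultimately show ?thesis by auto
qed

lemma gaps_Suc_unreleased:
  "0 < l m \<Longrightarrow> T < r m \<Longrightarrow> gaps T l (Suc m) = insert (r m - T) (gaps T l m)"
  unfolding gaps_def by (auto simp: ready_def less_Suc_eq)

lemma gaps_Suc_chosen:
  assumes "0 < l m" "r m \<le> T" "\<forall>y\<in>chosen (ready T l) m. src y \<noteq> src m \<and> dst y \<noteq> dst m"
  shows "gaps T l (Suc m) = insert (l m) (gaps T l m)"
proof -
  have "{z. z < Suc m \<and> 0 < l z \<and> T < r z} = {z. z < m \<and> 0 < l z \<and> T < r z}"
    using assms(2) by (auto simp: less_Suc_eq)
  then show ?thesis using assms unfolding gaps_def by (simp add: ready_def)
qed

lemma gap_Suc_same:
  assumes "\<not> 0 < l m \<or> r m \<le> T \<and> \<not> (\<forall>y\<in>chosen (ready T l) m. src y \<noteq> src m \<and> dst y \<noteq> dst m)"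
  shows "gap T l (Suc m) = gap T l m"
proof -
  have "{z. z < Suc m \<and> 0 < l z \<and> T < r z} = {z. z < m \<and> 0 < l z \<and> T < r z}"
    using assms by (auto simp: less_Suc_eq)
  moreover have "chosen (ready T l) (Suc m) = chosen (ready T l) m"
    using assms by (auto simp: ready_def)
  ultimately have "gaps T l (Suc m) = gaps T l m" unfolding gaps_def by (simp only:)
  then show ?thesis unfolding gap_def by (simp only:)
qed

text \<open>The current time and the amounts still to be transmitted after each event.\<close>

primrec state :: "nat \<Rightarrow> rat \<times> (nat \<Rightarrow> rat)" where
  "state 0 = (0, \<lambda>z. of_nat (d z))"
| "state (Suc e) = (let T = fst (state e); l = snd (state e); g = gap T l F in
     (T + g, \<lambda>z. if z \<in> chosen (ready T l) F then l z - g else l z))"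

definition time :: "nat \<Rightarrow> rat" where "time e = fst (state e)"
definition left :: "nat \<Rightarrow> nat \<Rightarrow> rat" where "left e = snd (state e)"
definition active :: "nat \<Rightarrow> nat set" where "active e = chosen (ready (time e) (left e)) F"
definition len :: "nat \<Rightarrow> rat" where "len e = gap (time e) (left e) F"

lemma time_0 [simp]: "time 0 = 0" and left_0 [simp]: "left 0 z = of_nat (d z)"
  by (simp_all add: time_def left_def)

lemma time_Suc: "time (Suc e) = time e + len e"
  by (simp add: time_def left_def len_def Let_def)

lemma left_Suc: "left (Suc e) z = (if z \<in> active e then left e z - len e else left e z)"
  by (simp add: time_def left_def len_def active_def Let_def)

lemma len_nonneg: "0 \<le> len e"
  unfolding len_def by (rule gap_nonneg)

lemma time_mono: "e \<le> e' \<Longrightarrow> time e \<le> time e'"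
  by (induction e' rule: dec_induct) (auto simp: time_Suc intro: order_trans add_increasing2 len_nonneg)

lemma time_nonneg: "0 \<le> time e"
  using time_mono[of 0 e] by simp

lemma activeD:
  assumes "z \<in> active e"
  shows "z < F" "0 < left e z" "r z \<le> time e" "len e \<le> left e z"
proof -
  show "z < F" "0 < left e z" "r z \<le> time e"
    using assms chosenD unfolding active_def ready_def by blast+
  show "len e \<le> left e z"
    unfolding len_def by (rule gap_le) (use assms in \<open>auto simp: gaps_def active_def\<close>)
qed

lemma active_no_conflict:
  "y \<in> active e \<Longrightarrow> z \<in> active e \<Longrightarrow> src y = src z \<or> dst y = dst z \<Longrightarrow> y = z"
  unfolding active_def by (rule chosen_no_conflict)

lemma time_Suc_le_release:
  assumes "z < F" "0 < left e z" "time e < r z"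
  shows "time (Suc e) \<le> r z"
proof -
  have "len e \<le> r z - time e"
    unfolding len_def by (rule gap_le) (use assms in \<open>auto simp: gaps_def\<close>)
  then show ?thesis by (simp add: time_Suc)
qed

lemma left_nonneg: "0 \<le> left e z"
  by (induction e) (auto simp: left_Suc activeD)

lemma left_Suc_le: "left (Suc e) z \<le> left e z"
  by (simp add: left_Suc len_nonneg)

lemma left_antimono: "e \<le> e' \<Longrightarrow> left e' z \<le> left e z"
  by (induction e' rule: dec_induct) (auto intro: order_trans left_Suc_le)

lemma left_le: "left e z \<le> of_nat (d z)"
  using left_antimono[of 0 e z] by simp

lemma left_eq: "left e z = of_nat (d z) - (\<Sum>e' | e' < e \<and> z \<in> active e'. len e')"
proof (induction e)
  case (Suc e)
  have "{e'. e' < Suc e \<and> z \<in> active e'} =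
      (if z \<in> active e then insert e {e'. e' < e \<and> z \<in> active e'} else {e'. e' < e \<and> z \<in> active e'})"
    by (auto simp: less_Suc_eq)
  then show ?case using Suc by (simp add: left_Suc)
qed simp

lemma gaps_nonempty:
  assumes "z < F" "0 < left e z"
  shows "gaps (time e) (left e) F \<noteq> {}"
proof (cases "time e < r z")
  case True
  then show ?thesis using assms unfolding gaps_def by auto
next
  case False
  then have "ready (time e) (left e) z" using assms unfolding ready_def by simp
  then obtain y where "y \<in> chosen (ready (time e) (left e)) F" using chosen_blocked assms(1) by blast
  then show ?thesis unfolding gaps_def by blast
qed

section \<open>Termination of the event sequence\<close>

definition pending :: "nat \<Rightarrow> nat set" where "pending e = {z. z < F \<and> 0 < left e z}"
definition unreleased :: "nat \<Rightarrow> nat set" where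
  "unreleased e = {z. z < F \<and> 0 < left e z \<and> time e < r z}"

text \<open>The gap is attained by some candidate. If that is a chosen flow, the flow ends and
  leaves \<open>pending\<close>; if it is a release, the flow leaves \<open>unreleased\<close>.
  Neither set ever grows.\<close>

lemma potential_decreases:
  assumes "pending e \<noteq> {}"
  shows "card (pending (Suc e)) + card (unreleased (Suc e)) < card (pending e) + card (unreleased e)"
proof -
  have fin: "finite (pending e)" "finite (unreleased e)" by (auto simp: pending_def unreleased_def)
  have pos: "0 < left e z" if "0 < left (Suc e) z" for z
    using left_Suc_le[of e z] that by linarith
  have sub: "pending (Suc e) \<subseteq> pending e" using pos unfolding pending_def by auto
  have "time e \<le> time (Suc e)" by (rule time_mono) simp
  then have sub': "unreleased (Suc e) \<subseteq> unreleased e" using pos unfolding unreleased_def by auto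
  have "len e \<in> gaps (time e) (left e) F"
    using assms gaps_nonempty unfolding len_def pending_def by (intro gap_in) blast
  then consider z where "z \<in> active e" "len e = left e z"
    | z where "z < F" "0 < left e z" "time e < r z" "len e = r z - time e"
    unfolding gaps_def active_def by auto
  then show ?thesis
  proof cases
    case 1
    then have "z \<in> pending e - pending (Suc e)"
      using activeD[OF 1(1)] unfolding pending_def by (simp add: left_Suc)
    then have "card (pending (Suc e)) < card (pending e)"
      using fin sub by (intro psubset_card_mono) auto
    moreover have "card (unreleased (Suc e)) \<le> card (unreleased e)"
      using card_mono[OF fin(2) sub'] .
    ultimately show ?thesis by linarith
  next
    case 2
    then have "z \<in> unreleased e - unreleased (Suc e)"
      unfolding unreleased_def by (simp add: time_Suc)
    then have "card (unreleased (Suc e)) < card (unreleased e)"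
      using fin sub' by (intro psubset_card_mono) auto
    moreover have "card (pending (Suc e)) \<le> card (pending e)" using card_mono[OF fin(1) sub] .
    ultimately show ?thesis by linarith
  qed
qed

text \<open>Each of the two sets starts with at most \<open>F\<close> members, so at most
  \<open>2 * F\<close> events can reduce the sum of their sizes. The fixed number allows a loop
  without a test for completion: once nothing is pending, all events have length 0.\<close>

lemma all_sent:
  assumes "z < F"
  shows "left (2 * F) z = 0"
proof -
  have "pending e = {} \<or> card (pending e) + card (unreleased e) + e \<le> 2 * F" for e
  proof (induction e)
    case 0
    have "card (pending 0) \<le> card {..<F}" "card (unreleased 0) \<le> card {..<F}"
      by (rule card_mono; auto simp: pending_def unreleased_def)+
    then show ?case by simp
  next
    case (Suc e)
    show ?case
    proof (cases "pending e = {}")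
      case True
      moreover have "pending (Suc e) \<subseteq> pending e"
        unfolding pending_def using left_Suc_le[of e] by (auto intro: less_le_trans)
      ultimately have "pending (Suc e) = {}" by blast
      then show ?thesis by simp
    next
      case False
      then show ?thesis using Suc potential_decreases[of e] by auto
    qed
  qed
  from this[of "2 * F"] have "pending (2 * F) = {} \<or> card (pending (2 * F)) = 0" by linarith
  then have "pending (2 * F) = {}" by (auto simp: pending_def)
  then show ?thesis using assms left_nonneg[of "2 * F" z] unfolding pending_def by force
qed

text \<open>While \<open>z\<close> is released and not finished, some flow \<open>y \<le> z\<close> sharing a port with it is active.\<close>

lemma time_le:
  assumes "z < F" "\<And>e'. e' < e \<Longrightarrow> 0 < left e' z"
  shows "time e \<le> r z + (\<Sum>y | y \<le> z \<and> src y = src z. of_nat (d y) - left e y)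
     + (\<Sum>y | y \<le> z \<and> dst y = dst z. of_nat (d y) - left e y)" (is "_ \<le> r z + ?A e + ?B e")
  using assms(2)
proof (induction e)
  case 0
  then show ?case using r_nonneg[OF assms(1)] by simp
next
  case (Suc e)
  have mono: "of_nat (d y) - left e y \<le> of_nat (d y) - left (Suc e) y" for y
    using left_Suc_le[of e y] by simp
  have nonneg: "0 \<le> ?A (Suc e)" "0 \<le> ?B (Suc e)" by (auto intro!: sum_nonneg simp: left_le)
  \<comment> \<open>One active member of \<open>Y\<close> already accounts for the whole length of
    the event; the transmitted amounts of the others do not decrease.\<close>
  have inc: "(\<Sum>y\<in>Y. of_nat (d y) - left e y) + len e \<le> (\<Sum>y\<in>Y. of_nat (d y) - left (Suc e) y)"
    if "y \<in> active e" "y \<in> Y" "finite Y" for y Y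
  proof -
    have "(\<Sum>x\<in>Y - {y}. of_nat (d x) - left e x) \<le> (\<Sum>x\<in>Y - {y}. of_nat (d x) - left (Suc e) x)"
      by (intro sum_mono mono)
    then show ?thesis using that
      by (simp add: sum.remove[OF that(3,2)] left_Suc)
  qed
  show ?case
  proof (cases "time e < r z")
    \<comment> \<open>Time cannot jump past \<open>r z\<close>, because the release of the
      unfinished flow \<open>z\<close> is itself an event.\<close>
    case True
    then have "time (Suc e) \<le> r z" using time_Suc_le_release assms(1) Suc.prems[of e] by simp
    then show ?thesis using nonneg by linarith
  next
    case False
    then have "ready (time e) (left e) z" using Suc.prems[of e] unfolding ready_def by simp
    then obtain y where y: "y \<in> active e" "y \<le> z" "src y = src z \<or> dst y = dst z"
      using chosen_blocked assms(1) unfolding active_def by blast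
    have AB: "?A e \<le> ?A (Suc e)" "?B e \<le> ?B (Suc e)" by (intro sum_mono mono)+
    have IH: "time e \<le> r z + ?A e + ?B e" using Suc by simp
    from y(3) show ?thesis
    proof
      assume "src y = src z"
      then have "?A e + len e \<le> ?A (Suc e)" using y by (intro inc[of y]) auto
      then show ?thesis using IH AB by (simp add: time_Suc)
    next
      assume "dst y = dst z"
      then have "?B e + len e \<le> ?B (Suc e)" using y by (intro inc[of y]) auto
      then show ?thesis using IH AB by (simp add: time_Suc)
    qed
  qed
qed

text \<open>The least event index at which nothing of \<open>z\<close> is left. Positive size makes
  it a successor, and \<open>z\<close> was active, hence released, at the event before. As
  \<open>z\<close> is unfinished at all earlier indices, \<open>time_le\<close> applies.\<close>

lemma finish_event:
  assumes "z < F" "0 < d z"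
  obtains e where "e \<le> 2 * F" "left e z = 0" "r z \<le> time e"
    "time e \<le> r z + of_nat (\<Sum>y | y \<le> z \<and> src y = src z. d y) + of_nat (\<Sum>y | y \<le> z \<and> dst y = dst z. d y)"
proof -
  define e where "e = (LEAST e. left e z = 0)"
  have e: "left e z = 0" unfolding e_def by (rule LeastI[of _ "2 * F"]) (rule all_sent[OF assms(1)])
  have le: "e \<le> 2 * F" unfolding e_def by (rule Least_le) (rule all_sent[OF assms(1)])
  have before: "0 < left e' z" if "e' < e" for e'
    using not_less_Least[of e' "\<lambda>e. left e z = 0"] that left_nonneg[of e' z] unfolding e_def
    by (simp add: less_le)
  have "e \<noteq> 0" using e assms(2) by (cases e) auto
  then obtain e' where e': "e = Suc e'" using not0_implies_Suc by blast
  have "z \<in> active e'" using e before[of e'] unfolding e' left_Suc by (auto split: if_splits)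
  then have "r z \<le> time e" using activeD(3) time_mono[of e' e] e' by (meson lessI less_imp_le order_trans)
  moreover have "time e \<le> r z + of_nat (\<Sum>y | y \<le> z \<and> src y = src z. d y) + of_nat (\<Sum>y | y \<le> z \<and> dst y = dst z. d y)"
  proof -
    have "(\<Sum>y\<in>Y. of_nat (d y) - left e y) \<le> of_nat (\<Sum>y\<in>Y. d y)" for Y
      unfolding of_nat_sum by (intro sum_mono) (simp add: left_nonneg)
    note this[of "{y. y \<le> z \<and> src y = src z}"] this[of "{y. y \<le> z \<and> dst y = dst z}"]
    moreover have "time e \<le> r z + (\<Sum>y | y \<le> z \<and> src y = src z. of_nat (d y) - left e y)
       + (\<Sum>y | y \<le> z \<and> dst y = dst z. of_nat (d y) - left e y)"
      using assms(1) before by (rule time_le)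
    ultimately show ?thesis by linarith
  qed
  ultimately show thesis using that e le by blast
qed

text \<open>Times and remaining amounts arise from release times and integer sizes by additions and
  subtractions only. A common denominator of the release times therefore serves for the entire
  simulation.\<close>

lemma integral_multiples:
  assumes D: "\<And>z. z < F \<Longrightarrow> r z * of_int D \<in> \<int>"
  shows "time e * of_int D \<in> \<int>" "left e z * of_int D \<in> \<int>" "len e * of_int D \<in> \<int>"
    "m \<le> F \<Longrightarrow> gap (time e) (left e) m * of_int D \<in> \<int>"
proof -
  have gap: "gap T l m * of_int D \<in> \<int>" if "T * of_int D \<in> \<int>" "\<And>z. l z * of_int D \<in> \<int>" "m \<le> F" for T l m
  proof (cases "gaps T l m = {}")
    case False
    then have "gap T l m \<in> gaps T l m" by (rule gap_in)
    then show ?thesis using that D unfolding gaps_def by (auto simp: left_diff_distrib)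
  qed (simp add: gap_def)
  have *: "time e * of_int D \<in> \<int> \<and> (\<forall>z. left e z * of_int D \<in> \<int>)"
  proof (induction e)
    case (Suc e)
    then have "len e * of_int D \<in> \<int>" unfolding len_def by (intro gap) auto
    then show ?case using Suc by (auto simp: time_Suc left_Suc distrib_right left_diff_distrib)
  qed auto
  then show "time e * of_int D \<in> \<int>" "left e z * of_int D \<in> \<int>" by auto
  show "m \<le> F \<Longrightarrow> gap (time e) (left e) m * of_int D \<in> \<int>" by (intro gap) (use * in auto)
  show "len e * of_int D \<in> \<int>" unfolding len_def by (intro gap) (use * in auto)
qed

text \<open>The second bound separates the two kinds of events: a release lies at or before
  \<open>R\<close>, a completion at most \<open>X\<close> after the current time. Summing the first
  bound over the events would count \<open>R\<close> once per event; the second lets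
  \<open>R\<close> enter \<open>time_bound\<close> only once.\<close>

lemma gap_bound:
  assumes "\<And>z. z < F \<Longrightarrow> r z \<le> R" "\<And>z. z < F \<Longrightarrow> d z \<le> X" "0 \<le> R" "m \<le> F"
  shows "gap (time e) (left e) m \<le> R + of_nat X"
    "time e + gap (time e) (left e) m \<le> max R (time e + of_nat X)"
proof -
  have "gap (time e) (left e) m \<le> of_nat X \<or> time e + gap (time e) (left e) m \<le> R"
  proof (cases "gaps (time e) (left e) m = {}")
    case False
    then have "gap (time e) (left e) m \<in> gaps (time e) (left e) m" by (rule gap_in)
    then consider z where "z < m" "gap (time e) (left e) m = left e z"
      | z where "z < m" "gap (time e) (left e) m = r z - time e"
      unfolding gaps_def using chosenD by blast
    then show ?thesis
    proof cases
      case 1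
      moreover have "left e z \<le> of_nat X"
        using left_le[of e z] assms(2)[of z] 1 assms(4) by (meson of_nat_mono order_trans less_le_trans)
      ultimately show ?thesis by simp
    next
      case 2
      then show ?thesis using assms(1)[of z] assms(4) by simp
    qed
  qed (simp add: gap_def)
  then show "gap (time e) (left e) m \<le> R + of_nat X"
    "time e + gap (time e) (left e) m \<le> max R (time e + of_nat X)"
    using time_nonneg[of e] assms(3) by (auto simp: max_def)
qed

lemma time_bound:
  assumes "\<And>z. z < F \<Longrightarrow> r z \<le> R" "\<And>z. z < F \<Longrightarrow> d z \<le> X" "0 \<le> R"
  shows "time e \<le> R + of_nat (e * X)"
proof (induction e)
  case (Suc e)
  have "time (Suc e) \<le> max R (time e + of_nat X)"
    unfolding time_Suc len_def by (rule gap_bound(2)[OF assms]) auto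
  moreover have "rat_of_nat (Suc e * X) = of_nat (e * X) + of_nat X" by (simp add: algebra_simps)
  moreover have "0 \<le> rat_of_nat (e * X)" "0 \<le> rat_of_nat X" by (rule of_nat_0_le_iff)+
  ultimately show ?case using Suc assms(3) unfolding le_max_iff_disj by linarith
qed (use assms in simp)

end


subsection \<open>The schedule on one core\<close>

text \<open>The form with \<open>min T\<close> covers a horizon before, inside or after the interval
  at once. The half-open interval differs from the closed one in the single point
  \<open>b\<close>.\<close>

lemma has_integral_indicator_interval:
  fixes a b T :: real
  assumes "0 \<le> a" "a \<le> b" "0 \<le> T"
  shows "((\<lambda>t. if a \<le> t \<and> t < b then 1 else 0) has_integral (min T b - min T a)) {0..T}"
proof -
  have "{a..b} \<inter> {0..T} = {a..min b T}" using assms by auto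
  then have "((\<lambda>_. 1::real) has_integral (min T b - min T a)) ({a..b} \<inter> {0..T})"
    using has_integral_const_real[of "1::real" a "min b T"] assms
    by (cases "a \<le> T") (auto simp: min_def split: if_splits)
  then have "((\<lambda>t. if t \<in> {a..b} then 1 else 0) has_integral (min T b - min T a)) {0..T}"
    unfolding has_integral_restrict_Int .
  then show ?thesis
    by (rule has_integral_spike_finite[of "{b}", rotated 2]) auto
qed

locale coflow_order =
  fixes I :: coflow_instance and \<pi> :: "nat \<Rightarrow> nat"
  assumes valid: "valid_instance I"
    and bij: "bij_betw \<pi> {..<coflows I} {..<coflows I}"
begin

text \<open>The flow with source \<open>i\<close> and destination \<open>j\<close> of the coflow at position \<open>x\<close> has number
  \<open>(x * N + i) * N + j\<close>, where \<open>N\<close> is the number of ports.\<close>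

definition src :: "nat \<Rightarrow> nat" where "src z = z div ports I mod ports I"
definition dst :: "nat \<Rightarrow> nat" where "dst z = z mod ports I"
definition pos :: "nat \<Rightarrow> nat" where "pos z = z div ports I div ports I"
definition cof :: "nat \<Rightarrow> nat" where "cof z = \<pi> (pos z)"
definition flows :: nat where "flows = coflows I * ports I * ports I"
definition size_of :: "nat \<Rightarrow> nat" where "size_of z = demand I (src z) (dst z) (cof z)"
definition release_of :: "nat \<Rightarrow> rat" where "release_of z = release I (cof z)"

lemma ports_pos: "0 < ports I"
  using valid unfolding valid_instance_def by simp

lemma flow_number_parts:
  assumes "i < ports I" "j < ports I"
  shows "src ((x * ports I + i) * ports I + j) = i" "dst ((x * ports I + i) * ports I + j) = j"
    "pos ((x * ports I + i) * ports I + j) = x"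
  using assms by (simp_all add: src_def dst_def pos_def)

lemma flow_number_eq: "(pos z * ports I + src z) * ports I + dst z = z"
  unfolding src_def dst_def pos_def by (simp only: div_mult_mod_eq)

lemma flow_number_less:
  assumes "i < ports I" "j < ports I" "x < coflows I"
  shows "(x * ports I + i) * ports I + j < flows"
proof -
  have "x * ports I + i < coflows I * ports I"
    using assms by (metis add.commute add_less_cancel_left less_le_trans mult_Suc mult_le_mono1 Suc_leI)
  then have "Suc (x * ports I + i) * ports I \<le> flows"
    unfolding flows_def by (intro mult_le_mono1 Suc_leI)
  then show ?thesis using assms(2) by simp
qed

lemma flow_parts_less:
  assumes "z < flows"
  shows "src z < ports I" "dst z < ports I" "pos z < coflows I" "cof z < coflows I"
proof -
  show "src z < ports I" "dst z < ports I" using ports_pos by (simp_all add: src_def dst_def)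
  show pos: "pos z < coflows I"
    using assms ports_pos unfolding pos_def flows_def
    by (simp add: div_less_iff_less_mult mult.commute mult.left_commute)
  then show "cof z < coflows I" unfolding cof_def using bij by (auto simp: bij_betw_def)
qed

lemma flow_eqI:
  assumes "z < flows" "z' < flows" "src z = src z'" "dst z = dst z'" "cof z = cof z'"
  shows "z = z'"
proof -
  have "pos z = pos z'"
    using inj_onD[OF bij_betw_imp_inj_on[OF bij], of "pos z" "pos z'"] assms(5)
      flow_parts_less(3)[OF assms(1)] flow_parts_less(3)[OF assms(2)] unfolding cof_def by simp
  then have "(pos z * ports I + src z) * ports I + dst z = (pos z' * ports I + src z') * ports I + dst z'"
    by (simp only: assms(3,4))
  then show ?thesis by (simp only: flow_number_eq)
qed

lemma obtain_flow:
  assumes "i < ports I" "j < ports I" "k < coflows I"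
  obtains z where "z < flows" "src z = i" "dst z = j" "cof z = k"
proof -
  have "k \<in> \<pi> ` {..<coflows I}" using bij assms(3) by (simp add: bij_betw_def)
  then obtain x where "x < coflows I" "\<pi> x = k" by auto
  then show thesis
    using that[of "(x * ports I + i) * ports I + j"] flow_number_less[OF assms(1,2)]
      flow_number_parts[OF assms(1,2)] by (simp add: cof_def)
qed

sublocale list_scheduling flows src dst size_of release_of
proof
  show "0 \<le> release_of z" if "z < flows" for z
    using valid flow_parts_less(4)[OF that] unfolding release_of_def valid_instance_def by blast
qed

section \<open>The schedule as a function of real time\<close>

definition \<tau> :: "nat \<Rightarrow> real" where "\<tau> e = real_of_rat (time e)"

text \<open>With all coflows on core 0 the port constraints are those of a single switch. Half-open
  intervals keep consecutive events disjoint and make events of length 0 invisible.\<close>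

definition sched :: schedule where
  "sched = \<lparr>core = (\<lambda>_. 0), rate = (\<lambda>i j k t. if \<exists>e<2 * flows. \<exists>z<flows.
     src z = i \<and> dst z = j \<and> cof z = k \<and> z \<in> active e \<and> \<tau> e \<le> t \<and> t < \<tau> (Suc e) then 1 else 0)\<rparr>"

lemma \<tau>_mono: "e \<le> e' \<Longrightarrow> \<tau> e \<le> \<tau> e'"
  unfolding \<tau>_def by (simp add: of_rat_less_eq time_mono)

lemma \<tau>_nonneg: "0 \<le> \<tau> e"
  unfolding \<tau>_def by (simp add: time_nonneg)

lemma \<tau>_unique:
  assumes "\<tau> e \<le> t" "t < \<tau> (Suc e)" "\<tau> e' \<le> t" "t < \<tau> (Suc e')"
  shows "e = e'"
proof (rule ccontr)
  assume "e \<noteq> e'"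
  then consider "Suc e \<le> e'" | "Suc e' \<le> e" by linarith
  then show False using \<tau>_mono[of "Suc e" e'] \<tau>_mono[of "Suc e'" e] assms by cases auto
qed

lemma rate_sched:
  assumes "z < flows"
  shows "rate sched (src z) (dst z) (cof z) t =
    (if \<exists>e<2 * flows. z \<in> active e \<and> \<tau> e \<le> t \<and> t < \<tau> (Suc e) then 1 else 0)"
proof -
  have "(\<exists>y<flows. src y = src z \<and> dst y = dst z \<and> cof y = cof z \<and> y \<in> active e \<and> \<tau> e \<le> t \<and> t < \<tau> (Suc e))
      \<longleftrightarrow> z \<in> active e \<and> \<tau> e \<le> t \<and> t < \<tau> (Suc e)" for e
    using flow_eqI[OF _ assms] assms by blast
  then show ?thesis unfolding sched_def by simp
qed

lemma rate_sched_pos: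
  assumes "i < ports I" "j < ports I" "k < coflows I" "rate sched i j k t > 0"
  obtains e z where "z < flows" "src z = i" "dst z = j" "cof z = k" "z \<in> active e"
    "\<tau> e \<le> t" "t < \<tau> (Suc e)"
proof -
  from obtain_flow[OF assms(1-3)] obtain z where z: "z < flows" "src z = i" "dst z = j" "cof z = k" .
  from assms(4) obtain e where "z \<in> active e" "\<tau> e \<le> t" "t < \<tau> (Suc e)"
    using rate_sched[OF z(1), of t] z by (auto split: if_splits)
  then show thesis using that z by blast
qed

lemma rate_sched_sum:
  assumes "z < flows"
  shows "rate sched (src z) (dst z) (cof z) t =
    (\<Sum>e | e < 2 * flows \<and> z \<in> active e. if \<tau> e \<le> t \<and> t < \<tau> (Suc e) then 1 else 0)" (is "_ = ?s")
proof (cases "\<exists>e<2 * flows. z \<in> active e \<and> \<tau> e \<le> t \<and> t < \<tau> (Suc e)")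
  case True
  then obtain e where e: "e < 2 * flows" "z \<in> active e" "\<tau> e \<le> t" "t < \<tau> (Suc e)" by blast
  have "?s = (\<Sum>e' | e' < 2 * flows \<and> z \<in> active e'. if e' = e then 1 else 0)"
    using e \<tau>_unique by (intro sum.cong) auto
  also have "\<dots> = 1" using e by simp
  finally show ?thesis using rate_sched[OF assms, of t] True by simp
next
  case False
  then have "?s = 0" by (intro sum.neutral) auto
  then show ?thesis using rate_sched[OF assms, of t] False by simp
qed

lemma rate_sched_has_integral:
  assumes "z < flows" "0 \<le> T"
  shows "(rate sched (src z) (dst z) (cof z) has_integral
    (\<Sum>e | e < 2 * flows \<and> z \<in> active e. min T (\<tau> (Suc e)) - min T (\<tau> e))) {0..T}"
proof -
  have "rate sched (src z) (dst z) (cof z) = (\<lambda>t.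
      \<Sum>e | e < 2 * flows \<and> z \<in> active e. if \<tau> e \<le> t \<and> t < \<tau> (Suc e) then 1 else 0)"
    using rate_sched_sum[OF assms(1)] by blast
  then show ?thesis
    using assms(2) \<tau>_nonneg \<tau>_mono
    by (simp only:) (intro has_integral_sum has_integral_indicator_interval; simp)
qed

text \<open>The instant \<open>T\<close> lies after all events before \<open>e\<close> and not after
  the start of any later one, so each interval counts fully or not at all. For
  \<open>e = 2 * flows\<close> the second condition is vacuous and \<open>T\<close> may be
  arbitrarily late.\<close>

lemma sent_sched:
  assumes "z < flows" "e \<le> 2 * flows"
    and T: "\<And>e'. e' < e \<Longrightarrow> \<tau> (Suc e') \<le> T" "\<And>e'. e \<le> e' \<Longrightarrow> e' < 2 * flows \<Longrightarrow> T \<le> \<tau> e'" "0 \<le> T"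
  shows "sent sched (src z) (dst z) (cof z) T = real (size_of z) - real_of_rat (left e z)"
proof -
  have len: "\<tau> (Suc e') - \<tau> e' = real_of_rat (len e')" for e'
    unfolding \<tau>_def by (simp add: time_Suc of_rat_add)
  have "sent sched (src z) (dst z) (cof z) T =
      (\<Sum>e' | e' < 2 * flows \<and> z \<in> active e'. min T (\<tau> (Suc e')) - min T (\<tau> e'))"
    unfolding sent_def by (rule integral_unique[OF rate_sched_has_integral[OF assms(1) T(3)]])
  also have "\<dots> = (\<Sum>e' | e' < 2 * flows \<and> z \<in> active e'. if e' < e then \<tau> (Suc e') - \<tau> e' else 0)"
  proof (rule sum.cong[OF refl])
    fix e' assume e': "e' \<in> {e'. e' < 2 * flows \<and> z \<in> active e'}"
    have "\<tau> e' \<le> \<tau> (Suc e')" by (rule \<tau>_mono) simp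
    then show "min T (\<tau> (Suc e')) - min T (\<tau> e') = (if e' < e then \<tau> (Suc e') - \<tau> e' else 0)"
      using T(1)[of e'] T(2)[of e'] e' by (cases "e' < e") (auto simp: min_def)
  qed
  also have "\<dots> = (\<Sum>e' | (e' < 2 * flows \<and> z \<in> active e') \<and> e' < e. \<tau> (Suc e') - \<tau> e')"
    using sum.inter_filter[of "{e'. e' < 2 * flows \<and> z \<in> active e'}" "\<lambda>e'. \<tau> (Suc e') - \<tau> e'" "\<lambda>e'. e' < e"]
    by simp
  also have "{e'. (e' < 2 * flows \<and> z \<in> active e') \<and> e' < e} = {e'. e' < e \<and> z \<in> active e'}"
    using assms(2) by auto
  also have "(\<Sum>e' | e' < e \<and> z \<in> active e'. \<tau> (Suc e') - \<tau> e') = real (size_of z) - real_of_rat (left e z)"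
    by (simp add: left_eq len of_rat_sum of_rat_diff)
  finally show ?thesis .
qed

lemma sent_sched_at_event:
  assumes "z < flows" "e \<le> 2 * flows"
  shows "sent sched (src z) (dst z) (cof z) (\<tau> e) = real (size_of z) - real_of_rat (left e z)"
  by (rule sent_sched[OF assms]) (auto intro: \<tau>_mono \<tau>_nonneg)

lemma sent_sched_finally:
  assumes "z < flows" "\<tau> (2 * flows) \<le> T"
  shows "sent sched (src z) (dst z) (cof z) T = real (size_of z)"
proof -
  have "\<tau> (Suc e') \<le> T" if "e' < 2 * flows" for e'
    using \<tau>_mono[of "Suc e'" "2 * flows"] that assms(2) by simp
  moreover have "0 \<le> T" using \<tau>_nonneg[of "2 * flows"] assms(2) by linarith
  ultimately show ?thesis using sent_sched[OF assms(1), of "2 * flows" T] all_sent[OF assms(1)] by simp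
qed

lemma feasible_sched: "feasible I sched"
  unfolding feasible_def
proof (intro conjI allI impI)
  show "core sched k < cores I" for k using valid by (simp add: sched_def valid_instance_def)
next
  fix i j k assume ijk: "i < ports I" "j < ports I" "k < coflows I"
  from obtain_flow[OF ijk] obtain z where z: "z < flows" "src z = i" "dst z = j" "cof z = k" .
  show "0 \<le> rate sched i j k t" "rate sched i j k t \<le> 1" for t by (auto simp: sched_def)
  show "rate sched i j k t = 0" if "t < real_of_rat (release I k)" for t
  proof (rule ccontr)
    assume "rate sched i j k t \<noteq> 0"
    then obtain e where e: "z \<in> active e" "\<tau> e \<le> t"
      using rate_sched[OF z(1), of t] z by (auto split: if_splits)
    have "real_of_rat (release I k) \<le> \<tau> e"
      using activeD(3)[OF e(1)] z(4) unfolding \<tau>_def release_of_def by (simp add: of_rat_less_eq)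
    then show False using e(2) that by linarith
  qed
  show "rate sched i j k integrable_on {0..T}" if "0 \<le> T" for T
    using rate_sched_has_integral[OF z(1) that] z by blast
  show "\<exists>T\<ge>0. \<forall>T'\<ge>T. sent sched i j k T' = real (demand I i j k)"
    using sent_sched_finally[OF z(1)] \<tau>_nonneg z by (auto simp: size_of_def)
next
  fix i j j' k k' t
  assume ij: "i < ports I" "j < ports I" "j' < ports I" "k < coflows I" "k' < coflows I"
    and "core sched k = core sched k' \<and> 0 < rate sched i j k t \<and> 0 < rate sched i j' k' t"
  then have *: "0 < rate sched i j k t" "0 < rate sched i j' k' t" by auto
  obtain e z where z: "src z = i" "dst z = j" "cof z = k" "z \<in> active e" "\<tau> e \<le> t" "t < \<tau> (Suc e)"
    by (rule rate_sched_pos[OF ij(1,2,4) *(1)])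
  obtain e' z' where z': "src z' = i" "dst z' = j'" "cof z' = k'" "z' \<in> active e'" "\<tau> e' \<le> t" "t < \<tau> (Suc e')"
    by (rule rate_sched_pos[OF ij(1,3,5) *(2)])
  have "e = e'" using \<tau>_unique[OF z(5,6) z'(5,6)] .
  then have "z = z'" using active_no_conflict z z' by metis
  then show "j = j'" "k = k'" using z z' by auto
next
  fix j i i' k k' t
  assume ij: "j < ports I" "i < ports I" "i' < ports I" "k < coflows I" "k' < coflows I"
    and "core sched k = core sched k' \<and> 0 < rate sched i j k t \<and> 0 < rate sched i' j k' t"
  then have *: "0 < rate sched i j k t" "0 < rate sched i' j k' t" by auto
  obtain e z where z: "src z = i" "dst z = j" "cof z = k" "z \<in> active e" "\<tau> e \<le> t" "t < \<tau> (Suc e)"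
    by (rule rate_sched_pos[OF ij(2,1,4) *(1)])
  obtain e' z' where z': "src z' = i'" "dst z' = j" "cof z' = k'" "z' \<in> active e'" "\<tau> e' \<le> t" "t < \<tau> (Suc e')"
    by (rule rate_sched_pos[OF ij(3,1,5) *(2)])
  have "e = e'" using \<tau>_unique[OF z(5,6) z'(5,6)] .
  then have "z = z'" using active_no_conflict z z' by metis
  then show "i = i'" "k = k'" using z z' by auto
qed

text \<open>Flows numbered up to \<open>z\<close> belong to coflows at positions up to
  \<open>pos z\<close>. Once the source is fixed, position and destination determine the flow, so
  the sum is part of the load that these coflows put on the port \<open>src z\<close>; destinations
  are symmetric.\<close>

lemma sum_sizes_le_peak_load:
  assumes z: "z < flows"
  shows "(\<Sum>y | y \<le> z \<and> src y = src z. size_of y) \<le> peak_load I (\<pi> ` {..<Suc (pos z)})"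
    "(\<Sum>y | y \<le> z \<and> dst y = dst z. size_of y) \<le> peak_load I (\<pi> ` {..<Suc (pos z)})"
proof -
  have pos_le: "pos y < Suc (pos z)" if "y \<le> z" for y
    using that unfolding pos_def by (simp add: div_le_mono less_Suc_eq_le)
  have inj: "inj_on \<pi> {..<Suc (pos z)}"
    using bij flow_parts_less(3)[OF z] unfolding bij_betw_def by (auto intro: inj_on_subset)
  have dst_less: "dst y < ports I" and src_less: "src y < ports I" for y
    using ports_pos by (simp_all add: dst_def src_def)
  let ?P = "{..<Suc (pos z)} \<times> {..<ports I}"
  have load: "(\<Sum>(x, j)\<in>?P. f j (\<pi> x)) = (\<Sum>k\<in>\<pi> ` {..<Suc (pos z)}. \<Sum>j<ports I. f j k)" for f :: "nat \<Rightarrow> nat \<Rightarrow> nat"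
    using inj by (simp add: sum.cartesian_product[symmetric] sum.reindex)
  let ?Y = "{y. y \<le> z \<and> src y = src z}"
  have "inj_on (\<lambda>y. (pos y, dst y)) ?Y"
    by (rule inj_onI) (metis (mono_tags, lifting) flow_number_eq mem_Collect_eq prod.inject)
  then have "(\<Sum>y\<in>?Y. size_of y) = (\<Sum>(x, j)\<in>(\<lambda>y. (pos y, dst y)) ` ?Y. demand I (src z) j (\<pi> x))"
    by (simp add: sum.reindex size_of_def cof_def)
  also have "\<dots> \<le> (\<Sum>(x, j)\<in>?P. demand I (src z) j (\<pi> x))"
    by (rule sum_mono2) (use pos_le dst_less in auto)
  also have "\<dots> = (\<Sum>k\<in>\<pi> ` {..<Suc (pos z)}. port_load I (src z) k)"
    unfolding load[of "demand I (src z)"] using src_less[of z] by (simp add: port_load_def)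
  also have "\<dots> \<le> peak_load I (\<pi> ` {..<Suc (pos z)})"
    using src_less[of z] by (intro port_load_le_peak_load) simp
  finally show "(\<Sum>y\<in>?Y. size_of y) \<le> peak_load I (\<pi> ` {..<Suc (pos z)})" .
  let ?Y = "{y. y \<le> z \<and> dst y = dst z}"
  have "inj_on (\<lambda>y. (pos y, src y)) ?Y"
    by (rule inj_onI) (metis (mono_tags, lifting) flow_number_eq mem_Collect_eq prod.inject)
  then have "(\<Sum>y\<in>?Y. size_of y) = (\<Sum>(x, i)\<in>(\<lambda>y. (pos y, src y)) ` ?Y. demand I i (dst z) (\<pi> x))"
    by (simp add: sum.reindex size_of_def cof_def)
  also have "\<dots> \<le> (\<Sum>(x, i)\<in>?P. demand I i (dst z) (\<pi> x))"
    by (rule sum_mono2) (use pos_le src_less in auto)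
  also have "\<dots> = (\<Sum>k\<in>\<pi> ` {..<Suc (pos z)}. port_load I (ports I + dst z) k)"
    unfolding load[of "\<lambda>i. demand I i (dst z)"] by (simp add: port_load_def)
  also have "\<dots> \<le> peak_load I (\<pi> ` {..<Suc (pos z)})"
    using dst_less[of z] by (intro port_load_le_peak_load) simp
  finally show "(\<Sum>y\<in>?Y. size_of y) \<le> peak_load I (\<pi> ` {..<Suc (pos z)})" .
qed

lemma flow_completion_sched_le:
  assumes z: "z < flows"
  shows "flow_completion I sched (src z) (dst z) (cof z)
    \<le> real_of_rat (release I (cof z)) + 2 * real (peak_load I (\<pi> ` {..<Suc (pos z)}))"
proof -
  let ?r = "real_of_rat (release I (cof z))" and ?P = "peak_load I (\<pi> ` {..<Suc (pos z)})"
  let ?A = "{T. ?r \<le> T \<and> sent sched (src z) (dst z) (cof z) T = real (demand I (src z) (dst z) (cof z))}"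
  have lower: "flow_completion I sched (src z) (dst z) (cof z) \<le> T" if "T \<in> ?A" for T
    unfolding flow_completion_def using that
    by (intro cInf_lower bdd_belowI[of _ ?r]) auto
  show ?thesis
  proof (cases "size_of z = 0")
    \<comment> \<open>A flow of size 0 is never active and is not covered by
      \<open>finish_event\<close>. Nothing has to be sent, so its release time already belongs to
      the set whose infimum is the completion time.\<close>
    case True
    then have "left e z = 0" for e using left_nonneg[of e z] left_le[of e z] by simp
    then have "z \<notin> active e" for e using activeD(2)[of z e] by auto
    then have "rate sched (src z) (dst z) (cof z) = (\<lambda>t. 0)" using rate_sched[OF z] by auto
    then have "?r \<in> ?A" using True by (simp add: sent_def size_of_def)
    then show ?thesis using lower by fastforce
  next
    case False
    then obtain e where e: "e \<le> 2 * flows" "left e z = 0" "release_of z \<le> time e"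
      "time e \<le> release_of z + of_nat (\<Sum>y | y \<le> z \<and> src y = src z. size_of y)
        + of_nat (\<Sum>y | y \<le> z \<and> dst y = dst z. size_of y)"
      using finish_event[OF z] by blast
    have "\<tau> e \<in> ?A"
      using sent_sched_at_event[OF z e(1)] e(2,3) unfolding \<tau>_def size_of_def release_of_def
      by (simp add: of_rat_less_eq)
    moreover have "\<tau> e \<le> real_of_rat (release_of z + of_nat (\<Sum>y | y \<le> z \<and> src y = src z. size_of y)
        + of_nat (\<Sum>y | y \<le> z \<and> dst y = dst z. size_of y))"
      unfolding \<tau>_def of_rat_less_eq by (rule e(4))
    moreover have "\<dots> = ?r + real (\<Sum>y | y \<le> z \<and> src y = src z. size_of y)
        + real (\<Sum>y | y \<le> z \<and> dst y = dst z. size_of y)"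
      unfolding release_of_def of_rat_add of_rat_of_nat_eq ..
    moreover have "real (\<Sum>y | y \<le> z \<and> src y = src z. size_of y) \<le> real ?P"
      "real (\<Sum>y | y \<le> z \<and> dst y = dst z. size_of y) \<le> real ?P"
      by (intro of_nat_mono sum_sizes_le_peak_load z)+
    ultimately show ?thesis using lower[of "\<tau> e"] by linarith
  qed
qed

lemma completion_time_sched_le:
  assumes x: "x < coflows I"
  shows "completion_time I sched (\<pi> x)
    \<le> real_of_rat (release I (\<pi> x)) + 2 * real (peak_load I (\<pi> ` {..<Suc x}))"
  unfolding completion_time_def
proof (rule Max.boundedI)
  have "(0, 0) \<in> {..<ports I} \<times> {..<ports I}" using ports_pos by simp
  then show "(\<lambda>(i, j). flow_completion I sched i j (\<pi> x)) ` ({..<ports I} \<times> {..<ports I}) \<noteq> {}" by blast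
  fix a assume "a \<in> (\<lambda>(i, j). flow_completion I sched i j (\<pi> x)) ` ({..<ports I} \<times> {..<ports I})"
  then obtain i j where ij: "i < ports I" "j < ports I" "a = flow_completion I sched i j (\<pi> x)" by auto
  show "a \<le> real_of_rat (release I (\<pi> x)) + 2 * real (peak_load I (\<pi> ` {..<Suc x}))"
    using flow_completion_sched_le[OF flow_number_less[OF ij(1,2) x]] flow_number_parts[OF ij(1,2)] ij(3)
    unfolding cof_def by simp
qed simp

text \<open>The release times cost one objective value of \<open>S\<close>. The peak loads enter
  with factor 2, and \<open>order_inv_final\<close> bounds their weighted sum by
  \<open>2 * m\<close> objective values, where \<open>m\<close> is the number of cores.\<close>

lemma objective_sched_le:
  assumes inv: "order_inv I 0 \<pi> w" and S: "feasible I S"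
  shows "objective I sched \<le> (4 * real (cores I) + 1) * objective I S"
proof -
  let ?w = "\<lambda>k. real_of_rat (weight I k)"
  have w: "0 \<le> ?w k" if "k < coflows I" for k
    using valid that unfolding valid_instance_def by (simp add: less_imp_le)
  have reindex: "(\<Sum>k<coflows I. f k) = (\<Sum>x<coflows I. f (\<pi> x))" for f :: "nat \<Rightarrow> real"
    using sum.reindex_bij_betw[OF bij, of f] by simp
  have \<pi>: "\<pi> x < coflows I" if "x < coflows I" for x using bij that by (auto simp: bij_betw_def)
  have "objective I sched = (\<Sum>x<coflows I. ?w (\<pi> x) * completion_time I sched (\<pi> x))"
    unfolding objective_def by (rule reindex)
  also have "\<dots> \<le> (\<Sum>x<coflows I. ?w (\<pi> x) * (real_of_rat (release I (\<pi> x)) + 2 * real (peak_load I (\<pi> ` {..<Suc x}))))"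
    using completion_time_sched_le w \<pi> by (intro sum_mono mult_left_mono) auto
  also have "\<dots> = (\<Sum>x<coflows I. ?w (\<pi> x) * real_of_rat (release I (\<pi> x))) +
      2 * (\<Sum>x<coflows I. ?w (\<pi> x) * real (peak_load I (\<pi> ` {..<Suc x})))"
    by (simp add: distrib_left sum.distrib sum_distrib_left algebra_simps)
  also have "(\<Sum>x<coflows I. ?w (\<pi> x) * real_of_rat (release I (\<pi> x))) \<le> objective I S"
    unfolding objective_def reindex[symmetric, of "\<lambda>k. ?w k * real_of_rat (release I k)"]
    using release_le_completion_time[OF valid S] w by (intro sum_mono mult_left_mono) auto
  also have "(\<Sum>x<coflows I. ?w (\<pi> x) * real (peak_load I (\<pi> ` {..<Suc x})))
      \<le> (\<Sum>k<coflows I. ?w k * (2 * real (cores I) * completion_time I S k))"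
    by (rule order_inv_final[OF inv dual_bound_completion_time[OF valid S]])
  also have "\<dots> = 2 * real (cores I) * objective I S"
    unfolding objective_def by (simp add: sum_distrib_left algebra_simps)
  finally show ?thesis by (simp add: algebra_simps)
qed

lemma objective_sched_le_optimum:
  assumes inv: "order_inv I 0 \<pi> w"
  shows "objective I sched \<le> (4 * real (cores I) + 1) * optimum I"
proof -
  \<comment> \<open>Dividing by the ratio leaves the bare infimum on the right, so a bound against
    every feasible schedule is enough.\<close>
  have "objective I sched / (4 * real (cores I) + 1) \<le> optimum I"
    unfolding optimum_def
  proof (rule cInf_greatest)
    show "{objective I S |S. feasible I S} \<noteq> {}" using feasible_sched by blast
    fix v assume "v \<in> {objective I S |S. feasible I S}"
    then show "objective I sched / (4 * real (cores I) + 1) \<le> v"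
      using objective_sched_le[OF inv] by (auto simp: divide_le_eq mult.commute)
  qed
  then show ?thesis by (simp add: divide_le_eq mult.commute)
qed

end


subsection \<open>Size of the input\<close>

lemma abs_le_two_power_rat_bits: "\<bar>q\<bar> \<le> 2 ^ rat_bits q"
proof -
  let ?a = "fst (quotient_of q)" and ?b = "snd (quotient_of q)"
  have q: "q = of_int ?a / of_int ?b" by (rule quotient_of_div) simp
  have "1 \<le> ?b" using quotient_of_denom_pos'[of q] by simp
  then have "\<bar>q\<bar> \<le> of_int \<bar>?a\<bar>"
    by (subst q) (simp add: divide_le_eq mult_left_le_one_le abs_divide mult_le_cancel_left1)
  also have "\<dots> \<le> of_int (2 ^ rat_bits q)"
    using quotient_of_le_rat_bits(1)[of q] of_int_le_iff by blast
  finally show ?thesis by simp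
qed

lemma nat_le_two_power_rat_bits: "x \<le> 2 ^ rat_bits (of_nat x)"
proof -
  have "rat_of_nat x \<le> rat_of_nat (2 ^ rat_bits (of_nat x))"
    using abs_le_two_power_rat_bits[of "of_nat x"] by simp
  then show ?thesis by (simp only: of_nat_le_iff)
qed

text \<open>Numbers that are at least 2 satisfy \<open>x + y \<le> x * y\<close>. The length of a
  sum of demands is thus at most their total length, and port loads need no extra term for the
  number of summands.\<close>

lemma sum_two_power_le:
  fixes f :: "'a \<Rightarrow> nat"
  assumes "finite A" "\<And>x. x \<in> A \<Longrightarrow> 1 \<le> f x"
  shows "(\<Sum>x\<in>A. 2 ^ f x) \<le> (2::nat) ^ (\<Sum>x\<in>A. f x)"
  using assms
proof (induction rule: finite_induct)
  case (insert x A)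
  show ?case
  proof (cases "A = {}")
    case False
    have two: "(2::nat) \<le> 2 ^ a" if "1 \<le> a" for a :: nat
      using power_increasing[OF that, of "2::nat"] by simp
    from False obtain y where y: "y \<in> A" by blast
    have "f y \<le> (\<Sum>x\<in>A. f x)" using insert(1) y by (intro member_le_sum) auto
    then have "2 \<le> (2::nat) ^ f x" "2 \<le> (2::nat) ^ (\<Sum>x\<in>A. f x)"
      using insert.prems[of x] insert.prems[of y] y by (auto intro!: two)
    then obtain a b where "(2::nat) ^ f x = 2 + a" "(2::nat) ^ (\<Sum>x\<in>A. f x) = 2 + b"
      using le_Suc_ex by metis
    then have "(2::nat) ^ f x + 2 ^ (\<Sum>x\<in>A. f x) \<le> 2 ^ f x * 2 ^ (\<Sum>x\<in>A. f x)" by simp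
    moreover have "(\<Sum>x\<in>A. 2 ^ f x) \<le> (2::nat) ^ (\<Sum>x\<in>A. f x)" using insert by auto
    ultimately show ?thesis using insert(1,2) by (simp add: power_add)
  qed simp
qed simp

text \<open>The product of the reduced denominators, whose length is at most the total length of the
  numbers.\<close>

lemma common_denominator:
  fixes f :: "'a \<Rightarrow> rat"
  assumes "finite A" "(\<Sum>x\<in>A. rat_bits (f x)) \<le> b"
  obtains D :: int where "0 < D" "D \<le> 2 ^ b" "\<And>x. x \<in> A \<Longrightarrow> f x * of_int D \<in> \<int>"
proof
  let ?D = "\<Prod>x\<in>A. snd (quotient_of (f x))"
  show "0 < ?D" by (intro prod_pos) (simp add: quotient_of_denom_pos')
  have "?D \<le> (\<Prod>x\<in>A. 2 ^ rat_bits (f x))"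
    by (intro prod_mono) (simp add: quotient_of_le_rat_bits less_imp_le quotient_of_denom_pos')
  also have "\<dots> = 2 ^ (\<Sum>x\<in>A. rat_bits (f x))" by (simp add: power_sum)
  also have "\<dots> \<le> 2 ^ b" using assms(2) by (intro power_increasing) auto
  finally show "?D \<le> 2 ^ b" .
  fix x assume x: "x \<in> A"
  have q: "f x = of_int (fst (quotient_of (f x))) / of_int (snd (quotient_of (f x)))"
    by (rule quotient_of_div) simp
  have "f x * of_int (snd (quotient_of (f x))) = of_int (fst (quotient_of (f x)))"
    using quotient_of_denom_pos'[of "f x"] by (subst q) simp
  then have "f x * of_int ?D = of_int (fst (quotient_of (f x)) * (\<Prod>x\<in>A - {x}. snd (quotient_of (f x))))"
    by (simp only: prod.remove[OF assms(1) x] of_int_mult mult.assoc[symmetric])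
  then show "f x * of_int ?D \<in> \<int>" by (simp only: Ints_of_int)
qed

lemma sum_grid:
  fixes f :: "nat \<Rightarrow> nat \<Rightarrow> 'a::comm_monoid_add"
  shows "(\<Sum>y<a * b. f (y div b) (y mod b)) = (\<Sum>x<a. \<Sum>y<b. f x y)"
proof (induction a)
  case (Suc a)
  have "(\<Sum>y<Suc a * b. f (y div b) (y mod b)) =
      (\<Sum>y<a * b. f (y div b) (y mod b)) + (\<Sum>y\<in>{a * b..<a * b + b}. f (y div b) (y mod b))"
    by (simp add: lessThan_atLeast0 sum.atLeastLessThan_concat add.commute)
  also have "(\<Sum>y\<in>{a * b..<a * b + b}. f (y div b) (y mod b)) =
      (\<Sum>y<b. f ((y + a * b) div b) ((y + a * b) mod b))"
    using sum.shift_bounds_nat_ivl[of "\<lambda>y. f (y div b) (y mod b)" 0 "a * b" b]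
    by (simp add: lessThan_atLeast0 add.commute)
  also have "\<dots> = (\<Sum>y<b. f a y)" by (rule sum.cong) auto
  finally show ?case using Suc by simp
qed simp

section \<open>Bounds on numbers and loops for a fixed instance\<close>

locale valid_coflow_instance =
  fixes I :: coflow_instance
  assumes valid: "valid_instance I"
begin

abbreviation N where "N \<equiv> ports I"
abbreviation n where "n \<equiv> coflows I"
abbreviation \<beta> where "\<beta> \<equiv> input_bits I"

text \<open>All numbers occurring in the computation fit into \<open>h\<close>, all loops are iterated at most
  \<open>M\<close> times.\<close>

definition h :: nat where "h = 8 * (\<beta> + 2)\<^sup>2"
definition M :: nat where "M = 2 * input_count I"

lemma N_pos: "0 < N"
  using valid unfolding valid_instance_def by simp

lemma bits_parts:
  shows "rat_bits (of_nat (cores I)) \<le> \<beta>" "rat_bits (of_nat N) \<le> \<beta>" "rat_bits (of_nat n) \<le> \<beta>"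
    "(\<Sum>k<n. \<Sum>i<N. \<Sum>j<N. rat_bits (of_nat (demand I i j k))) \<le> \<beta>"
    "(\<Sum>k<n. rat_bits (release I k)) \<le> \<beta>" "(\<Sum>k<n. rat_bits (weight I k)) \<le> \<beta>"
  unfolding input_bits_def sum.distrib by simp_all

lemma input_count_le: "input_count I \<le> \<beta>"
proof -
  have "n * N * N \<le> (\<Sum>k<n. \<Sum>i<N. \<Sum>j<N. rat_bits (of_nat (demand I i j k)))"
  proof -
    have "n * N * N = (\<Sum>k<n. \<Sum>i<N. \<Sum>j<N. 1)" by simp
    also have "\<dots> \<le> (\<Sum>k<n. \<Sum>i<N. \<Sum>j<N. rat_bits (of_nat (demand I i j k)))"
      by (intro sum_mono rat_bits_ge_1)
    finally show ?thesis .
  qed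
  moreover have "2 * n \<le> (\<Sum>k<n. rat_bits (release I k) + rat_bits (weight I k))"
  proof -
    have "2 * n = (\<Sum>k<n. 1 + 1)" by simp
    also have "\<dots> \<le> (\<Sum>k<n. rat_bits (release I k) + rat_bits (weight I k))"
      by (intro sum_mono add_mono rat_bits_ge_1)
    finally show ?thesis .
  qed
  moreover note rat_bits_ge_1[of "of_nat (cores I)"] rat_bits_ge_1[of "of_nat N"] rat_bits_ge_1[of "of_nat n"]
  ultimately show ?thesis unfolding input_bits_def input_count_def by linarith
qed

lemma demand_bits:
  assumes "i < N" "j < N" "k < n"
  shows "rat_bits (of_nat (demand I i j k)) \<le> \<beta>"
proof -
  have "rat_bits (of_nat (demand I i j k)) \<le> (\<Sum>j<N. rat_bits (of_nat (demand I i j k)))"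
    using assms by (intro member_le_sum) auto
  also have "\<dots> \<le> (\<Sum>i<N. \<Sum>j<N. rat_bits (of_nat (demand I i j k)))"
    using assms member_le_sum[of i "{..<N}" "\<lambda>i. \<Sum>j<N. rat_bits (of_nat (demand I i j k))"] by auto
  also have "\<dots> \<le> (\<Sum>k<n. \<Sum>i<N. \<Sum>j<N. rat_bits (of_nat (demand I i j k)))"
    using assms member_le_sum[of k "{..<n}" "\<lambda>k. \<Sum>i<N. \<Sum>j<N. rat_bits (of_nat (demand I i j k))"] by auto
  finally show ?thesis using bits_parts(4) by linarith
qed

lemma release_bits: "k < n \<Longrightarrow> rat_bits (release I k) \<le> \<beta>"
  and weight_bits: "k < n \<Longrightarrow> rat_bits (weight I k) \<le> \<beta>"
  using member_le_sum[of k "{..<n}" "\<lambda>k. rat_bits (release I k)"]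
    member_le_sum[of k "{..<n}" "\<lambda>k. rat_bits (weight I k)"] bits_parts(5,6) by auto

lemma pow_mono: "a \<le> b \<Longrightarrow> (2::'a::linordered_semidom) ^ a \<le> 2 ^ b"
  by (rule power_increasing) auto

lemma weight_le: "k < n \<Longrightarrow> weight I k \<le> 2 ^ \<beta>"
  and release_le: "k < n \<Longrightarrow> release I k \<le> 2 ^ \<beta>"
  using abs_le_two_power_rat_bits[of "weight I k"] abs_le_two_power_rat_bits[of "release I k"]
    pow_mono[OF weight_bits, of k, where 'a=rat] pow_mono[OF release_bits, of k, where 'a=rat] by linarith+

lemma demand_le: "i < N \<Longrightarrow> j < N \<Longrightarrow> k < n \<Longrightarrow> demand I i j k \<le> 2 ^ \<beta>"
  using nat_le_two_power_rat_bits[of "demand I i j k"] pow_mono[OF demand_bits, of i j k, where 'a=nat]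
  by linarith

lemma port_load_le:
  assumes "p < 2 * N" "k < n"
  shows "port_load I p k \<le> 2 ^ \<beta>"
proof -
  have row: "(\<Sum>x<N. g x) \<le> 2 ^ (\<Sum>x<N. rat_bits (of_nat (g x)))" for g :: "nat \<Rightarrow> nat"
  proof -
    have "(\<Sum>x<N. g x) \<le> (\<Sum>x<N. 2 ^ rat_bits (of_nat (g x)))"
      by (intro sum_mono nat_le_two_power_rat_bits)
    also have "\<dots> \<le> 2 ^ (\<Sum>x<N. rat_bits (of_nat (g x)))"
      by (rule sum_two_power_le) (simp, rule rat_bits_ge_1)
    finally show ?thesis .
  qed
  let ?b = "\<lambda>i j. rat_bits (of_nat (demand I i j k))"
  have "(\<Sum>i<N. \<Sum>j<N. ?b i j) \<le> (\<Sum>k<n. \<Sum>i<N. \<Sum>j<N. rat_bits (of_nat (demand I i j k)))"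
    using assms member_le_sum[of k "{..<n}" "\<lambda>k. \<Sum>i<N. \<Sum>j<N. rat_bits (of_nat (demand I i j k))"] by auto
  then have tot: "(\<Sum>i<N. \<Sum>j<N. ?b i j) \<le> \<beta>" using bits_parts(4) by linarith
  have "port_load I p k \<le> 2 ^ (\<Sum>i<N. \<Sum>j<N. ?b i j)"
  proof (cases "p < N")
    case True
    then have le: "(\<Sum>j<N. ?b p j) \<le> (\<Sum>i<N. \<Sum>j<N. ?b i j)"
      using member_le_sum[of p "{..<N}" "\<lambda>i. \<Sum>j<N. ?b i j"] by auto
    have eq: "port_load I p k = (\<Sum>j<N. demand I p j k)" using True by (simp add: port_load_def)
    show ?thesis unfolding eq by (rule order_trans[OF row pow_mono[OF le]])
  next
    case False
    define q where "q = p - N"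
    have "q < N" using assms(1) False unfolding q_def by simp
    then have le: "(\<Sum>i<N. ?b i q) \<le> (\<Sum>i<N. \<Sum>j<N. ?b i j)"
      by (intro sum_mono) (auto intro!: member_le_sum[of q "{..<N}"])
    have eq: "port_load I p k = (\<Sum>i<N. demand I i q k)" using False by (simp add: port_load_def q_def)
    show ?thesis unfolding eq by (rule order_trans[OF row pow_mono[OF le]])
  qed
  then show ?thesis using pow_mono[OF tot, where 'a=nat] by linarith
qed

text \<open>The two ways in which \<open>h\<close> is used. The first leaves room for exponents such
  as those of the residual weights, with \<beta> bits for each of up to \<beta> coflows. The second,
  with \<open>h < 2 ^ h\<close>, covers counters and the number of emitted intervals, which is
  quadratic in the number of flows.\<close>

lemma h_ge: "\<beta> * \<beta> + 8 * \<beta> + 8 \<le> h" "8 * (\<beta> * \<beta>) + 8 * \<beta> + 8 \<le> h"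
  unfolding h_def power2_eq_square by (simp_all add: algebra_simps)

lemma le_two_power_hI: "x \<le> 8 * (\<beta> * \<beta>) + 8 * \<beta> + 8 \<Longrightarrow> x \<le> 2 ^ h"
  using h_ge(2) less_exp[of h] by linarith

lemma two_power_le_h: "a \<le> \<beta> * \<beta> + 8 * \<beta> + 8 \<Longrightarrow> (2::'a::linordered_semidom) ^ a \<le> 2 ^ h"
  by (rule pow_mono) (use h_ge(1) in linarith)

lemma n_le: "2 * n \<le> \<beta>" and flows_le: "n * N * N \<le> \<beta>"
  using input_count_le unfolding input_count_def by auto

lemma ports_le_flows: "0 < n \<Longrightarrow> N \<le> n * N * N"
  using N_pos by (simp add: mult.assoc)

lemma ports_le: "N \<le> 2 ^ \<beta>"
  using nat_le_two_power_rat_bits[of N] pow_mono[OF bits_parts(2), where 'a=nat] by linarith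

text \<open>Without coflows \<open>input_count\<close> is 3, whatever the number of ports. Loops
  over ports are bounded only if there is a coflow, so the programs place them inside loops over the
  coflows.\<close>

lemma loop_bounds:
  "n \<le> M" "0 < n \<Longrightarrow> N \<le> M" "0 < n \<Longrightarrow> 2 * N \<le> M" "n * N * N \<le> M" "2 * (n * N * N) \<le> M"
proof -
  show "2 * N \<le> M" if "0 < n"
    using mult_le_mono2[OF ports_le_flows[OF that], of 2]
    by (rule order_trans) (simp add: M_def input_count_def)
  then show "N \<le> M" if "0 < n" using that by linarith
qed (auto simp: M_def input_count_def)

lemma size_bounds:
  "n \<le> 2 ^ h" "N \<le> 2 ^ h" "2 * N \<le> 2 ^ h" "n * N * N \<le> 2 ^ h" "2 * (n * N * N) \<le> 2 ^ h"
proof -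
  show "n \<le> 2 ^ h" "n * N * N \<le> 2 ^ h" "2 * (n * N * N) \<le> 2 ^ h"
    by (rule le_two_power_hI; use n_le flows_le in linarith)+
  have "2 * N \<le> 2 ^ (\<beta> + 1)" using ports_le by simp
  also have "\<dots> \<le> 2 ^ h" by (rule two_power_le_h) simp
  finally show "2 * N \<le> 2 ^ h" .
  then show "N \<le> 2 ^ h" by simp
qed

lemma fits_if_le_two_power: "x \<le> 2 ^ \<beta> \<Longrightarrow> fits h (of_nat x)"
  by (rule fits_of_nat) (use two_power_le_h[of \<beta>, where 'a=nat] in linarith)

lemma encode_eqs:
  "encode I 0 0 = of_nat (cores I)" "encode I 0 1 = of_nat N" "encode I 0 2 = of_nat n"
  "i < N \<Longrightarrow> j < N \<Longrightarrow> k < n \<Longrightarrow> encode I 1 (of_nat ((k * N + i) * N + j)) = of_nat (demand I i j k)"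
  "k < n \<Longrightarrow> encode I 2 (of_nat k) = release I k" "k < n \<Longrightarrow> encode I 3 (of_nat k) = weight I k"
  "a > 3 \<Longrightarrow> encode I a q = 0"
proof -
  show "i < N \<Longrightarrow> j < N \<Longrightarrow> k < n \<Longrightarrow> encode I 1 (of_nat ((k * N + i) * N + j)) = of_nat (demand I i j k)"
  proof -
    assume ijk: "i < N" "j < N" "k < n"
    \<comment> \<open>Uniqueness of mixed-radix digits: exactly one triple of indices in the sum of
      \<open>encode\<close> matches a given address.\<close>
    have eq: "(k * N + i) * N + j = (k' * N + i') * N + j' \<longleftrightarrow> k' = k \<and> i' = i \<and> j' = j"
      if "i' < N" "j' < N" for k' i' j'
    proof
      assume e: "(k * N + i) * N + j = (k' * N + i') * N + j'"
      from arg_cong[OF e, of "\<lambda>x. x mod N"] have "j' = j" using ijk that by simp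
      moreover from arg_cong[OF e, of "\<lambda>x. x div N"] have e': "k * N + i = k' * N + i'" using ijk that by simp
      from arg_cong[OF e', of "\<lambda>x. x mod N"] have "i' = i" using ijk that by simp
      moreover from arg_cong[OF e', of "\<lambda>x. x div N"] have "k' = k" using ijk that by simp
      ultimately show "k' = k \<and> i' = i \<and> j' = j" by simp
    qed simp
    have "encode I 1 (of_nat ((k * N + i) * N + j)) = (\<Sum>k'<n. \<Sum>i'<N. \<Sum>j'<N.
        if (k * N + i) * N + j = (k' * N + i') * N + j' then of_nat (demand I i' j' k') else 0)"
      unfolding encode_def by (simp del: of_nat_add of_nat_mult)
    also have "\<dots> = (\<Sum>k'<n. \<Sum>i'<N. \<Sum>j'<N.
        if k' = k then if i' = i then if j' = j then of_nat (demand I i' j' k') else 0 else 0 else 0)"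
      by (intro sum.cong refl) (auto simp: eq)
    also have "\<dots> = (\<Sum>k'<n. if k' = k then \<Sum>i'<N. if i' = i then \<Sum>j'<N.
        if j' = j then of_nat (demand I i' j' k') else 0 else 0 else 0)"
    proof -
      have "(\<Sum>x\<in>A. if P then g x else 0) = (if P then \<Sum>x\<in>A. g x else 0)"
        for A :: "nat set" and P and g :: "nat \<Rightarrow> rat" by simp
      then show ?thesis by (simp only:)
    qed
    also have "\<dots> = of_nat (demand I i j k)" using ijk by simp
    finally show ?thesis .
  qed
qed (auto simp: encode_def)

lemma all_fit_encode: "all_fit h (encode I)"
  unfolding all_fit_def
proof (intro allI)
  fix a :: nat and q
  have fit: "fits h x" if "rat_bits x \<le> \<beta>" for x
    using fits_rat_bits by (rule fits_mono) (use that h_ge(1) in linarith)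
  consider "a = 0" | "a = 1" | "a = 2" | "a = 3" | "a > 3" by linarith
  then show "fits h (encode I a q)"
  proof cases
    case 1
    then show ?thesis using bits_parts(1,2,3) by (auto simp: encode_def intro: fit)
  next
    case 2
    show ?thesis
    proof (cases "\<exists>k i j. k < n \<and> i < N \<and> j < N \<and> q = of_nat ((k * N + i) * N + j)")
      case True
      then show ?thesis using 2 encode_eqs(4) fit[OF demand_bits] by auto
    next
      case False
      then have "encode I a q = 0" using 2 unfolding encode_def
        by (simp only: fun_upd_apply) (auto intro!: sum.neutral)
      then show ?thesis by simp
    qed
  next
    case 3
    show ?thesis
    proof (cases "\<exists>k<n. q = of_nat k")
      case True
      then show ?thesis using 3 encode_eqs(5) fit[OF release_bits] by auto
    next
      case False
      then have "encode I a q = 0" using 3 unfolding encode_def by (auto intro!: sum.neutral)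
      then show ?thesis by simp
    qed
  next
    case 4
    show ?thesis
    proof (cases "\<exists>k<n. q = of_nat k")
      case True
      then show ?thesis using 4 encode_eqs(6) fit[OF weight_bits] by auto
    next
      case False
      then have "encode I a q = 0" using 4 unfolding encode_def by (auto intro!: sum.neutral)
      then show ?thesis by simp
    qed
  next
    case 5
    then show ?thesis using encode_eqs(7) by simp
  qed
qed

end


subsection \<open>Port loads\<close>

lemma run_Seq_Assign:
  assumes "all_fit h s" "val e s = q" "val f s = v" "fits h v"
    and "\<And>t. all_fit h t \<Longrightarrow> t = s(a := (s a)(q := v)) \<Longrightarrow> run M h d t Q"
  shows "run M h (Seq (Assign a e f) d) s Q"
  by (rule run_Seq, rule run_Assign[OF assms(1-4)], rule assms(5))
    (use assms(1,4) in \<open>auto simp: all_fit_def\<close>)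

lemma run_Seq_spec:
  assumes "run M h c s P"
    and "\<And>t. all_fit h t \<Longrightarrow> same_outside (writes c) s t \<Longrightarrow> P t \<Longrightarrow> run M h d t Q"
  shows "run M h (Seq c d) s Q"
  by (rule run_Seq, rule run_conseq[OF assms(1)], rule assms(2))

lemma same_outsideD: "same_outside W s t \<Longrightarrow> a \<notin> W \<Longrightarrow> t a = s a"
  unfolding same_outside_def by blast

abbreviation Var :: "nat \<Rightarrow> exp" where "Var a \<equiv> Cell a (Const 0)"
abbreviation Ports :: exp where "Ports \<equiv> Cell 0 (Const 1)"
abbreviation Coflows :: exp where "Coflows \<equiv> Cell 0 (Const 2)"

text \<open>Cell 23 counts the triples and so always holds the mixed-radix number of the current
  one. The coflow loop is outermost, which keeps the port loops within the bounds of
  \<open>loop_bounds\<close>.\<close>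

definition For_flows :: "prog \<Rightarrow> prog" where
  "For_flows c = Seq (Assign 23 (Const 0) (Const 0)) (For 20 Coflows (For 21 Ports (For 22 Ports
     (Seq c (Assign 23 (Const 0) (Add (Var 23) (Const 1)))))))"

lemma writes_For_flows [simp]: "writes (For_flows c) = {20, 21, 22, 23} \<union> writes c"
  by (auto simp: For_flows_def)

text \<open>With \<open>n\<close> coflows, entry \<open>p * n + k\<close> of array 11 accumulates
  the load of coflow \<open>k\<close> at port \<open>p\<close>. Each demand is added twice, for its
  source and for its destination.\<close>

definition loads_step :: prog where
  "loads_step = Seq
     (Assign 11 (Add (Mul (Var 21) Coflows) (Var 20))
       (Add (Cell 11 (Add (Mul (Var 21) Coflows) (Var 20))) (Cell 1 (Var 23))))
     (Assign 11 (Add (Mul (Add Ports (Var 22)) Coflows) (Var 20))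
       (Add (Cell 11 (Add (Mul (Add Ports (Var 22)) Coflows) (Var 20))) (Cell 1 (Var 23))))"

definition loads_prog :: prog where "loads_prog = For_flows loads_step"

lemma writes_loads_prog [simp]:
  "writes loads_step = {11}" "writes loads_prog = {11, 20, 21, 22, 23}"
  by (auto simp: loads_prog_def loads_step_def)

lemma pair_index_eq:
  fixes a b c :: nat
  assumes "a < c" "b < c"
  shows "p * c + a = q * c + b \<longleftrightarrow> p = q \<and> a = b"
proof
  assume e: "p * c + a = q * c + b"
  from arg_cong[OF e, of "\<lambda>x. x div c"] arg_cong[OF e, of "\<lambda>x. x mod c"]
  show "p = q \<and> a = b" using assms by simp
qed simp

context valid_coflow_instance
begin

lemma run_For_flows:
  assumes s: "all_fit h s" "s 0 1 = of_nat N" "s 0 2 = of_nat n"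
    and c: "writes c \<inter> {0, 20, 21, 22, 23} = {}"
    and indep: "\<And>z t a v. a \<in> {20, 21, 22, 23} \<Longrightarrow> Inv z (t(a := v)) = Inv z t"
    and init: "Inv 0 s"
    and step: "\<And>x i j z t. x < n \<Longrightarrow> i < N \<Longrightarrow> j < N \<Longrightarrow> z = (x * N + i) * N + j \<Longrightarrow> all_fit h t \<Longrightarrow>
      same_outside ({20, 21, 22, 23} \<union> writes c) s t \<Longrightarrow> t 20 0 = of_nat x \<Longrightarrow> t 21 0 = of_nat i \<Longrightarrow>
      t 22 0 = of_nat j \<Longrightarrow> t 23 0 = of_nat z \<Longrightarrow> Inv z t \<Longrightarrow> run M h c t (Inv (Suc z))"
    and fin: "\<And>t. all_fit h t \<Longrightarrow> same_outside ({20, 21, 22, 23} \<union> writes c) s t \<Longrightarrow>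
      Inv (n * N * N) t \<Longrightarrow> Q t"
  shows "run M h (For_flows c) s Q"
proof -
  let ?c = "Seq c (Assign 23 (Const 0) (Add (Var 23) (Const 1)))"
  let ?W = "{20, 21, 22, 23} \<union> writes c"
  have notin: "0 \<notin> writes c" "20 \<notin> writes c" "21 \<notin> writes c" "22 \<notin> writes c" "23 \<notin> writes c"
    using c by auto
  have input: "t 0 = s 0" if "same_outside ?W s t" for t
    using same_outsideD[OF that] notin by simp
  define J where "J = (\<lambda>z t. t 23 0 = of_nat z \<and> Inv z t)"
  have J_indep: "J z (t(a := v)) = J z t" if "a \<in> {20, 21, 22}" for z t a v
    using that indep[of a] unfolding J_def by auto
  have body: "run M h ?c t (J (Suc z))"
    if "x < n" "i < N" "j < N" "z = (x * N + i) * N + j" "all_fit h t" "same_outside ?W s t"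
      "t 20 0 = of_nat x" "t 21 0 = of_nat i" "t 22 0 = of_nat j" "J z t" for x i j z t
  proof (rule run_Seq_spec[OF step[OF that(1-9)]])
    fix t' assume t': "all_fit h t'" "same_outside (writes c) t t'" "Inv (Suc z) t'"
    have z: "t' 23 0 = of_nat z" using that(10) same_outsideD[OF t'(2)] notin unfolding J_def by simp
    have "x * N + i + 1 \<le> n * N" using that(1,2) mult_le_mono1[of "Suc x" n N] by simp
    then have "(x * N + i + 1) * N \<le> n * N * N" by (rule mult_le_mono1)
    then have "Suc z \<le> n * N * N" using that(3,4) by (simp add: algebra_simps)
    then have "fits h (of_nat (Suc z))" using size_bounds(4) by (intro fits_of_nat) linarith
    then show "run M h (Assign 23 (Const 0) (Add (Var 23) (Const 1))) t' (J (Suc z))"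
      using t' z by (intro run_Assign[where q = 0 and v = "of_nat (Suc z)"])
        (auto simp: J_def indep)
  qed (use that in \<open>auto simp: J_def\<close>)
  have loop_j: "run M h (For 22 Ports ?c) t
      (J ((x * N + Suc i) * N))"
    if A: "x < n" "i < N" "all_fit h t" "same_outside ?W s t" "t 20 0 = of_nat x" "t 21 0 = of_nat i"
      "J ((x * N + i) * N) t" for x i t
  proof (rule run_For[where K = N and Inv = "\<lambda>j. J ((x * N + i) * N + j)"])
    show "N \<le> M" using A(1) loop_bounds(2) by simp
    show "val Ports t' = of_nat N" if t': "same_outside (insert 22 (writes ?c)) t t'" for t'
      using same_outsideD[OF t', of 0] input[OF A(4)] s notin by simp
    show "run M h ?c t' (J ((x * N + i) * N + Suc j))"
      if j: "j < N" "all_fit h t'" "same_outside (insert 22 (writes ?c)) t t'"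
        "t' 22 0 = of_nat j" "J ((x * N + i) * N + j) t'" for j t'
    proof -
      have "same_outside ?W s t'" using A(4) j(3) by (rule same_outside_trans) auto
      moreover have "t' 20 = t 20" "t' 21 = t 21" using same_outsideD[OF j(3)] notin by auto
      ultimately show ?thesis using body[OF A(1,2) j(1) refl j(2)] A j by simp
    qed
    show "J ((x * N + Suc i) * N) t'" if "J ((x * N + i) * N + N) t'" for t'
      using that by (simp add: algebra_simps)
  qed (use A size_bounds notin J_indep in auto)
  have loop_i: "run M h (For 21 Ports (For 22 Ports ?c)) t
      (J (Suc x * N * N))"
    if B: "x < n" "all_fit h t" "same_outside ?W s t" "t 20 0 = of_nat x" "J (x * N * N) t" for x t
  proof (rule run_For[where K = N and Inv = "\<lambda>i. J ((x * N + i) * N)"])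
    show "N \<le> M" using B(1) loop_bounds(2) by simp
    let ?V = "insert 21 (writes (For 22 Ports ?c))"
    show "val Ports t' = of_nat N" if t': "same_outside ?V t t'" for t'
      using same_outsideD[OF t', of 0] input[OF B(3)] s notin by simp
    show "run M h (For 22 Ports ?c) t' (J ((x * N + Suc i) * N))"
      if i: "i < N" "all_fit h t'" "same_outside ?V t t'" "t' 21 0 = of_nat i" "J ((x * N + i) * N) t'" for i t'
    proof -
      have "same_outside ?W s t'" using B(3) i(3) by (rule same_outside_trans) auto
      moreover have "t' 20 = t 20" using same_outsideD[OF i(3)] notin by auto
      ultimately show ?thesis using loop_j[OF B(1) i(1,2)] B i by simp
    qed
    show "J (Suc x * N * N) t'" if "J ((x * N + N) * N) t'" for t'
      using that by (simp add: algebra_simps)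
  qed (use B size_bounds notin J_indep in auto)
  show ?thesis unfolding For_flows_def
  proof (rule run_Seq_Assign[where q = 0 and v = 0])
    fix t assume t: "all_fit h t" "t = s(23 := (s 23)(0 := 0))"
    let ?V = "insert 20 (writes (For 21 Ports (For 22 Ports ?c)))"
    have st: "same_outside ?W s t'" if "same_outside ?V t t'" for t'
      using that unfolding t(2) same_outside_def by auto
    show "run M h (For 20 Coflows (For 21 Ports (For 22 Ports ?c))) t Q"
    proof (rule run_For[where K = n and Inv = "\<lambda>x. J (x * N * N)"])
      show "val Coflows t' = of_nat n" if t': "same_outside ?V t t'" for t'
        using input[OF st[OF t']] s by simp
      show "J (0 * N * N) t" using init indep[of 23] t(2) unfolding J_def by simp
      show "run M h (For 21 Ports (For 22 Ports ?c)) t' (J (Suc x * N * N))"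
        if "x < n" "all_fit h t'" "same_outside ?V t t'" "t' 20 0 = of_nat x" "J (x * N * N) t'" for x t'
        using loop_i[OF that(1,2) st[OF that(3)] that(4,5)] .
      show "Q t'" if "all_fit h t'" "same_outside ?V t t'" "J (n * N * N) t'" for t'
        using fin[OF that(1) st[OF that(2)]] that(3) unfolding J_def by simp
    qed (use t loop_bounds size_bounds notin J_indep in auto)
  qed (use s in auto)
qed

text \<open>Load due to the first \<open>z\<close> entries of the demand array, decoded by
  \<open>div\<close> and \<open>mod\<close>. This is the content of array 11 after \<open>z\<close>
  rounds of the flow loop.\<close>

definition partial_load :: "nat \<Rightarrow> nat \<Rightarrow> nat \<Rightarrow> nat" where
  "partial_load z p k = (\<Sum>y<z. if y div N div N = k then
     (if y div N mod N = p then demand I (y div N mod N) (y mod N) (y div N div N) else 0) +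
     (if N + y mod N = p then demand I (y div N mod N) (y mod N) (y div N div N) else 0) else 0)"

lemma partial_load_eq:
  assumes "p < 2 * N" "k < n"
  shows "partial_load (n * N * N) p k = port_load I p k"
proof -
  let ?f = "\<lambda>x i j. if x = k then (if i = p then demand I i j x else 0) +
      (if N + j = p then demand I i j x else 0) else 0"
  have "partial_load (n * N * N) p k = (\<Sum>y<n * N. \<Sum>j<N. ?f (y div N) (y mod N) j)"
    unfolding partial_load_def using sum_grid[of "\<lambda>y j. ?f (y div N) (y mod N) j" N "n * N"] by simp
  also have "\<dots> = (\<Sum>x<n. \<Sum>i<N. \<Sum>j<N. ?f x i j)"
    using sum_grid[of "\<lambda>x i. \<Sum>j<N. ?f x i j" N n] by simp
  also have "\<dots> = (\<Sum>x<n. if x = k then \<Sum>i<N. \<Sum>j<N. (if i = p then demand I i j x else 0) +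
      (if N + j = p then demand I i j x else 0) else 0)"
    by (intro sum.cong refl) simp
  also have "\<dots> = (\<Sum>i<N. \<Sum>j<N. (if i = p then demand I i j k else 0) +
      (if N + j = p then demand I i j k else 0))"
    using assms(2) by simp
  also have "\<dots> = port_load I p k"
  proof (cases "p < N")
    case True
    have "(\<Sum>i<N. \<Sum>j<N. (if i = p then demand I i j k else 0) + (if N + j = p then demand I i j k else 0))
        = (\<Sum>i<N. if i = p then \<Sum>j<N. demand I i j k else 0)"
      using True by (intro sum.cong refl) auto
    then show ?thesis using True by (simp add: port_load_def)
  next
    case False
    have "(\<Sum>i<N. \<Sum>j<N. (if i = p then demand I i j k else 0) + (if N + j = p then demand I i j k else 0))
        = (\<Sum>i<N. \<Sum>j<N. if j = p - N then demand I i j k else 0)"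
      using False by (intro sum.cong refl) auto
    moreover have "p - N < N" using assms(1) False by simp
    ultimately show ?thesis using False by (simp add: port_load_def)
  qed
  finally show ?thesis .
qed

lemma partial_load_le:
  assumes "p < 2 * N" "k < n" "z \<le> n * N * N"
  shows "partial_load z p k \<le> 2 ^ \<beta>"
proof -
  have "partial_load z p k \<le> partial_load (n * N * N) p k"
    unfolding partial_load_def using assms(3) by (intro sum_mono2) auto
  then show ?thesis using partial_load_eq[OF assms(1,2)] port_load_le[OF assms(1,2)] by linarith
qed

definition loads_stored :: "memory \<Rightarrow> bool" where
  "loads_stored s \<longleftrightarrow> (\<forall>p<2 * N. \<forall>k<n. s 11 (of_nat (p * n + k)) = of_nat (port_load I p k))"

lemma run_loads_prog: "run M h loads_prog (encode I) loads_stored"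
  unfolding loads_prog_def
proof (rule run_For_flows[where Inv = "\<lambda>z t. \<forall>p<2 * N. \<forall>k<n. t 11 (of_nat (p * n + k)) = of_nat (partial_load z p k)"])
  show "all_fit h (encode I)" by (rule all_fit_encode)
  show "encode I 0 1 = of_nat N" "encode I 0 2 = of_nat n" by (rule encode_eqs)+
  show "\<forall>p<2 * N. \<forall>k<n. encode I 11 (of_nat (p * n + k)) = of_nat (partial_load 0 p k)"
    by (simp add: encode_eqs(7) partial_load_def)
next
  fix x i j z and t :: memory
  assume xij: "x < n" "i < N" "j < N" "z = (x * N + i) * N + j" and t: "all_fit h t"
    and same: "same_outside ({20, 21, 22, 23} \<union> writes loads_step) (encode I) t"
    and cells: "t 20 0 = of_nat x" "t 21 0 = of_nat i" "t 22 0 = of_nat j" "t 23 0 = of_nat z"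
    and L: "\<forall>p<2 * N. \<forall>k<n. t 11 (of_nat (p * n + k)) = of_nat (partial_load z p k)"
  have inp: "t 0 1 = of_nat N" "t 0 2 = of_nat n" "t 1 (of_nat z) = of_nat (demand I i j x)"
    using same_outsideD[OF same] encode_eqs(2,3) encode_eqs(4)[OF xij(2,3,1)] xij(4) by auto
  have zz: "z div N = x * N + i" "z mod N = j" "z div N div N = x" "z div N mod N = i"
    using xij by simp_all
  have "x * N + i + 1 \<le> n * N" using xij mult_le_mono1[of "Suc x" n N] by simp
  then have "(x * N + i + 1) * N \<le> n * N * N" by (rule mult_le_mono1)
  then have Suc_z: "Suc z \<le> n * N * N" using xij by (simp add: algebra_simps)
  let ?d = "demand I i j x"
  \<comment> \<open>The table between the two assignments: the entry of the source is updated, the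
    entry of the destination is not.\<close>
  define g where "g = (\<lambda>p k. partial_load z p k + (if p = i \<and> k = x then ?d else 0))"
  have next_load: "partial_load (Suc z) p k = g p k + (if p = N + j \<and> k = x then ?d else 0)" for p k
    using zz unfolding partial_load_def g_def by auto
  have fit: "fits h (of_nat (partial_load (Suc z) p k))" if "p < 2 * N" "k < n" for p k
    using fits_if_le_two_power[OF partial_load_le[OF that Suc_z]] .
  have fit_g: "fits h (of_nat (g p k))" if "p < 2 * N" "k < n" for p k
    using partial_load_le[OF that Suc_z] next_load[of p k] by (intro fits_if_le_two_power) simp
  show "run M h loads_step t
     (\<lambda>t. \<forall>p<2 * N. \<forall>k<n. t 11 (of_nat (p * n + k)) = of_nat (partial_load (Suc z) p k))"
    unfolding loads_step_def
  proof (rule run_Seq_Assign[where q = "of_nat (i * n + x)" and v = "of_nat (g i x)"])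
    show "val (Add (Mul (Var 21) Coflows) (Var 20)) t = of_nat (i * n + x)"
      using cells inp by simp
    moreover have "t 11 (of_nat (i * n + x)) = of_nat (partial_load z i x)" using L xij by auto
    ultimately show "val (Add (Cell 11 (Add (Mul (Var 21) Coflows) (Var 20))) (Cell 1 (Var 23))) t = of_nat (g i x)"
      using cells inp by (simp add: g_def)
    show "fits h (of_nat (g i x))" using xij by (intro fit_g) auto
    fix t' assume t': "all_fit h t'" "t' = t(11 := (t 11)(of_nat (i * n + x) := of_nat (g i x)))"
    have L': "t' 11 (of_nat (p * n + k)) = of_nat (g p k)" if "p < 2 * N" "k < n" for p k
      using L that xij(1) unfolding t'(2) g_def
      by (auto simp: pair_index_eq simp del: of_nat_add of_nat_mult)
    show "run M h (Assign 11 (Add (Mul (Add Ports (Var 22)) Coflows) (Var 20))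
       (Add (Cell 11 (Add (Mul (Add Ports (Var 22)) Coflows) (Var 20))) (Cell 1 (Var 23)))) t'
       (\<lambda>t. \<forall>p<2 * N. \<forall>k<n. t 11 (of_nat (p * n + k)) = of_nat (partial_load (Suc z) p k))"
    proof (rule run_Assign[where q = "of_nat ((N + j) * n + x)" and v = "of_nat (partial_load (Suc z) (N + j) x)"])
      show a: "val (Add (Mul (Add Ports (Var 22)) Coflows) (Var 20)) t' = of_nat ((N + j) * n + x)"
        using cells inp t'(2) by simp
      have "t' 11 (of_nat ((N + j) * n + x)) = of_nat (g (N + j) x)" using xij by (intro L') auto
      then show "val (Add (Cell 11 (Add (Mul (Add Ports (Var 22)) Coflows) (Var 20))) (Cell 1 (Var 23))) t'
          = of_nat (partial_load (Suc z) (N + j) x)"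
        using a cells inp t'(2) by (simp add: next_load del: of_nat_mult)
      show "fits h (of_nat (partial_load (Suc z) (N + j) x))" using xij by (intro fit) auto
      show "\<forall>p<2 * N. \<forall>k<n. (t'(11 := (t' 11)(of_nat ((N + j) * n + x) := of_nat (partial_load (Suc z) (N + j) x)))) 11
          (of_nat (p * n + k)) = of_nat (partial_load (Suc z) p k)"
        using L' xij(1) by (auto simp: pair_index_eq next_load simp del: of_nat_add of_nat_mult)
    qed (rule t'(1))
  qed (rule t)
qed (auto simp: loads_stored_def partial_load_eq)

end


subsection \<open>Computing the order\<close>

text \<open>Memory of the order computation: array 13 holds the order, array 3 is overwritten by the
  residual weights, 24 counts the placed coflows, 26 is the position to be filled, 27 the port of
  maximal load, 28 the selected position, 29 the ratio, 30 a temporary for the exchange. Cells 39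
  and 40 hold the best and the current load, 25 and 41 are loop counters.\<close>

definition init_prog :: prog where
  "init_prog = For 20 Coflows (Assign 13 (Var 20) (Var 20))"

abbreviation Load :: "exp \<Rightarrow> exp \<Rightarrow> exp" where
  "Load e f \<equiv> Cell 11 (Add (Mul e Coflows) f)"

definition sum_prog :: prog where
  "sum_prog = Seq (Assign 40 (Const 0) (Const 0)) (For 41 (Add (Var 26) (Const 1))
     (Assign 40 (Const 0) (Add (Var 40) (Load (Var 25) (Cell 13 (Var 41))))))"

definition peak_prog :: prog where
  "peak_prog = Seq (Assign 27 (Const 0) (Const 0)) (Seq (Assign 39 (Const 0) (Const 0))
     (For 25 (Mul (Const 2) Ports) (Seq sum_prog
       (IfLess (Var 39) (Var 40) (Seq (Assign 39 (Const 0) (Var 40)) (Assign 27 (Const 0) (Var 25))) Skip))))"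

text \<open>Ratios are compared by cross-multiplication. A coflow of load 0 then never displaces the
  current choice, and as the current choice it is displaced by any coflow of positive load unless
  its own weight is 0.\<close>

definition select_prog :: prog where
  "select_prog = Seq (Assign 28 (Const 0) (Const 0)) (For 25 (Add (Var 26) (Const 1))
     (IfLess (Mul (Cell 3 (Cell 13 (Var 25))) (Load (Var 27) (Cell 13 (Var 28))))
       (Mul (Cell 3 (Cell 13 (Var 28))) (Load (Var 27) (Cell 13 (Var 25))))
       (Assign 28 (Const 0) (Var 25)) Skip))"

text \<open>The ratio is stored first because the loop changes the weight of the selected coflow,
  from which it is computed.\<close>

definition update_prog :: prog where
  "update_prog = Seq (Assign 29 (Const 0) (Div (Cell 3 (Cell 13 (Var 28))) (Load (Var 27) (Cell 13 (Var 28)))))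
     (For 25 (Add (Var 26) (Const 1)) (Assign 3 (Cell 13 (Var 25))
       (Sub (Cell 3 (Cell 13 (Var 25))) (Mul (Var 29) (Load (Var 27) (Cell 13 (Var 25)))))))"

definition swap_prog :: prog where
  "swap_prog = Seq (Assign 30 (Const 0) (Cell 13 (Var 28)))
     (Seq (Assign 13 (Var 28) (Cell 13 (Var 26))) (Assign 13 (Var 26) (Var 30)))"

definition order_prog :: prog where
  "order_prog = Seq init_prog (For 24 Coflows (Seq (Assign 26 (Const 0) (Sub (Sub Coflows (Var 24)) (Const 1)))
     (Seq peak_prog (Seq select_prog (Seq update_prog swap_prog)))))"

lemma writes_order_progs [simp]:
  "writes init_prog = {13, 20}" "writes sum_prog = {40, 41}" "writes peak_prog = {25, 27, 39, 40, 41}"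
  "writes select_prog = {25, 28}" "writes update_prog = {3, 25, 29}" "writes swap_prog = {13, 30}"
  "writes order_prog = {3, 13, 20, 24, 25, 26, 27, 28, 29, 30, 39, 40, 41}"
  by (auto simp: init_prog_def sum_prog_def peak_prog_def select_prog_def update_prog_def
      swap_prog_def order_prog_def)

text \<open>The index \<open>\<pi> b\<close> minimises the ratio of residual weight and load among the first \<open>y\<close>
  positions, where a ratio with load 0 is considered infinite, and one with weight 0 minimal.\<close>

definition selected :: "(nat \<Rightarrow> rat) \<Rightarrow> (nat \<Rightarrow> nat) \<Rightarrow> (nat \<Rightarrow> nat) \<Rightarrow> nat \<Rightarrow> nat \<Rightarrow> bool" where
  "selected w l \<pi> b y \<longleftrightarrow>
     0 < l (\<pi> b) \<and> (\<forall>x<y. w (\<pi> b) * of_nat (l (\<pi> x)) \<le> w (\<pi> x) * of_nat (l (\<pi> b))) \<or>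
     l (\<pi> b) = 0 \<and> (w (\<pi> b) = 0 \<or> (\<forall>x<y. l (\<pi> x) = 0))"

lemma selected_keep:
  assumes "selected w l \<pi> b y" "\<not> w (\<pi> y) * of_nat (l (\<pi> b)) < w (\<pi> b) * of_nat (l (\<pi> y))"
    "0 \<le> w (\<pi> b)"
  shows "selected w l \<pi> b (Suc y)"
  using assms unfolding selected_def by (auto simp: less_Suc_eq not_less mult_le_0_iff)

text \<open>Transitivity of the comparison of ratios in cross-multiplied form, by multiplication
  with the positive load of \<open>\<pi> b\<close>. Strictness makes the weight of
  \<open>\<pi> b\<close> and the load of \<open>\<pi> y\<close> positive, which settles the case of
  load 0 at \<open>\<pi> b\<close>: all earlier loads are then 0.\<close>

lemma selected_change:
  assumes sel: "selected w l \<pi> b y" and less: "w (\<pi> y) * of_nat (l (\<pi> b)) < w (\<pi> b) * of_nat (l (\<pi> y))"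
    and w: "\<And>x. x \<le> y \<Longrightarrow> 0 \<le> w (\<pi> x)" "0 \<le> w (\<pi> b)"
  shows "selected w l \<pi> y (Suc y)"
proof -
  have "0 \<le> w (\<pi> y) * of_nat (l (\<pi> b))" using w(1)[of y] by simp
  then have "0 < w (\<pi> b) * of_nat (l (\<pi> y))" using less by linarith
  then have pos: "0 < w (\<pi> b)" "0 < l (\<pi> y)" using w(2) by (auto simp: zero_less_mult_iff)
  have "w (\<pi> y) * of_nat (l (\<pi> x)) \<le> w (\<pi> x) * of_nat (l (\<pi> y))" if x: "x < y" for x
  proof (cases "l (\<pi> b) = 0")
    case True
    then have "l (\<pi> x) = 0" using sel pos x unfolding selected_def by auto
    then show ?thesis using w(1)[of x] x by simp
  next
    case False
    then have b: "w (\<pi> b) * of_nat (l (\<pi> x)) \<le> w (\<pi> x) * of_nat (l (\<pi> b))"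
      using sel x unfolding selected_def by auto
    have "w (\<pi> y) * of_nat (l (\<pi> x)) * of_nat (l (\<pi> b)) = w (\<pi> y) * of_nat (l (\<pi> b)) * of_nat (l (\<pi> x))"
      by simp
    also have "\<dots> \<le> w (\<pi> b) * of_nat (l (\<pi> y)) * of_nat (l (\<pi> x))"
      using less by (intro mult_right_mono) auto
    also have "\<dots> = w (\<pi> b) * of_nat (l (\<pi> x)) * of_nat (l (\<pi> y))" by simp
    also have "\<dots> \<le> w (\<pi> x) * of_nat (l (\<pi> b)) * of_nat (l (\<pi> y))"
      using b by (intro mult_right_mono) auto
    also have "\<dots> = w (\<pi> x) * of_nat (l (\<pi> y)) * of_nat (l (\<pi> b))" by simp
    finally show ?thesis using False by (simp add: mult_le_cancel_right)
  qed
  then show ?thesis using pos unfolding selected_def by (auto simp: less_Suc_eq)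
qed

text \<open>Division by 0 gives 0, so a selected coflow of load 0 yields \<open>\<theta> = 0\<close>
  and changes no weight. A nonzero load is at least 1, which gives the upper bound on
  \<open>\<theta>\<close> needed for its size. The last claim supplies the condition
  \<open>tight\<close> of \<open>order_inv_step\<close>.\<close>

lemma selected_residual:
  assumes sel: "selected w l \<pi> b y" and w: "\<And>x. x < y \<Longrightarrow> 0 \<le> w (\<pi> x)" and b: "b < y"
  defines "\<theta> \<equiv> w (\<pi> b) / of_nat (l (\<pi> b))"
  shows "0 \<le> \<theta>" "\<theta> \<le> w (\<pi> b)" "\<And>x. x < y \<Longrightarrow> 0 \<le> w (\<pi> x) - \<theta> * of_nat (l (\<pi> x))"
    "w (\<pi> b) - \<theta> * of_nat (l (\<pi> b)) = 0 \<or> (\<forall>x<y. l (\<pi> x) = 0)"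
proof -
  show "0 \<le> \<theta>" unfolding \<theta>_def using w[OF b] by simp
  show "\<theta> \<le> w (\<pi> b)"
  proof (cases "l (\<pi> b) = 0")
    case True
    then show ?thesis unfolding \<theta>_def using w[OF b] by simp
  next
    case False
    then have "1 \<le> rat_of_nat (l (\<pi> b))" by simp
    then show ?thesis unfolding \<theta>_def using w[OF b] by (simp add: divide_le_eq mult_le_cancel_left1)
  qed
  show "0 \<le> w (\<pi> x) - \<theta> * of_nat (l (\<pi> x))" if "x < y" for x
  proof (cases "l (\<pi> b) = 0")
    case True
    then show ?thesis unfolding \<theta>_def using w[OF that] by simp
  next
    case False
    then show ?thesis using sel that unfolding selected_def \<theta>_def by (auto simp: field_simps)
  qed
  show "w (\<pi> b) - \<theta> * of_nat (l (\<pi> b)) = 0 \<or> (\<forall>x<y. l (\<pi> x) = 0)"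
    using sel unfolding selected_def \<theta>_def by auto
qed

context valid_coflow_instance
begin

section \<open>Correctness of the parts of the order computation\<close>

definition order_stored :: "(nat \<Rightarrow> nat) \<Rightarrow> nat \<Rightarrow> memory \<Rightarrow> bool" where
  "order_stored \<pi> m s \<longleftrightarrow> s 0 1 = of_nat N \<and> s 0 2 = of_nat n \<and> loads_stored s \<and>
     (\<forall>x<n. s 13 (of_nat x) = of_nat (\<pi> x)) \<and> s 26 0 = of_nat m"

lemma order_stored_cong:
  assumes "order_stored \<pi> m s" "t 0 = s 0" "t 11 = s 11" "t 13 = s 13" "t 26 = s 26"
  shows "order_stored \<pi> m t"
  using assms unfolding order_stored_def loads_stored_def by simp

lemma val_Load:
  assumes "s 0 2 = of_nat n" "loads_stored s" "val e s = of_nat p" "val f s = of_nat k" "p < 2 * N" "k < n"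
  shows "val (Load e f) s = of_nat (port_load I p k)"
proof -
  have "val (Add (Mul e Coflows) f) s = of_nat (p * n + k)" using assms by simp
  then show ?thesis using assms unfolding loads_stored_def by simp
qed

lemma run_init_prog:
  assumes s: "all_fit h s" "s 0 2 = of_nat n"
  shows "run M h init_prog s (\<lambda>t. \<forall>x<n. t 13 (of_nat x) = of_nat x)"
  unfolding init_prog_def
proof (rule run_For[where K = n and Inv = "\<lambda>k t. \<forall>x<k. t 13 (of_nat x) = of_nat x"])
  show "val Coflows t = of_nat n" if "same_outside (insert 20 (writes (Assign 13 (Var 20) (Var 20)))) s t" for t
    using same_outsideD[OF that, of 0] s by simp
  show "run M h (Assign 13 (Var 20) (Var 20)) t (\<lambda>t. \<forall>x<Suc k. t 13 (of_nat x) = of_nat x)"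
    if "k < n" "all_fit h t" "t 20 0 = of_nat k" "\<forall>x<k. t 13 (of_nat x) = of_nat x" for k t
  proof (rule run_Assign[where q = "of_nat k" and v = "of_nat k"])
    show "fits h (of_nat k)" using that(1) size_bounds(1) by (intro fits_of_nat) linarith
  qed (use that in \<open>auto simp: less_Suc_eq\<close>)
qed (use s loop_bounds size_bounds in auto)

context
  fixes \<pi> :: "nat \<Rightarrow> nat" and m :: nat
  assumes m: "m < n" and bij: "bij_betw \<pi> {..<n} {..<n}"
begin

definition prefix_load :: "nat \<Rightarrow> nat \<Rightarrow> nat" where
  "prefix_load p y = (\<Sum>x<y. port_load I p (\<pi> x))"

lemma \<pi>_less: "x < n \<Longrightarrow> \<pi> x < n"
  using bij by (auto simp: bij_betw_def)

lemma prefix_load_eq: "prefix_load p (Suc m) = (\<Sum>k\<in>\<pi> ` {..<Suc m}. port_load I p k)"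
proof -
  have "inj_on \<pi> {..<Suc m}" using bij m unfolding bij_betw_def by (auto intro: inj_on_subset)
  then show ?thesis unfolding prefix_load_def by (simp add: sum.reindex)
qed

lemma prefix_load_fits:
  assumes "p < 2 * N" "y \<le> n"
  shows "fits h (of_nat (prefix_load p y))"
proof (rule fits_of_nat)
  have "prefix_load p y \<le> (\<Sum>x<y. 2 ^ \<beta>)"
    unfolding prefix_load_def using assms \<pi>_less by (intro sum_mono port_load_le) auto
  also have "\<dots> = y * 2 ^ \<beta>" by simp
  also have "\<dots> \<le> 2 ^ \<beta> * 2 ^ \<beta>"
    using assms n_le less_exp[of \<beta>] by (intro mult_right_mono) linarith+
  also have "\<dots> = 2 ^ (\<beta> + \<beta>)" by (simp add: power_add)
  also have "\<dots> \<le> 2 ^ h" by (rule two_power_le_h) simp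
  finally show "prefix_load p y \<le> 2 ^ h" .
qed

lemma Suc_m_bounds: "Suc m \<le> M" "Suc m \<le> 2 ^ h"
  using m loop_bounds(1) size_bounds(1) by linarith+

lemma val_count: "order_stored \<pi> m s \<Longrightarrow> val (Add (Var 26) (Const 1)) s = of_nat (Suc m)"
  unfolding order_stored_def by simp

lemma run_sum_prog:
  assumes s: "all_fit h s" "order_stored \<pi> m s" "s 25 0 = of_nat p" and p: "p < 2 * N"
  shows "run M h sum_prog s (\<lambda>t. t 40 0 = of_nat (prefix_load p (Suc m)))"
  unfolding sum_prog_def
proof (rule run_Seq_Assign[where q = 0 and v = 0])
  fix t assume t: "all_fit h t" "t = s(40 := (s 40)(0 := 0))"
  let ?c = "Assign 40 (Const 0) (Add (Var 40) (Load (Var 25) (Cell 13 (Var 41))))"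
  have ord: "order_stored \<pi> m t'" "t' 25 0 = of_nat p" if "same_outside (insert 41 (writes ?c)) t t'" for t'
    using order_stored_cong[OF s(2), of t'] same_outsideD[OF that] t(2) s(3) by simp_all
  show "run M h (For 41 (Add (Var 26) (Const 1)) ?c) t (\<lambda>t. t 40 0 = of_nat (prefix_load p (Suc m)))"
  proof (rule run_For[where K = "Suc m" and Inv = "\<lambda>y t. t 40 0 = of_nat (prefix_load p y)"])
    show "val (Add (Var 26) (Const 1)) t' = of_nat (Suc m)" if "same_outside (insert 41 (writes ?c)) t t'" for t'
      using val_count[OF ord(1)[OF that]] .
    show "run M h ?c t' (\<lambda>t. t 40 0 = of_nat (prefix_load p (Suc y)))"
      if y: "y < Suc m" "all_fit h t'" "same_outside (insert 41 (writes ?c)) t t'" "t' 41 0 = of_nat y"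
        "t' 40 0 = of_nat (prefix_load p y)" for y t'
    proof (rule run_Assign[where q = 0 and v = "of_nat (prefix_load p (Suc y))"])
      have o: "order_stored \<pi> m t'" "t' 25 0 = of_nat p" by (rule ord[OF y(3)])+
      have "val (Load (Var 25) (Cell 13 (Var 41))) t' = of_nat (port_load I p (\<pi> y))"
        using o y(1,4) m \<pi>_less[of y] p unfolding order_stored_def by (intro val_Load) auto
      then show "val (Add (Var 40) (Load (Var 25) (Cell 13 (Var 41)))) t' = of_nat (prefix_load p (Suc y))"
        using y(5) by (simp add: prefix_load_def)
      show "fits h (of_nat (prefix_load p (Suc y)))" using y(1) m p by (intro prefix_load_fits) auto
    qed (use y in auto)
  qed (use t Suc_m_bounds in \<open>auto simp: prefix_load_def\<close>)
qed (use s in auto)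

lemma run_peak_prog:
  assumes s: "all_fit h s" "order_stored \<pi> m s"
  shows "run M h peak_prog s (\<lambda>t. \<exists>p<2 * N. t 27 0 = of_nat p \<and>
    (\<Sum>k\<in>\<pi> ` {..<Suc m}. port_load I p k) = peak_load I (\<pi> ` {..<Suc m}))"
  unfolding peak_prog_def
proof (rule run_Seq_Assign[where q = 0 and v = 0], goal_cases)
  case (5 s1)
  show ?case
  proof (rule run_Seq_Assign[where q = 0 and v = 0], goal_cases)
    case (5 t)
    let ?ld = "\<lambda>p. prefix_load p (Suc m)"
    let ?if = "IfLess (Var 39) (Var 40) (Seq (Assign 39 (Const 0) (Var 40)) (Assign 27 (Const 0) (Var 25))) Skip"
    \<comment> \<open>The recorded maximum starts at 0 together with port 0, so at first
      \<open>v\<close> need not be the load of \<open>q\<close>. If it is still 0 at the end, all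
      loads are 0 and every port is maximal.\<close>
    define J where "J = (\<lambda>p (t :: memory). \<exists>q<2 * N. \<exists>v. t 27 0 = of_nat q \<and> t 39 0 = of_nat v \<and>
      (\<forall>p'<p. ?ld p' \<le> v) \<and> (v = ?ld q \<or> v = 0))"
    have same: "t' a = s a" if "same_outside (insert 25 (writes (Seq sum_prog ?if))) t t'"
      "a \<notin> {25, 27, 39, 40, 41}" for t' a
      using same_outsideD[OF that(1), of a] that(2) 5(2) \<open>s1 = _\<close> by simp
    have ord: "order_stored \<pi> m t'" if "same_outside (insert 25 (writes (Seq sum_prog ?if))) t t'" for t'
      using same[OF that] by (intro order_stored_cong[OF s(2)]) auto
    show ?case
    proof (rule run_For[where K = "2 * N" and Inv = J])
      show "val (Mul (Const 2) Ports) t' = of_nat (2 * N)"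
        if "same_outside (insert 25 (writes (Seq sum_prog ?if))) t t'" for t'
        using ord[OF that] unfolding order_stored_def by simp
      show "J 0 t" using 5(2) \<open>s1 = _\<close> N_pos unfolding J_def
        by (intro exI[of _ 0] conjI) auto
      show "run M h (Seq sum_prog ?if) t' (J (Suc p))"
        if p: "p < 2 * N" "all_fit h t'" "same_outside (insert 25 (writes (Seq sum_prog ?if))) t t'"
          "t' 25 0 = of_nat p" "J p t'" for p t'
      proof (rule run_Seq_spec[OF run_sum_prog[OF p(2) ord[OF p(3)] p(4,1)]])
        fix r assume r: "all_fit h r" "same_outside (writes sum_prog) t' r" "r 40 0 = of_nat (?ld p)"
        have eqs: "r 25 0 = of_nat p" "r 27 = t' 27" "r 39 = t' 39"
          using same_outsideD[OF r(2)] p(4) by auto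
        obtain q v where qv: "q < 2 * N" "r 27 0 = of_nat q" "r 39 0 = of_nat v"
          "\<forall>p'<p. ?ld p' \<le> v" "v = ?ld q \<or> v = 0"
          using p(5) eqs unfolding J_def by auto
        show "run M h ?if r (J (Suc p))"
        proof (rule run_IfLess[OF r(1)])
          assume "val (Var 39) r < val (Var 40) r"
          then have v: "v < ?ld p" using qv(3) r(3) by simp
          show "run M h (Seq (Assign 39 (Const 0) (Var 40)) (Assign 27 (Const 0) (Var 25))) r (J (Suc p))"
          proof (rule run_Seq_Assign[where q = 0 and v = "of_nat (?ld p)"])
            show "fits h (of_nat (?ld p))" using p(1) m by (intro prefix_load_fits) auto
            fix r' assume r': "all_fit h r'" "r' = r(39 := (r 39)(0 := of_nat (?ld p)))"
            show "run M h (Assign 27 (Const 0) (Var 25)) r' (J (Suc p))"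
            proof (rule run_Assign[where q = 0 and v = "of_nat p"])
              show "fits h (of_nat p)" using p(1) size_bounds(3) by (intro fits_of_nat) linarith
              have "\<forall>p'<Suc p. ?ld p' \<le> ?ld p" using qv(4) v by (auto simp: less_Suc_eq)
              then show "J (Suc p) (r'(27 := (r' 27)(0 := of_nat p)))"
                unfolding J_def r'(2) using p(1) by (intro exI[of _ p] conjI exI[of _ "?ld p"]) auto
            qed (use r' eqs in auto)
          qed (use r in auto)
        next
          assume "\<not> val (Var 39) r < val (Var 40) r"
          then have "?ld p \<le> v" using qv(3) r(3) by simp
          then have "J (Suc p) r" unfolding J_def using qv by (auto simp: less_Suc_eq)
          then show "run M h Skip r (J (Suc p))" using r(1) by (intro run_Skip)
        qed
      qed
      show "\<exists>p<2 * N. t' 27 0 = of_nat p \<and>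
        (\<Sum>k\<in>\<pi> ` {..<Suc m}. port_load I p k) = peak_load I (\<pi> ` {..<Suc m})" if "J (2 * N) t'" for t'
      proof -
        obtain q v where q: "q < 2 * N" "t' 27 0 = of_nat q" "\<forall>p'<2 * N. ?ld p' \<le> v" "v = ?ld q \<or> v = 0"
          using \<open>J (2 * N) t'\<close> unfolding J_def by blast
        then have "?ld p' \<le> ?ld q" if "p' < 2 * N" for p' using that by fastforce
        then show ?thesis using q(1,2) peak_loadI[OF q(1), of "\<pi> ` {..<Suc m}"]
          unfolding prefix_load_eq by blast
      qed
      show "2 * N \<le> M" using loop_bounds(3) m by simp
    qed (use 5 size_bounds in \<open>auto simp: J_def\<close>)
  qed (use 5 in auto)
qed (use s in auto)

lemma run_select_prog:
  assumes s: "all_fit h s" "order_stored \<pi> m s" "s 27 0 = of_nat p" and p: "p < 2 * N"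
    and w: "\<And>x. x \<le> m \<Longrightarrow> 0 \<le> s 3 (of_nat (\<pi> x))"
  shows "run M h select_prog s (\<lambda>t. \<exists>b\<le>m. t 28 0 = of_nat b \<and>
    selected (\<lambda>k. s 3 (of_nat k)) (port_load I p) \<pi> b (Suc m))"
  unfolding select_prog_def
proof (rule run_Seq_Assign[where q = 0 and v = 0], goal_cases)
  case (5 t)
  let ?e = "Mul (Cell 3 (Cell 13 (Var 25))) (Load (Var 27) (Cell 13 (Var 28)))"
  let ?f = "Mul (Cell 3 (Cell 13 (Var 28))) (Load (Var 27) (Cell 13 (Var 25)))"
  let ?c = "IfLess ?e ?f (Assign 28 (Const 0) (Var 25)) Skip"
  let ?w = "\<lambda>k. s 3 (of_nat k)" and ?l = "port_load I p"
  define J where "J = (\<lambda>y (t :: memory). \<exists>b\<le>m. t 28 0 = of_nat b \<and> selected ?w ?l \<pi> b y)"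
  have ord: "order_stored \<pi> m t'" "t' 27 0 = of_nat p" "t' 3 = s 3" if "same_outside (insert 25 (writes ?c)) t t'" for t'
    using order_stored_cong[OF s(2), of t'] same_outsideD[OF that] 5(2) s(3) by simp_all
  show ?case
  proof (rule run_For[where K = "Suc m" and Inv = J])
    show "val (Add (Var 26) (Const 1)) t' = of_nat (Suc m)" if "same_outside (insert 25 (writes ?c)) t t'" for t'
      using val_count[OF ord(1)[OF that]] .
    show "J 0 t" unfolding J_def selected_def using 5(2) by (intro exI[of _ 0]) auto
    show "run M h ?c t' (J (Suc y))"
      if y: "y < Suc m" "all_fit h t'" "same_outside (insert 25 (writes ?c)) t t'" "t' 25 0 = of_nat y" "J y t'" for y t'
    proof -
      note o = ord[OF y(3)]
      obtain b where b: "b \<le> m" "t' 28 0 = of_nat b" "selected ?w ?l \<pi> b y" using y(5) unfolding J_def by blast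
      have perm: "val (Cell 13 (Var 25)) t' = of_nat (\<pi> y)" "val (Cell 13 (Var 28)) t' = of_nat (\<pi> b)"
        using o(1) y b m unfolding order_stored_def by auto
      have "val (Load (Var 27) (Cell 13 (Var 28))) t' = of_nat (?l (\<pi> b))"
        "val (Load (Var 27) (Cell 13 (Var 25))) t' = of_nat (?l (\<pi> y))"
        using o perm y(1) b(1) m \<pi>_less[of y] \<pi>_less[of b] p unfolding order_stored_def
        by (intro val_Load; auto)+
      then have vals: "val ?e t' = ?w (\<pi> y) * of_nat (?l (\<pi> b))" "val ?f t' = ?w (\<pi> b) * of_nat (?l (\<pi> y))"
        using perm o(3) by simp_all
      show ?thesis
      proof (rule run_IfLess[OF y(2)])
        assume less: "val ?e t' < val ?f t'"
        show "run M h (Assign 28 (Const 0) (Var 25)) t' (J (Suc y))"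
        proof (rule run_Assign[where q = 0 and v = "of_nat y"])
          show "fits h (of_nat y)" using y(1) Suc_m_bounds(2) by (intro fits_of_nat) linarith
          have "selected ?w ?l \<pi> y (Suc y)"
            using selected_change[OF b(3)] less w b(1) y(1) unfolding vals by simp
          then show "J (Suc y) (t'(28 := (t' 28)(0 := of_nat y)))"
            using y(1) unfolding J_def by auto
        qed (use y in auto)
      next
        assume less: "\<not> val ?e t' < val ?f t'"
        have "selected ?w ?l \<pi> b (Suc y)" using selected_keep[OF b(3)] less w b(1) unfolding vals by simp
        then show "run M h Skip t' (J (Suc y))" using b y(2) unfolding J_def by (intro run_Skip) auto
      qed
    qed
  qed (use 5 Suc_m_bounds in \<open>auto simp: J_def\<close>)
qed (use s in auto)

lemma run_update_prog:
  assumes s: "all_fit h s" "order_stored \<pi> m s" "s 27 0 = of_nat p" "s 28 0 = of_nat b"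
    and p: "p < 2 * N" and b: "b \<le> m"
    and \<theta>: "\<theta> = s 3 (of_nat (\<pi> b)) / of_nat (port_load I p (\<pi> b))"
    and fit: "fits h \<theta>" "\<And>x. x \<le> m \<Longrightarrow> fits h (s 3 (of_nat (\<pi> x)) - \<theta> * of_nat (port_load I p (\<pi> x)))"
  shows "run M h update_prog s (\<lambda>t. \<forall>k<n. t 3 (of_nat k) =
    (if k \<in> \<pi> ` {..<Suc m} then s 3 (of_nat k) - \<theta> * of_nat (port_load I p k) else s 3 (of_nat k)))"
  unfolding update_prog_def
proof (rule run_Seq_Assign[where q = 0 and v = \<theta>], goal_cases)
  case 3
  have perm: "val (Cell 13 (Var 28)) s = of_nat (\<pi> b)" using s b m unfolding order_stored_def by auto
  have "val (Load (Var 27) (Cell 13 (Var 28))) s = of_nat (port_load I p (\<pi> b))"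
    using s perm b m \<pi>_less[of b] p unfolding order_stored_def by (intro val_Load) auto
  then show ?case using perm \<theta> by simp
next
  case (5 t)
  let ?c = "Assign 3 (Cell 13 (Var 25)) (Sub (Cell 3 (Cell 13 (Var 25))) (Mul (Var 29) (Load (Var 27) (Cell 13 (Var 25)))))"
  let ?w' = "\<lambda>k. s 3 (of_nat k) - \<theta> * of_nat (port_load I p k)"
  define J where "J = (\<lambda>y (t :: memory). \<forall>k<n. t 3 (of_nat k) = (if k \<in> \<pi> ` {..<y} then ?w' k else s 3 (of_nat k)))"
  have ord: "order_stored \<pi> m t'" "t' 27 0 = of_nat p" "t' 29 0 = \<theta>" if "same_outside (insert 25 (writes ?c)) t t'" for t'
    using order_stored_cong[OF s(2), of t'] same_outsideD[OF that] 5(2) s(3) by simp_all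
  show ?case
  proof (rule run_For[where K = "Suc m" and Inv = J])
    show "val (Add (Var 26) (Const 1)) t' = of_nat (Suc m)" if "same_outside (insert 25 (writes ?c)) t t'" for t'
      using val_count[OF ord(1)[OF that]] .
    show "J 0 t" unfolding J_def using 5(2) by simp
    show "run M h ?c t' (J (Suc y))"
      if y: "y < Suc m" "all_fit h t'" "same_outside (insert 25 (writes ?c)) t t'" "t' 25 0 = of_nat y" "J y t'" for y t'
    proof -
      note o = ord[OF y(3)]
      have perm: "val (Cell 13 (Var 25)) t' = of_nat (\<pi> y)" using o(1) y m unfolding order_stored_def by auto
      have load: "val (Load (Var 27) (Cell 13 (Var 25))) t' = of_nat (port_load I p (\<pi> y))"
        using o perm y(1) m \<pi>_less[of y] p unfolding order_stored_def by (intro val_Load) auto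
      \<comment> \<open>By injectivity the weight of \<open>\<pi> y\<close> has not yet been changed
        in this loop, so the old value is read.\<close>
      have "\<pi> y \<notin> \<pi> ` {..<y}"
        using inj_onD[OF bij_betw_imp_inj_on[OF bij], of y] y(1) m by fastforce
      then have "t' 3 (of_nat (\<pi> y)) = s 3 (of_nat (\<pi> y))" using y(1,5) m \<pi>_less[of y] unfolding J_def by auto
      then have v: "val (Sub (Cell 3 (Cell 13 (Var 25))) (Mul (Var 29) (Load (Var 27) (Cell 13 (Var 25))))) t' = ?w' (\<pi> y)"
        using perm load o(3) by simp
      show ?thesis
      proof (rule run_Assign[OF y(2) perm v])
        show "fits h (?w' (\<pi> y))" using y(1) by (intro fit) simp
        show "J (Suc y) (t'(3 := (t' 3)(of_nat (\<pi> y) := ?w' (\<pi> y))))"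
          using y(5) unfolding J_def by (auto simp: less_Suc_eq lessThan_Suc)
      qed
    qed
  qed (use 5 Suc_m_bounds in \<open>auto simp: J_def\<close>)
qed (use s fit in auto)

lemma run_swap_prog:
  assumes s: "all_fit h s" "order_stored \<pi> m s" "s 28 0 = of_nat b" and b: "b \<le> m"
  shows "run M h swap_prog s (\<lambda>t. \<forall>x<n. t 13 (of_nat x) = of_nat ((\<pi>(b := \<pi> m, m := \<pi> b)) x))"
  unfolding swap_prog_def
proof (rule run_Seq_Assign[where q = 0 and v = "of_nat (\<pi> b)"], goal_cases)
  case (5 t)
  have fit: "fits h (of_nat (\<pi> x))" if "x < n" for x
    using \<pi>_less[OF that] size_bounds(1) by (intro fits_of_nat) linarith
  show ?case
  proof (rule run_Seq_Assign[where q = "of_nat b" and v = "of_nat (\<pi> m)"], goal_cases)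
    case swapped: (5 t')
    show ?case
      by (rule run_Assign[where q = "of_nat m" and v = "of_nat (\<pi> b)"])
        (use swapped 5 s m b fit in \<open>auto simp: order_stored_def\<close>)
  qed (use 5 s m b fit in \<open>auto simp: order_stored_def\<close>)
qed (use s m b \<pi>_less[of b] size_bounds(1) in \<open>auto simp: order_stored_def intro!: fits_of_nat\<close>)

end

text \<open>The denominator has to be part of the loop invariant, since the fact that all cells fit
  into \<open>h\<close> is not preserved by the subtractions alone. Its exponent counts \<beta> bits
  for the input and \<beta> for the load divided by in each round.\<close>

definition order_found :: "nat \<Rightarrow> memory \<Rightarrow> bool" where
  "order_found t s \<longleftrightarrow> (\<exists>\<pi>. (\<forall>x<n. s 13 (of_nat x) = of_nat (\<pi> x)) \<and>
     order_inv I (n - t) \<pi> (\<lambda>k. real_of_rat (s 3 (of_nat k))) \<and>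
     (\<exists>D::int. 0 < D \<and> D \<le> 2 ^ (\<beta> * (t + 1)) \<and> (\<forall>k<n. s 3 (of_nat k) * of_int D \<in> \<int>)))"

text \<open>Multiplying \<open>D\<close> by the load \<open>l b\<close> clears
  \<open>\<theta>\<close>, and with it all new weights, because loads are integers. If
  \<open>l b = 0\<close>, then \<open>\<theta> = 0\<close> and \<open>D\<close> itself
  works.\<close>

lemma residual_denominator:
  fixes w :: "nat \<Rightarrow> rat" and l :: "nat \<Rightarrow> nat"
  assumes D: "0 < D" "D \<le> 2 ^ a" "\<And>k. k < n \<Longrightarrow> w k * of_int D \<in> \<int>"
    and b: "b < n" "l b \<le> 2 ^ \<beta>" and \<theta>: "\<theta> = w b / of_nat (l b)"
  obtains D' :: int where "0 < D'" "D' \<le> 2 ^ (a + \<beta>)" "\<theta> * of_int D' \<in> \<int>"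
    "\<And>k. k < n \<Longrightarrow> w k * of_int D' \<in> \<int>" "\<And>k. k < n \<Longrightarrow> (w k - \<theta> * of_nat (l k)) * of_int D' \<in> \<int>"
proof -
  define c where "c = (if l b = 0 then 1 else l b)"
  have c: "0 < c" "c \<le> 2 ^ \<beta>" using b(2) unfolding c_def by auto
  have ic: "int c \<le> 2 ^ \<beta>" using c(2) by (metis of_nat_le_iff of_nat_numeral of_nat_power)
  have "D * int c \<le> 2 ^ a * 2 ^ \<beta>" using D(1,2) ic by (intro mult_mono) auto
  then have le: "D * int c \<le> 2 ^ (a + \<beta>)" by (simp add: power_add)
  have "\<theta> * of_int (D * int c) = (if l b = 0 then 0 else w b * of_int D)"
    unfolding \<theta> c_def by simp
  then have th: "\<theta> * of_int (D * int c) \<in> \<int>" using D(3)[OF b(1)] by simp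
  have w: "w k * of_int (D * int c) \<in> \<int>" if "k < n" for k
  proof -
    have "w k * of_int (D * int c) = w k * of_int D * of_nat c" by simp
    then show ?thesis using D(3)[OF that] by (simp only: Ints_mult Ints_of_nat)
  qed
  have "(w k - \<theta> * of_nat (l k)) * of_int (D * int c) \<in> \<int>" if "k < n" for k
  proof -
    have "(w k - \<theta> * of_nat (l k)) * of_int (D * int c)
        = w k * of_int (D * int c) - \<theta> * of_int (D * int c) * of_nat (l k)"
      by (simp only: left_diff_distrib mult.assoc mult.commute[of "of_nat (l k)"])
    then show ?thesis using th w[OF that] by (simp only: Ints_diff Ints_mult Ints_of_nat)
  qed
  then show thesis using that[of "D * int c"] D(1) c(1) le th w by simp
qed

lemma run_order_step:
  assumes s: "all_fit h s" "s 0 1 = of_nat N" "s 0 2 = of_nat n" "loads_stored s" "s 24 0 = of_nat t"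
    and t: "t < n" and found: "order_found t s"
  shows "run M h (Seq (Assign 26 (Const 0) (Sub (Sub Coflows (Var 24)) (Const 1)))
     (Seq peak_prog (Seq select_prog (Seq update_prog swap_prog)))) s (order_found (Suc t))"
proof -
  define m where "m = n - Suc t"
  have m: "m < n" "n - t = Suc m" "n - Suc t = m" using t unfolding m_def by auto
  obtain \<pi> D where \<pi>: "\<forall>x<n. s 13 (of_nat x) = of_nat (\<pi> x)"
    and inv: "order_inv I (Suc m) \<pi> (\<lambda>k. real_of_rat (s 3 (of_nat k)))"
    and D: "0 < D" "D \<le> 2 ^ (\<beta> * (t + 1))" "\<And>k. k < n \<Longrightarrow> s 3 (of_nat k) * of_int D \<in> \<int>"
    using found unfolding order_found_def m(2) by blast
  have bij: "bij_betw \<pi> {..<n} {..<n}" using inv unfolding order_inv_def by blast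
  have less: "\<pi> x < n" if "x \<le> m" for x using bij that m(1) by (auto simp: bij_betw_def)
  let ?w = "\<lambda>k. s 3 (of_nat k)" and ?U = "\<pi> ` {..<Suc m}"
  have w: "0 \<le> ?w (\<pi> x)" "?w (\<pi> x) \<le> weight I (\<pi> x)" if "x \<le> m" for x
    using inv that unfolding order_inv_def by (auto simp: of_rat_less_eq)
  show ?thesis
  proof (rule run_Seq_Assign[where q = 0 and v = "of_nat m"])
    show "val (Sub (Sub Coflows (Var 24)) (Const 1)) s = of_nat m"
      using s t unfolding m_def by (simp add: of_nat_diff)
    show "fits h (of_nat m)" using m(1) size_bounds(1) by (intro fits_of_nat) linarith
    fix s1 assume s1: "all_fit h s1" "s1 = s(26 := (s 26)(0 := of_nat m))"
    have o1: "order_stored \<pi> m s1" using s \<pi> unfolding s1(2) order_stored_def loads_stored_def by simp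
    show "run M h (Seq peak_prog (Seq select_prog (Seq update_prog swap_prog))) s1 (order_found (Suc t))"
    proof (rule run_Seq_spec[OF run_peak_prog[OF m(1) bij s1(1) o1]])
      fix s2 assume s2: "all_fit h s2" "same_outside (writes peak_prog) s1 s2"
        "\<exists>p<2 * N. s2 27 0 = of_nat p \<and> (\<Sum>k\<in>?U. port_load I p k) = peak_load I ?U"
      then obtain p where p: "p < 2 * N" "s2 27 0 = of_nat p" "(\<Sum>k\<in>?U. port_load I p k) = peak_load I ?U" by blast
      have o2: "order_stored \<pi> m s2" and w2: "s2 3 = s 3"
        using order_stored_cong[OF o1, of s2] same_outsideD[OF s2(2)] s1(2) by simp_all
      show "run M h (Seq select_prog (Seq update_prog swap_prog)) s2 (order_found (Suc t))"
      proof (rule run_Seq_spec[OF run_select_prog[OF m(1) bij s2(1) o2 p(2,1)]])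
        show "0 \<le> s2 3 (of_nat (\<pi> x))" if "x \<le> m" for x using w(1)[OF that] w2 by simp
        fix s3 assume s3: "all_fit h s3" "same_outside (writes select_prog) s2 s3"
          "\<exists>b\<le>m. s3 28 0 = of_nat b \<and> selected (\<lambda>k. s2 3 (of_nat k)) (port_load I p) \<pi> b (Suc m)"
        then obtain b where b: "b \<le> m" "s3 28 0 = of_nat b" "selected ?w (port_load I p) \<pi> b (Suc m)"
          unfolding w2 by blast
        have o3: "order_stored \<pi> m s3" and w3: "s3 3 = s 3" and p3: "s3 27 0 = of_nat p"
          using order_stored_cong[OF o2, of s3] same_outsideD[OF s3(2)] w2 p(2) by simp_all
        define \<theta> where "\<theta> = ?w (\<pi> b) / of_nat (port_load I p (\<pi> b))"
        define w' where "w' = (\<lambda>k. ?w k - \<theta> * of_nat (port_load I p k))"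
        have res: "0 \<le> \<theta>" "\<theta> \<le> ?w (\<pi> b)" "\<And>x. x \<le> m \<Longrightarrow> 0 \<le> w' (\<pi> x)"
          "w' (\<pi> b) = 0 \<or> (\<forall>x\<le>m. port_load I p (\<pi> x) = 0)"
          using selected_residual[OF b(3)] w(1) b(1) unfolding \<theta>_def w'_def by (auto simp: less_Suc_eq_le)
        obtain D' where D': "0 < D'" "D' \<le> 2 ^ (\<beta> * (t + 1) + \<beta>)" "\<theta> * of_int D' \<in> \<int>"
          "\<And>k. k < n \<Longrightarrow> ?w k * of_int D' \<in> \<int>" "\<And>k. k < n \<Longrightarrow> w' k * of_int D' \<in> \<int>"
          using residual_denominator[of D "\<beta> * (t + 1)" ?w "\<pi> b" "port_load I p" \<theta>, OF D less[OF b(1)]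
              port_load_le[OF p(1) less[OF b(1)]] \<theta>_def] unfolding w'_def by blast
        \<comment> \<open>The denominator takes \<open>\<beta> * (t + 2)\<close> bits and the
          magnitude \<beta> more. As \<open>t < n\<close> and \<open>2 * n \<le> \<beta>\<close>,
          the total is at most \<open>\<beta> * \<beta> + 2 * \<beta>\<close>.\<close>
        have "t + 2 \<le> \<beta> + 1" using t n_le by linarith
        from mult_le_mono2[OF this, of \<beta>] have hb: "\<beta> * (t + 1) + \<beta> + \<beta> \<le> h" using h_ge(1) by (simp add: algebra_simps)
        have w_le: "?w (\<pi> x) \<le> 2 ^ \<beta>" if "x \<le> m" for x
          using w(2)[OF that] weight_le[OF less[OF that]] by linarith
        have fit_\<theta>: "fits h \<theta>"
          using fits_common_denominator[OF D'(3,1,2), of \<beta>] res(1,2) w_le[OF b(1)] hb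
          by (auto intro: fits_mono)
        \<comment> \<open>A nonnegative amount is subtracted and the result is nonnegative, so the
          bound on the original weight persists.\<close>
        have fit_w: "fits h (w' (\<pi> x))" if "x \<le> m" for x
        proof -
          have "0 \<le> \<theta> * of_nat (port_load I p (\<pi> x))" using res(1) by simp
          then have "\<bar>w' (\<pi> x)\<bar> \<le> 2 ^ \<beta>" using res(3)[OF that] w_le[OF that] unfolding w'_def by linarith
          from fits_common_denominator[OF D'(5)[OF less[OF that]] D'(1,2) this] hb
          show ?thesis by (rule fits_mono)
        qed
        show "run M h (Seq update_prog swap_prog) s3 (order_found (Suc t))"
        proof (rule run_Seq_spec[OF run_update_prog[OF m(1) bij s3(1) o3 p3 b(2) p(1) b(1), of \<theta>]])
          show "\<theta> = s3 3 (of_nat (\<pi> b)) / of_nat (port_load I p (\<pi> b))" unfolding w3 \<theta>_def ..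
          show "fits h \<theta>" by (rule fit_\<theta>)
          show "fits h (s3 3 (of_nat (\<pi> x)) - \<theta> * of_nat (port_load I p (\<pi> x)))" if "x \<le> m" for x
            using fit_w[OF that] unfolding w3 w'_def .
          fix s4 assume s4: "all_fit h s4" "same_outside (writes update_prog) s3 s4"
            "\<forall>k<n. s4 3 (of_nat k) = (if k \<in> ?U then s3 3 (of_nat k) - \<theta> * of_nat (port_load I p k) else s3 3 (of_nat k))"
          have w4: "s4 3 (of_nat k) = (if k \<in> ?U then w' k else ?w k)" if "k < n" for k
            using s4(3) that unfolding w3 w'_def by simp
          have o4: "order_stored \<pi> m s4" and b4: "s4 28 0 = of_nat b"
            using order_stored_cong[OF o3, of s4] same_outsideD[OF s4(2)] b(2) by simp_all
          show "run M h swap_prog s4 (order_found (Suc t))"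
          proof (rule run_conseq[OF run_swap_prog[OF m(1) bij s4(1) o4 b4 b(1)]])
            fix s5 :: memory
            define \<rho> where "\<rho> = \<pi>(b := \<pi> m, m := \<pi> b)"
            assume s5: "same_outside (writes swap_prog) s4 s5"
              "\<forall>x<n. s5 13 (of_nat x) = of_nat ((\<pi>(b := \<pi> m, m := \<pi> b)) x)"
            have w5: "s5 3 = s4 3" using same_outsideD[OF s5(1)] by simp
            have im: "\<rho> ` {..<Suc m} = ?U" unfolding \<rho>_def by (rule image_swap) (use b in auto)
            have Un: "k < n" if "k \<in> ?U" for k using that less by (auto simp: less_Suc_eq_le)
            \<comment> \<open>The program updates the weights before the exchange, the analysis
              exchanges first. Both orders agree because weights are indexed by coflows and not by
              positions.\<close>
            have "order_inv I m \<rho> (\<lambda>k. real_of_rat (s5 3 (of_nat k)))"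
            proof (rule order_inv_step[where p = p and \<theta> = "real_of_rat \<theta>"])
              show "valid_instance I" by (rule valid)
              show "order_inv I (Suc m) \<rho> (\<lambda>k. real_of_rat (?w k))"
                unfolding \<rho>_def by (rule order_inv_swap[OF inv m(1) b(1)])
              show "(\<Sum>k\<in>\<rho> ` {..<Suc m}. port_load I p k) = peak_load I (\<rho> ` {..<Suc m})" unfolding im by (rule p(3))
              show "0 \<le> real_of_rat \<theta>" using res(1) by simp
              show "real_of_rat (s5 3 (of_nat k)) = real_of_rat (?w k) - real_of_rat \<theta> * real (port_load I p k)"
                if "k \<in> \<rho> ` {..<Suc m}" for k
                using that w4[of k] Un[of k] unfolding im w5 w'_def by (simp add: of_rat_diff of_rat_mult)
              show "0 \<le> real_of_rat (s5 3 (of_nat k))" if "k \<in> \<rho> ` {..<Suc m}" for k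
                using that w4[of k] Un[of k] res(3) unfolding im w5 by (auto simp: less_Suc_eq_le)
              have "\<rho> m = \<pi> b" unfolding \<rho>_def by simp
              moreover have "peak_load I ?U = 0" if "\<forall>x\<le>m. port_load I p (\<pi> x) = 0"
                unfolding p(3)[symmetric] using that by (auto simp: less_Suc_eq_le)
              ultimately show "real_of_rat (s5 3 (of_nat (\<rho> m))) = 0 \<or> peak_load I (\<rho> ` {..<Suc m}) = 0"
                using res(4) w4[of "\<pi> b"] less[OF b(1)] b(1) unfolding im w5 by (auto simp: less_Suc_eq_le)
            qed (use m p in auto)
            moreover have "\<forall>k<n. s5 3 (of_nat k) * of_int D' \<in> \<int>"
              unfolding w5 using w4 D'(4,5) by simp
            moreover have "D' \<le> 2 ^ (\<beta> * (Suc t + 1))" using D'(2) by (simp add: algebra_simps)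
            ultimately show "order_found (Suc t) s5"
              unfolding order_found_def m(3) using s5(2) D'(1) unfolding \<rho>_def by blast
          qed
        qed
      qed
    qed
  qed (use s in auto)
qed

lemma run_order_prog:
  assumes s: "all_fit h s" "s 0 1 = of_nat N" "s 0 2 = of_nat n" "loads_stored s"
    and w: "\<And>k. k < n \<Longrightarrow> s 3 (of_nat k) = weight I k"
  shows "run M h order_prog s (order_found n)"
  unfolding order_prog_def
proof (rule run_Seq_spec[OF run_init_prog[OF s(1,3)]])
  fix t assume t: "all_fit h t" "same_outside (writes init_prog) s t" "\<forall>x<n. t 13 (of_nat x) = of_nat x"
  let ?c = "Seq (Assign 26 (Const 0) (Sub (Sub Coflows (Var 24)) (Const 1)))
     (Seq peak_prog (Seq select_prog (Seq update_prog swap_prog)))"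
  have same: "r 0 = s 0" "r 11 = s 11" if "same_outside (insert 24 (writes ?c)) t r" for r
    using same_outsideD[OF that] same_outsideD[OF t(2)] by simp_all
  show "run M h (For 24 Coflows ?c) t (order_found n)"
  proof (rule run_For[where K = n and Inv = order_found])
    show "val Coflows r = of_nat n" if "same_outside (insert 24 (writes ?c)) t r" for r
      using same[OF that] s by simp
    obtain D where D: "0 < D" "D \<le> 2 ^ \<beta>" "\<And>k. k \<in> {..<n} \<Longrightarrow> weight I k * of_int D \<in> \<int>"
      by (rule common_denominator[OF _ bits_parts(6)]) auto
    have w': "t 3 (of_nat k) = weight I k" if "k < n" for k
      using w[OF that] same_outsideD[OF t(2)] by simp
    have "order_inv I (n - 0) id (\<lambda>k. real_of_rat (t 3 (of_nat k)))"
      using order_inv_init[OF valid] w' unfolding order_inv_def by simp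
    then show "order_found 0 t" unfolding order_found_def using t(3) D w'
      by (intro exI[of _ id]) auto
    show "run M h ?c r (order_found (Suc k))"
      if "k < n" "all_fit h r" "same_outside (insert 24 (writes ?c)) t r" "r 24 0 = of_nat k" "order_found k r" for k r
      using same[OF that(3)] s that unfolding loads_stored_def
      by (intro run_order_step) (auto simp: loads_stored_def)
  qed (use t loop_bounds size_bounds in \<open>auto simp: order_found_def\<close>)
qed

end


subsection \<open>Computing the schedule\<close>

text \<open>Here cell 20 is a position in the order, so cell 23 numbers the flows by priority,
  whereas demands are addressed through the coflow at that position. Arrays 14 to 17 hold source,
  destination, coflow and remaining amount. The simulation adds 31 for the number of flows, 32 for
  the time, 33 for the gap, 34 and 35 for the current event and flow, 36 and 37 for the stamps of
  the ports, and 38 for the flags of the active flows.\<close>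

definition build_prog :: prog where
  "build_prog = For_flows (Seq (Assign 14 (Var 23) (Var 21)) (Seq (Assign 15 (Var 23) (Var 22))
     (Seq (Assign 16 (Var 23) (Cell 13 (Var 20)))
       (Assign 17 (Var 23)
         (Cell 1 (Add (Mul (Add (Mul (Cell 13 (Var 20)) Ports) (Var 21)) Ports) (Var 22)))))))"

definition min_prog :: "exp \<Rightarrow> prog" where
  "min_prog e = IfLess (Const 0) (Var 33) (IfLess e (Var 33) (Assign 33 (Const 0) e) Skip)
     (Assign 33 (Const 0) e)"

text \<open>A port is busy if it carries the number of the current event as a stamp.\<close>

definition choose_step :: prog where
  "choose_step = Seq (Assign 38 (Var 35) (Const 0)) (IfLess (Const 0) (Cell 17 (Var 35))
     (IfLess (Var 32) (Cell 2 (Cell 16 (Var 35))) (min_prog (Sub (Cell 2 (Cell 16 (Var 35))) (Var 32)))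
       (IfLess (Cell 36 (Cell 14 (Var 35))) (Add (Var 34) (Const 1))
         (IfLess (Cell 37 (Cell 15 (Var 35))) (Add (Var 34) (Const 1))
           (Seq (Assign 38 (Var 35) (Const 1))
             (Seq (Assign 36 (Cell 14 (Var 35)) (Add (Var 34) (Const 1)))
               (Seq (Assign 37 (Cell 15 (Var 35)) (Add (Var 34) (Const 1)))
                 (min_prog (Cell 17 (Var 35))))))
           Skip)
         Skip))
     Skip)"

definition choose_prog :: prog where
  "choose_prog = Seq (Assign 33 (Const 0) (Const 0)) (For 35 (Var 31) choose_step)"

abbreviation Slot :: exp where "Slot \<equiv> Add (Mul (Var 34) (Var 31)) (Var 35)"
abbreviation Amount :: exp where "Amount \<equiv> Mul (Cell 38 (Var 35)) (Var 33)"

text \<open>Every event writes one record per flow, in slots that depend only on event and flow.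
  Multiplying the gap by the flag gives an inactive flow an empty interval and an unchanged amount,
  so neither a counter of intervals nor a branch occurs.\<close>

definition emit_step :: prog where
  "emit_step = Seq (Assign 6 Slot (Cell 14 (Var 35))) (Seq (Assign 7 Slot (Cell 15 (Var 35)))
     (Seq (Assign 8 Slot (Cell 16 (Var 35))) (Seq (Assign 9 Slot (Var 32))
       (Seq (Assign 10 Slot (Add (Var 32) Amount))
         (Assign 17 (Var 35) (Sub (Cell 17 (Var 35)) Amount))))))"

definition event_prog :: prog where
  "event_prog = Seq choose_prog (Seq (For 35 (Var 31) emit_step)
     (Assign 32 (Const 0) (Add (Var 32) (Var 33))))"

definition simulate_prog :: prog where
  "simulate_prog = Seq (Assign 31 (Const 0) (Mul (Mul Coflows Ports) Ports))
     (Seq (Assign 5 (Const 0) (Mul (Mul (Const 2) (Var 31)) (Var 31)))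
       (For 34 (Mul (Const 2) (Var 31)) event_prog))"

lemma writes_schedule_progs [simp]:
  "writes build_prog = {14, 15, 16, 17, 20, 21, 22, 23}" "writes (min_prog e) = {33}"
  "writes choose_step = {33, 36, 37, 38}" "writes choose_prog = {33, 35, 36, 37, 38}"
  "writes emit_step = {6, 7, 8, 9, 10, 17}"
  "writes event_prog = {6, 7, 8, 9, 10, 17, 32, 33, 35, 36, 37, 38}"
  "writes simulate_prog = {5, 6, 7, 8, 9, 10, 17, 31, 32, 33, 34, 35, 36, 37, 38}"
  by (auto simp: build_prog_def min_prog_def choose_step_def choose_prog_def emit_step_def
      event_prog_def simulate_prog_def)

lemma run_min_prog:
  assumes s: "all_fit h s" "s 33 0 = g" and v: "val e s = v" "fits h v"
    and Q: "\<And>t. all_fit h t \<Longrightarrow> t = s(33 := (s 33)(0 := if 0 < g \<and> g \<le> v then g else v)) \<Longrightarrow> Q t"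
  shows "run M h (min_prog e) s Q"
proof -
  have keep: "s(33 := (s 33)(0 := g)) = s" using s(2) by auto
  have set: "run M h (Assign 33 (Const 0) e) s Q" if "\<not> (0 < g \<and> g \<le> v)"
    by (rule run_Assign[where q = 0 and v = v]) (use s v that Q in \<open>auto simp: all_fit_def\<close>)
  show ?thesis unfolding min_prog_def
  proof (intro run_IfLess s(1))
    assume "val (Const 0) s < val (Var 33) s" "\<not> val e s < val (Var 33) s"
    then show "run M h Skip s Q" using s v Q[OF s(1)] keep by (intro run_Skip) auto
  qed (use set s v in auto)
qed

section \<open>Correctness of the simulation\<close>

locale ordered_coflow_instance = valid_coflow_instance I + coflow_order I \<pi>
  for I :: coflow_instance and \<pi> :: "nat \<Rightarrow> nat"
begin

lemma flows_bounds: "flows \<le> \<beta>" "flows \<le> M" "2 * flows \<le> M" "flows \<le> 2 ^ h" "2 * flows \<le> 2 ^ h"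
  unfolding flows_def using flows_le loop_bounds(4,5) size_bounds(4,5) by auto

lemma size_of_le: "z < flows \<Longrightarrow> size_of z \<le> 2 ^ \<beta>"
  unfolding size_of_def using flow_parts_less[of z] by (intro demand_le) auto

lemma release_of_le: "z < flows \<Longrightarrow> release_of z \<le> 2 ^ \<beta>"
  unfolding release_of_def using flow_parts_less[of z] by (intro release_le) auto

text \<open>All these numbers share a common denominator of the release times, of at most \<beta>
  bits. The largest magnitude is that of the time, at most \<open>(1 + e) * 2 ^ \<beta>\<close> for
  \<open>e \<le> 2 * flows\<close>, and there are at most \<beta> flows.\<close>

lemma simulation_fits:
  shows "e \<le> 2 * flows \<Longrightarrow> fits h (time e)" "y < flows \<Longrightarrow> fits h (left e y)"
    "k \<le> flows \<Longrightarrow> fits h (gap (time e) (left e) k)"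
    "y < flows \<Longrightarrow> time e < release_of y \<Longrightarrow> fits h (release_of y - time e)"
proof -
  obtain D where D: "0 < D" "D \<le> 2 ^ \<beta>" "\<And>k. k \<in> {..<n} \<Longrightarrow> release I k * of_int D \<in> \<int>"
    by (rule common_denominator[OF _ bits_parts(5)]) auto
  have rD: "release_of z * of_int D \<in> \<int>" if "z < flows" for z
    unfolding release_of_def using D(3) flow_parts_less(4)[OF that] by simp
  note mult = integral_multiples[OF rD]
  have fit: "fits h x" if "x * of_int D \<in> \<int>" "0 \<le> x" "x \<le> 2 ^ (3 * \<beta> + 2)" for x
  proof (rule fits_mono)
    show "fits (\<beta> + (3 * \<beta> + 2)) x"
      by (rule fits_common_denominator[OF that(1) D(1,2)]) (use that in simp)
    show "\<beta> + (3 * \<beta> + 2) \<le> h" using h_ge(1) by linarith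
  qed
  have small: "x \<le> 2 ^ (3 * \<beta> + 2)" if "x \<le> 2 ^ \<beta> + 2 ^ \<beta>" for x :: rat
  proof -
    have "x \<le> 2 ^ (\<beta> + 1)" using that by simp
    also have "\<dots> \<le> 2 ^ (3 * \<beta> + 2)" by (rule pow_mono) simp
    finally show ?thesis .
  qed
  show "fits h (time e)" if "e \<le> 2 * flows"
  proof (rule fit[OF mult(1) time_nonneg])
    have "1 + e \<le> 2 ^ (2 * \<beta> + 1)"
      using that flows_bounds(1) less_exp[of "2 * \<beta> + 1"] by linarith
    then have "rat_of_nat (1 + e) \<le> of_nat (2 ^ (2 * \<beta> + 1))" by (simp only: of_nat_le_iff)
    then have e: "1 + rat_of_nat e \<le> 2 ^ (2 * \<beta> + 1)" by simp
    have "time e \<le> 2 ^ \<beta> + of_nat (e * 2 ^ \<beta>)"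
      using release_of_le size_of_le by (intro time_bound) auto
    also have "\<dots> = (1 + of_nat e) * 2 ^ \<beta>" by (simp add: algebra_simps)
    also have "\<dots> \<le> 2 ^ (2 * \<beta> + 1) * 2 ^ \<beta>" by (rule mult_right_mono[OF e]) simp
    also have "\<dots> = 2 ^ (3 * \<beta> + 1)" unfolding power_add[symmetric] by (rule arg_cong[of _ _ "power 2"]) simp
    also have "\<dots> \<le> 2 ^ (3 * \<beta> + 2)" by (rule pow_mono) simp
    finally show "time e \<le> 2 ^ (3 * \<beta> + 2)" .
  qed
  show "fits h (left e y)" if "y < flows"
  proof (rule fit[OF mult(2) left_nonneg small])
    have "rat_of_nat (size_of y) \<le> 2 ^ \<beta>"
      using size_of_le[OF that] by (metis of_nat_le_iff of_nat_numeral of_nat_power)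
    moreover have "(0::rat) \<le> 2 ^ \<beta>" by simp
    ultimately show "left e y \<le> 2 ^ \<beta> + 2 ^ \<beta>" using left_le[of e y] by linarith
  qed
  show "fits h (gap (time e) (left e) k)" if "k \<le> flows"
  proof (rule fit[OF mult(4)[OF _ that] gap_nonneg small])
    show "gap (time e) (left e) k \<le> 2 ^ \<beta> + 2 ^ \<beta>"
      using gap_bound(1)[of "2 ^ \<beta>" "2 ^ \<beta>" k e] release_of_le size_of_le that by simp
  qed
  show "fits h (release_of y - time e)" if "y < flows" "time e < release_of y"
  proof (rule fit[OF _ _ small])
    show "(release_of y - time e) * of_int D \<in> \<int>" using rD[OF that(1)] mult(1) by (simp add: left_diff_distrib)
    have "(0::rat) \<le> 2 ^ \<beta>" by simp
    then show "release_of y - time e \<le> 2 ^ \<beta> + 2 ^ \<beta>" using release_of_le[OF that(1)] time_nonneg[of e] by linarith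
  qed (use that in simp)
qed

lemma parts_fit:
  assumes "y < flows"
  shows "fits h (of_nat (src y))" "fits h (of_nat (dst y))" "fits h (of_nat (cof y))"
  using flow_parts_less[OF assms] size_bounds(1,2) by (auto intro!: fits_of_nat)

definition flows_stored :: "nat \<Rightarrow> memory \<Rightarrow> bool" where
  "flows_stored z s \<longleftrightarrow> (\<forall>y<z. s 14 (of_nat y) = of_nat (src y) \<and> s 15 (of_nat y) = of_nat (dst y) \<and>
     s 16 (of_nat y) = of_nat (cof y))"

lemma run_build_prog:
  assumes s: "all_fit h s" "s 0 1 = of_nat N" "s 0 2 = of_nat n" "s 1 = encode I 1"
    "\<forall>x<n. s 13 (of_nat x) = of_nat (\<pi> x)"
  shows "run M h build_prog s (\<lambda>t. flows_stored flows t \<and> (\<forall>y<flows. t 17 (of_nat y) = of_nat (size_of y)))"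
  unfolding build_prog_def
proof (rule run_For_flows[where Inv = "\<lambda>z t. flows_stored z t \<and> (\<forall>y<z. t 17 (of_nat y) = of_nat (size_of y))"],
    goal_cases)
  case (7 x i j z t)
  have z: "z < flows" "src z = i" "dst z = j" "cof z = \<pi> x"
    using 7(1-4) flow_number_less[of i j x] flow_number_parts[of i j x] by (auto simp: cof_def)
  have \<pi>x: "\<pi> x < n" using flow_parts_less(4)[OF z(1)] z(4) by simp
  have cells: "t 0 1 = of_nat N" "t 1 = encode I 1" "t 13 (of_nat x) = of_nat (\<pi> x)"
    using same_outsideD[OF 7(6)] s 7(1) by auto
  have size: "encode I 1 (of_nat ((\<pi> x * N + i) * N + j)) = of_nat (size_of z)"
    using encode_eqs(4)[OF 7(2,3) \<pi>x] z by (simp add: size_of_def)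
  have fits: "fits h (of_nat i)" "fits h (of_nat j)" "fits h (of_nat (\<pi> x))"
    using parts_fit[OF z(1)] z by auto
  show ?case
  proof (rule run_Seq_Assign[where q = "of_nat z" and v = "of_nat i"], goal_cases)
    case t1: (5 t1)
    show ?case
    proof (rule run_Seq_Assign[where q = "of_nat z" and v = "of_nat j"], goal_cases)
      case t2: (5 t2)
      show ?case
      proof (rule run_Seq_Assign[where q = "of_nat z" and v = "of_nat (\<pi> x)"], goal_cases)
        case t3: (5 t3)
        show ?case
        proof (rule run_Assign[where q = "of_nat z" and v = "of_nat (size_of z)"], goal_cases)
          case 3
          then show ?case using t1 t2 t3 7(5-11) cells size by simp
        next
          case 4
          show ?case by (rule fits_if_le_two_power[OF size_of_le[OF z(1)]])
        next
          case 5
          then show ?case using t1 t2 t3 7(5-11) z by (auto simp: flows_stored_def less_Suc_eq)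
        qed (use t1 t2 t3 7(5-11) in auto)
      qed (use t1 t2 7(5-11) cells fits in auto)
    qed (use t1 7(5-11) fits in auto)
  qed (use 7(5-11) fits in auto)
qed (use s in \<open>auto simp: flows_stored_def flows_def\<close>)

definition static :: "memory \<Rightarrow> bool" where
  "static s \<longleftrightarrow> s 31 0 = of_nat flows \<and> flows_stored flows s \<and> (\<forall>k<n. s 2 (of_nat k) = release I k)"

lemma static_cong:
  assumes "static s" "t 2 = s 2" "t 14 = s 14" "t 15 = s 15" "t 16 = s 16" "t 31 = s 31"
  shows "static t"
  using assms unfolding static_def flows_stored_def by simp

lemma staticD:
  assumes "static s" "y < flows"
  shows "s 14 (of_nat y) = of_nat (src y)" "s 15 (of_nat y) = of_nat (dst y)"
    "s 16 (of_nat y) = of_nat (cof y)" "s 2 (of_nat (cof y)) = release_of y"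
  using assms flow_parts_less(4)[OF assms(2)] unfolding static_def flows_stored_def release_of_def by auto

definition at_event :: "nat \<Rightarrow> memory \<Rightarrow> bool" where
  "at_event e s \<longleftrightarrow> static s \<and> s 34 0 = of_nat e \<and> s 32 0 = time e \<and> (\<forall>y<flows. s 17 (of_nat y) = left e y)"

lemma at_event_cong:
  assumes "at_event e s" "t 2 = s 2" "t 14 = s 14" "t 15 = s 15" "t 16 = s 16" "t 31 = s 31"
    "t 34 = s 34" "t 32 = s 32" "t 17 = s 17"
  shows "at_event e t"
  using assms static_cong[of s t] unfolding at_event_def by simp

text \<open>A port of \<open>A\<close> carries the stamp \<open>Suc e\<close>; every other port
  carries an older, smaller one. The shift by 1 makes the initial 0 mean "free" at event 0 as well,
  and no stamp is ever reset.\<close>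

definition stamped :: "nat \<Rightarrow> (nat \<Rightarrow> nat) \<Rightarrow> nat set \<Rightarrow> (rat \<Rightarrow> rat) \<Rightarrow> bool" where
  "stamped e f A b \<longleftrightarrow> (\<forall>p<N. b (of_nat p) \<le> of_nat (Suc e) \<and>
     (b (of_nat p) < of_nat (Suc e) \<longleftrightarrow> (\<forall>y\<in>A. f y \<noteq> p)))"

lemma stamped_insert:
  assumes "stamped e f A b"
  shows "stamped e f (insert y A) (b(of_nat (f y) := of_nat (Suc e)))"
  using assms unfolding stamped_def by auto

definition choosing :: "nat \<Rightarrow> nat \<Rightarrow> memory \<Rightarrow> bool" where
  "choosing e q s \<longleftrightarrow> s 33 0 = gap (time e) (left e) q \<and>
     (\<forall>y<q. s 38 (of_nat y) = (if y \<in> active e then 1 else 0)) \<and>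
     stamped e src (chosen (ready (time e) (left e)) q) (s 36) \<and>
     stamped e dst (chosen (ready (time e) (left e)) q) (s 37)"

lemma run_choose_step:
  assumes s: "all_fit h s" "at_event e s" "s 35 0 = of_nat q" "choosing e q s"
    and e: "e < 2 * flows" and q: "q < flows"
  shows "run M h choose_step s (choosing e (Suc q))"
proof -
  let ?R = "ready (time e) (left e)"
  have act: "q \<in> active e \<longleftrightarrow> q \<in> chosen ?R (Suc q)"
    unfolding active_def using chosen_stable[of q "Suc q" flows ?R] q by simp
  have not_yet: "q \<notin> chosen ?R q" using chosenD[of q ?R q] by blast
  note st = staticD[OF _ q]
  have ev: "s 34 0 = of_nat e" "s 32 0 = time e" "s 17 (of_nat q) = left e q" "static s"
    using s(2) q unfolding at_event_def by auto
  have cells: "s 14 (of_nat q) = of_nat (src q)" "s 15 (of_nat q) = of_nat (dst q)"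
    "s 16 (of_nat q) = of_nat (cof q)" "s 2 (of_nat (cof q)) = release_of q"
    using st[OF ev(4)] by auto
  have ch: "s 33 0 = gap (time e) (left e) q" "\<forall>y<q. s 38 (of_nat y) = (if y \<in> active e then 1 else 0)"
    "stamped e src (chosen ?R q) (s 36)" "stamped e dst (chosen ?R q) (s 37)"
    using s(4) unfolding choosing_def by auto
  have "Suc e \<le> 2 ^ h" using e flows_bounds(5) by linarith
  then have fit_e: "fits h (of_nat (Suc e))" by (rule fits_of_nat)
  have stamp: "val (Add (Var 34) (Const 1)) t = of_nat (Suc e)" if "t 34 = s 34" for t
    using that ev(1) by simp
  have free_src: "s 36 (of_nat (src q)) < of_nat (Suc e) \<longleftrightarrow> (\<forall>y\<in>chosen ?R q. src y \<noteq> src q)"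
    using ch(3) flow_parts_less(1)[OF q] unfolding stamped_def by blast
  have free_dst: "s 37 (of_nat (dst q)) < of_nat (Suc e) \<longleftrightarrow> (\<forall>y\<in>chosen ?R q. dst y \<noteq> dst q)"
    using ch(4) flow_parts_less(2)[OF q] unfolding stamped_def by blast
  show ?thesis unfolding choose_step_def
  \<comment> \<open>Array 38 may still contain flags of the previous event, so the entry is cleared
    before any branch. The branches are the ways in which \<open>chosen\<close> and
    \<open>gap\<close> extend by one flow: finished, not yet released, blocked at a port, or
    taken.\<close>
  proof (rule run_Seq_Assign[where q = "of_nat q" and v = 0], goal_cases)
    case t: (5 t)
    have teq: "t 33 = s 33" "t 36 = s 36" "t 37 = s 37" "t 34 = s 34" using t(2) by auto
    have flags: "\<forall>y<q. t 38 (of_nat y) = (if y \<in> active e then 1 else 0)" "t 38 (of_nat q) = 0"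
      using ch(2) t(2) by auto
    have skip: "choosing e (Suc q) t" if nc: "\<not> (?R q \<and> (\<forall>y\<in>chosen ?R q. src y \<noteq> src q \<and> dst y \<noteq> dst q))"
      and g: "gap (time e) (left e) (Suc q) = gap (time e) (left e) q"
    proof -
      have "chosen ?R (Suc q) = chosen ?R q" using nc by auto
      moreover from this have "q \<notin> active e" unfolding act using not_yet by simp
      ultimately show ?thesis unfolding choosing_def using ch flags teq g by (auto simp: less_Suc_eq)
    qed
    show ?case
    proof (rule run_IfLess[OF t(1)])
      assume "\<not> val (Const 0) t < val (Cell 17 (Var 35)) t"
      then have "\<not> 0 < left e q" using t(2) s(3) ev by simp
      then have "choosing e (Suc q) t" by (intro skip gap_Suc_same) (auto simp: ready_def)
      then show "run M h Skip t (choosing e (Suc q))" by (intro run_Skip t(1))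
    next
      assume "val (Const 0) t < val (Cell 17 (Var 35)) t"
      then have pos: "0 < left e q" using t(2) s(3) ev by simp
      have rel: "val (Cell 2 (Cell 16 (Var 35))) t = release_of q" "val (Var 32) t = time e"
        using t(2) s(3) cells ev by simp_all
      let ?min1 = "min_prog (Sub (Cell 2 (Cell 16 (Var 35))) (Var 32))"
      let ?take = "Seq (Assign 38 (Var 35) (Const 1))
             (Seq (Assign 36 (Cell 14 (Var 35)) (Add (Var 34) (Const 1)))
               (Seq (Assign 37 (Cell 15 (Var 35)) (Add (Var 34) (Const 1)))
                 (min_prog (Cell 17 (Var 35)))))"
      show "run M h (IfLess (Var 32) (Cell 2 (Cell 16 (Var 35))) ?min1
         (IfLess (Cell 36 (Cell 14 (Var 35))) (Add (Var 34) (Const 1))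
           (IfLess (Cell 37 (Cell 15 (Var 35))) (Add (Var 34) (Const 1)) ?take Skip) Skip)) t (choosing e (Suc q))"
      proof (rule run_IfLess[OF t(1)])
        assume "val (Var 32) t < val (Cell 2 (Cell 16 (Var 35))) t"
        then have late: "time e < release_of q" using rel by simp
        show "run M h ?min1 t (choosing e (Suc q))"
        proof (rule run_min_prog[where v = "release_of q - time e" and g = "gap (time e) (left e) q"], goal_cases)
          case (5 r)
          have "chosen ?R (Suc q) = chosen ?R q" using late by (auto simp: ready_def)
          moreover from this have "q \<notin> active e" unfolding act using not_yet by simp
          moreover have "r 33 0 = gap (time e) (left e) (Suc q)"
            using gap_insert[OF gaps_Suc_unreleased[where l = "left e" and m = q, OF pos late]] 5(2) by simp
          ultimately show ?case unfolding choosing_def using ch flags teq 5(2) by (auto simp: less_Suc_eq)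
        qed (use t rel late simulation_fits(4)[OF q late] teq ch in auto)
      next
        assume "\<not> val (Var 32) t < val (Cell 2 (Cell 16 (Var 35))) t"
        then have rdy: "release_of q \<le> time e" using rel by simp
        have busy: "choosing e (Suc q) t" if "\<not> (\<forall>y\<in>chosen ?R q. src y \<noteq> src q \<and> dst y \<noteq> dst q)"
          using that rdy by (intro skip gap_Suc_same) auto
        have p36: "val (Cell 36 (Cell 14 (Var 35))) t = s 36 (of_nat (src q))"
          and p37: "val (Cell 37 (Cell 15 (Var 35))) t = s 37 (of_nat (dst q))"
          using t(2) s(3) cells by simp_all
        show "run M h (IfLess (Cell 36 (Cell 14 (Var 35))) (Add (Var 34) (Const 1))
           (IfLess (Cell 37 (Cell 15 (Var 35))) (Add (Var 34) (Const 1)) ?take Skip) Skip) t (choosing e (Suc q))"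
        proof (intro run_IfLess t(1))
          assume "\<not> val (Cell 36 (Cell 14 (Var 35))) t < val (Add (Var 34) (Const 1)) t"
          then have "\<not> (\<forall>y\<in>chosen ?R q. src y \<noteq> src q)"
            unfolding p36 stamp[of t, OF teq(4)] free_src .
          then show "run M h Skip t (choosing e (Suc q))" using busy by (intro run_Skip t(1)) blast
        next
          assume "\<not> val (Cell 37 (Cell 15 (Var 35))) t < val (Add (Var 34) (Const 1)) t"
          then have "\<not> (\<forall>y\<in>chosen ?R q. dst y \<noteq> dst q)"
            unfolding p37 stamp[of t, OF teq(4)] free_dst .
          then show "run M h Skip t (choosing e (Suc q))" using busy by (intro run_Skip t(1)) blast
        next
          assume "val (Cell 36 (Cell 14 (Var 35))) t < val (Add (Var 34) (Const 1)) t"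
            "val (Cell 37 (Cell 15 (Var 35))) t < val (Add (Var 34) (Const 1)) t"
          then have free: "\<forall>y\<in>chosen ?R q. src y \<noteq> src q \<and> dst y \<noteq> dst q"
            unfolding p36 p37 stamp[of t, OF teq(4)] free_src free_dst by blast
          have ins: "chosen ?R (Suc q) = insert q (chosen ?R q)" using free pos rdy by (simp add: ready_def)
          have q_act: "q \<in> active e" unfolding act ins by simp
          show "run M h ?take t (choosing e (Suc q))"
          proof (rule run_Seq_Assign[where q = "of_nat q" and v = 1], goal_cases)
            case t1: (5 t1)
            show ?case
            proof (rule run_Seq_Assign[where q = "of_nat (src q)" and v = "of_nat (Suc e)"], goal_cases)
              case t2: (5 t2)
              show ?case
              proof (rule run_Seq_Assign[where q = "of_nat (dst q)" and v = "of_nat (Suc e)"], goal_cases)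
                case t3: (5 t3)
                show ?case
                proof (rule run_min_prog[where v = "left e q" and g = "gap (time e) (left e) q"], goal_cases)
                  case (5 r)
                  have "r 33 0 = gap (time e) (left e) (Suc q)"
                    using gap_insert[OF gaps_Suc_chosen[where l = "left e" and m = q, OF pos rdy free]] 5(2) by simp
                  moreover have "r 36 = (s 36)(of_nat (src q) := of_nat (Suc e))"
                    "r 37 = (s 37)(of_nat (dst q) := of_nat (Suc e))"
                    "r 38 = (t 38)(of_nat q := 1)"
                    using 5(2) t3(2) t2(2) t1(2) teq by simp_all
                  ultimately show ?case unfolding choosing_def ins
                    using stamped_insert[OF ch(3), of q] stamped_insert[OF ch(4), of q] flags(1) q_act
                    by (auto simp: less_Suc_eq)
                qed (use t3 t2 t1 t teq ch ev s(3) simulation_fits(2)[OF q] in auto)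
              qed (use t2 t1 t cells s(3) ev fit_e in auto)
            qed (use t1 t cells s(3) ev fit_e in auto)
          qed (use t s(3) in auto)
        qed
      qed
    qed
  qed (use s in auto)
qed

lemma run_choose_prog:
  assumes s: "all_fit h s" "at_event e s"
    and e: "e < 2 * flows"
    and old: "\<forall>p<N. s 36 (of_nat p) \<le> of_nat e \<and> s 37 (of_nat p) \<le> of_nat e"
  shows "run M h choose_prog s (choosing e flows)"
  unfolding choose_prog_def
proof (rule run_Seq_Assign[where q = 0 and v = 0], goal_cases)
  case (5 t)
  have ev: "at_event e t'" if "same_outside (insert 35 (writes choose_step)) t t'" for t'
    using same_outsideD[OF that] 5(2) by (intro at_event_cong[OF s(2)]) auto
  show ?case
  proof (rule run_For[where K = flows and Inv = "choosing e"])
    show "val (Var 31) t' = of_nat flows" if "same_outside (insert 35 (writes choose_step)) t t'" for t'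
      using ev[OF that] unfolding at_event_def static_def by simp
    have lt: "x \<le> of_nat e \<Longrightarrow> x < of_nat (Suc e) \<and> x \<le> of_nat (Suc e)" for x :: rat
      by (simp add: add.commute add_strict_increasing order_le_less_trans)
    have "stamped e f {} (s a)" if "\<forall>p<N. s a (of_nat p) \<le> of_nat e" for f a
      using that lt unfolding stamped_def by blast
    then show "choosing e 0 t" using 5(2) old unfolding choosing_def by (simp add: gap_def gaps_def)
    show "run M h choose_step t' (choosing e (Suc q))"
      if "q < flows" "all_fit h t'" "same_outside (insert 35 (writes choose_step)) t t'" "t' 35 0 = of_nat q"
        "choosing e q t'" for q t'
      using run_choose_step[OF that(2) ev[OF that(3)] that(4,5) e that(1)] .
  qed (use 5 flows_bounds in \<open>auto simp: choosing_def\<close>)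
qed (use s in auto)

definition emitted :: "nat \<Rightarrow> nat \<Rightarrow> memory \<Rightarrow> bool" where
  "emitted e y s \<longleftrightarrow> s 6 (of_nat (e * flows + y)) = of_nat (src y) \<and> s 7 (of_nat (e * flows + y)) = of_nat (dst y) \<and>
     s 8 (of_nat (e * flows + y)) = of_nat (cof y) \<and> s 9 (of_nat (e * flows + y)) = time e \<and>
     s 10 (of_nat (e * flows + y)) = (if y \<in> active e then time (Suc e) else time e)"

definition emitting :: "nat \<Rightarrow> nat \<Rightarrow> memory \<Rightarrow> bool" where
  "emitting e q s \<longleftrightarrow> (\<forall>e'<e. \<forall>y<flows. emitted e' y s) \<and> (\<forall>y<q. emitted e y s) \<and>
     (\<forall>y<flows. s 17 (of_nat y) = (if y < q then left (Suc e) y else left e y))"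

lemma run_emit_step:
  assumes s: "all_fit h s" "static s" "s 34 0 = of_nat e" "s 32 0 = time e" "s 33 0 = len e" "s 35 0 = of_nat q"
    "s 38 (of_nat q) = (if q \<in> active e then 1 else 0)" "emitting e q s"
    and e: "e < 2 * flows" and q: "q < flows"
  shows "run M h emit_step s (emitting e (Suc q))"
proof -
  define l where "l = e * flows + q"
  \<comment> \<open>Slots are pairs of event and flow in mixed radix, so writing slot
    \<open>l\<close> leaves all other records intact.\<close>
  have idx: "e' * flows + y = l \<longleftrightarrow> e' = e \<and> y = q" if "y < flows" for e' y
    unfolding l_def by (rule pair_index_eq[OF that q])
  have fl: "s 31 0 = of_nat flows" using s(2) unfolding static_def by simp
  note cells = staticD[OF s(2) q]
  have left: "s 17 (of_nat q) = left e q" using s(8) q unfolding emitting_def by simp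
  have slot: "val Slot t = of_nat l" if "t 34 = s 34" "t 31 = s 31" "t 35 = s 35" for t
    using that s(3,6) fl unfolding l_def by simp
  have amount: "val Amount t = (if q \<in> active e then len e else 0)" if "t 38 = s 38" "t 33 = s 33" "t 35 = s 35" for t
    using that s(5,6,7) by simp
  have fit_T: "fits h (time e)" "fits h (time (Suc e))" using e by (auto intro!: simulation_fits(1))
  let ?end = "if q \<in> active e then time (Suc e) else time e"
  show ?thesis unfolding emit_step_def
  proof (rule run_Seq_Assign[where q = "of_nat l" and v = "of_nat (src q)"], goal_cases)
    case t1: (5 t1)
    show ?case
    proof (rule run_Seq_Assign[where q = "of_nat l" and v = "of_nat (dst q)"], goal_cases)
      case t2: (5 t2)
      show ?case
      proof (rule run_Seq_Assign[where q = "of_nat l" and v = "of_nat (cof q)"], goal_cases)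
        case t3: (5 t3)
        show ?case
        proof (rule run_Seq_Assign[where q = "of_nat l" and v = "time e"], goal_cases)
          case t4: (5 t4)
          show ?case
          proof (rule run_Seq_Assign[where q = "of_nat l" and v = ?end], goal_cases)
            case t5: (5 t5)
            show ?case
            proof (rule run_Assign[where q = "of_nat q" and v = "left (Suc e) q"], goal_cases)
              case 3
              have "t5 38 = s 38" "t5 33 = s 33" "t5 35 = s 35" "t5 17 = s 17"
                using t1(2) t2(2) t3(2) t4(2) t5(2) by simp_all
              then show ?case using amount[of t5] left s(6) by (simp add: left_Suc)
            next
              case 4
              show ?case by (rule simulation_fits(2)[OF q])
            next
              case 5
              let ?t = "t5(17 := (t5 17)(of_nat q := left (Suc e) q))"
              have upd: "?t 6 = (s 6)(of_nat l := of_nat (src q))" "?t 7 = (s 7)(of_nat l := of_nat (dst q))"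
                "?t 8 = (s 8)(of_nat l := of_nat (cof q))" "?t 9 = (s 9)(of_nat l := time e)"
                "?t 10 = (s 10)(of_nat l := ?end)" "?t 17 = (s 17)(of_nat q := left (Suc e) q)"
                using t1(2) t2(2) t3(2) t4(2) t5(2) by simp_all
              have old: "emitted e' y ?t" if "emitted e' y s" "y < flows" "e' \<noteq> e \<or> y \<noteq> q" for e' y
                using that idx[of y e'] unfolding emitted_def upd
                by (simp del: of_nat_add of_nat_mult)
              have new: "emitted e q ?t" unfolding emitted_def upd l_def by simp
              show ?case
                using s(8) q old new unfolding emitting_def upd(6) by (auto simp: less_Suc_eq)
            qed (use t1 t2 t3 t4 t5 s(6) in auto)
          next
            case 2
            then show ?case using t1(2) t2(2) t3(2) t4(2) by (intro slot) simp_all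
          next
            case 3
            have "val Amount t4 = (if q \<in> active e then len e else 0)"
              using t1(2) t2(2) t3(2) t4(2) by (intro amount) simp_all
            moreover have "t4 32 0 = time e" using t1(2) t2(2) t3(2) t4(2) s(4) by simp
            ultimately show ?case by (simp add: time_Suc)
          qed (use t4 fit_T in auto)
        next
          case 2
          then show ?case using t1(2) t2(2) t3(2) by (intro slot) simp_all
        qed (use t1 t2 t3 fit_T s(4) in auto)
      next
        case 2
        then show ?case using t1(2) t2(2) by (intro slot) simp_all
      qed (use t1 t2 parts_fit[OF q] cells s(6) in auto)
    next
      case 2
      then show ?case using t1(2) by (intro slot) simp_all
    qed (use t1 parts_fit[OF q] cells s(6) in auto)
  next
    case 2
    then show ?case by (intro slot) simp_all
  qed (use s parts_fit[OF q] cells in auto)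
qed

definition event_inv :: "nat \<Rightarrow> memory \<Rightarrow> bool" where
  "event_inv e s \<longleftrightarrow> s 32 0 = time e \<and> (\<forall>y<flows. s 17 (of_nat y) = left e y) \<and>
     (\<forall>e'<e. \<forall>y<flows. emitted e' y s) \<and>
     (\<forall>p<N. s 36 (of_nat p) \<le> of_nat e \<and> s 37 (of_nat p) \<le> of_nat e)"

lemma run_event_prog:
  assumes s: "all_fit h s" "static s" "s 34 0 = of_nat e" "event_inv e s" and e: "e < 2 * flows"
  shows "run M h event_prog s (event_inv (Suc e))"
  unfolding event_prog_def
proof (rule run_Seq_spec[OF run_choose_prog[OF s(1) _ e]])
  show at: "at_event e s" using s unfolding at_event_def event_inv_def by simp
  show "\<forall>p<N. s 36 (of_nat p) \<le> of_nat e \<and> s 37 (of_nat p) \<le> of_nat e"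
    using s(4) unfolding event_inv_def by simp
  fix t assume t: "all_fit h t" "same_outside (writes choose_prog) s t" "choosing e flows t"
  have teq: "t 6 = s 6" "t 7 = s 7" "t 8 = s 8" "t 9 = s 9" "t 10 = s 10" "t 17 = s 17"
    using same_outsideD[OF t(2)] by auto
  have at_t: "at_event e t" using same_outsideD[OF t(2)] by (intro at_event_cong[OF at]) auto
  have ch: "t 33 0 = len e" "\<forall>y<flows. t 38 (of_nat y) = (if y \<in> active e then 1 else 0)"
    "\<forall>p<N. t 36 (of_nat p) \<le> of_nat (Suc e) \<and> t 37 (of_nat p) \<le> of_nat (Suc e)"
    using t(3) unfolding choosing_def stamped_def len_def by auto
  let ?last = "Assign 32 (Const 0) (Add (Var 32) (Var 33))"
  have "run M h (For 35 (Var 31) emit_step) t (emitting e flows)"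
  proof (rule run_For[where K = flows and Inv = "emitting e"])
    have same: "t' a = t a" if "same_outside (insert 35 (writes emit_step)) t t'" "a \<notin> {6, 7, 8, 9, 10, 17, 35}" for t' a
      using same_outsideD[OF that(1), of a] that(2) by simp
    have "static t" using at_t unfolding at_event_def by simp
    then have stat: "static t'" if "same_outside (insert 35 (writes emit_step)) t t'" for t'
      by (rule static_cong) (use same[OF that] in auto)
    show "val (Var 31) t' = of_nat flows" if "same_outside (insert 35 (writes emit_step)) t t'" for t'
      using stat[OF that] unfolding static_def by simp
    show "emitting e 0 t"
      using s(4) unfolding event_inv_def emitting_def emitted_def teq by simp
    show "run M h emit_step t' (emitting e (Suc q))"
      if "q < flows" "all_fit h t'" "same_outside (insert 35 (writes emit_step)) t t'" "t' 35 0 = of_nat q"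
        "emitting e q t'" for q t'
      using that same[OF that(3)] at_t ch stat[OF that(3)] e
      by (intro run_emit_step) (auto simp: at_event_def)
  qed (use t flows_bounds in \<open>auto simp: emitting_def emitted_def\<close>)
  then show "run M h (Seq (For 35 (Var 31) emit_step) ?last) t (event_inv (Suc e))"
  proof (rule run_Seq_spec)
    fix r assume r: "all_fit h r" "same_outside (writes (For 35 (Var 31) emit_step)) t r" "emitting e flows r"
    have req: "r 32 = t 32" "r 33 = t 33" "r 36 = t 36" "r 37 = t 37" using same_outsideD[OF r(2)] by auto
    show "run M h ?last r (event_inv (Suc e))"
    proof (rule run_Assign[where q = 0 and v = "time (Suc e)"])
      show "val (Add (Var 32) (Var 33)) r = time (Suc e)"
        using req ch(1) at_t unfolding at_event_def by (simp add: time_Suc)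
      show "fits h (time (Suc e))" using e by (intro simulation_fits(1)) simp
      show "event_inv (Suc e) (r(32 := (r 32)(0 := time (Suc e))))"
        using r(3) ch(3) req unfolding event_inv_def emitting_def emitted_def by (auto simp: less_Suc_eq)
    qed (use r in auto)
  qed
qed

lemma run_simulate_prog:
  assumes s: "all_fit h s" "s 0 1 = of_nat N" "s 0 2 = of_nat n" "flows_stored flows s"
    "\<forall>k<n. s 2 (of_nat k) = release I k" "\<forall>y<flows. s 17 (of_nat y) = of_nat (size_of y)"
    "s 32 0 = 0" "\<And>q. s 36 q = 0" "\<And>q. s 37 q = 0"
  shows "run M h simulate_prog s (\<lambda>t. t 5 0 = of_nat (2 * flows * flows) \<and>
    (\<forall>e<2 * flows. \<forall>y<flows. emitted e y t))"
  unfolding simulate_prog_def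
proof (rule run_Seq_Assign[where q = 0 and v = "of_nat flows"], goal_cases)
  case s1: (5 s1)
  have "2 * flows * flows \<le> 2 * \<beta> * \<beta>" using flows_bounds(1) by (intro mult_le_mono) auto
  then have "2 * flows * flows \<le> 2 ^ h" by (intro le_two_power_hI) (simp add: mult.assoc)
  then have cnt: "fits h (of_nat (2 * flows * flows))" by (rule fits_of_nat)
  show ?case
  proof (rule run_Seq_Assign[where q = 0 and v = "of_nat (2 * flows * flows)"], goal_cases)
    case s2: (5 s2)
    have same: "t a = s2 a" if "same_outside (insert 34 (writes event_prog)) s2 t"
      "a \<notin> {6, 7, 8, 9, 10, 17, 32, 33, 34, 35, 36, 37, 38}" for t a
      using same_outsideD[OF that(1), of a] that(2) by simp
    have s2_static: "static s2" using s(4,5) s1(2) s2(2) unfolding static_def flows_stored_def by simp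
    have stat: "static t" if "same_outside (insert 34 (writes event_prog)) s2 t" for t
      using same[OF that] by (intro static_cong[OF s2_static]) auto
    show ?case
    proof (rule run_For[where K = "2 * flows" and Inv = event_inv])
      show "val (Mul (Const 2) (Var 31)) t = of_nat (2 * flows)"
        if "same_outside (insert 34 (writes event_prog)) s2 t" for t
        using stat[OF that] unfolding static_def by simp
      show "event_inv 0 s2" using s(6-9) s1(2) s2(2) unfolding event_inv_def by simp
      show "run M h event_prog t (event_inv (Suc e))"
        if "e < 2 * flows" "all_fit h t" "same_outside (insert 34 (writes event_prog)) s2 t"
          "t 34 0 = of_nat e" "event_inv e t" for e t
        using run_event_prog[OF that(2) stat[OF that(3)] that(4,5,1)] .
      show "t 5 0 = of_nat (2 * flows * flows) \<and> (\<forall>e<2 * flows. \<forall>y<flows. emitted e y t)"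
        if "same_outside (insert 34 (writes event_prog)) s2 t" "event_inv (2 * flows) t" for t
        using same[OF that(1), of 5] that(2) s2(2) unfolding event_inv_def by simp
    qed (use s2 flows_bounds in \<open>auto simp: event_inv_def emitted_def\<close>)
  qed (use s1 cnt in auto)
next
  case 4
  show ?case by (rule fits_of_nat[OF flows_bounds(4)])
qed (use s in \<open>auto simp: flows_def\<close>)

text \<open>Array 4 still contains its initial zeros, which name core 0. A record of an inactive
  flow has equal endpoints and contains no instant, so the records that cover \<open>t\<close> are
  those of active flows.\<close>

lemma outputs_sched:
  assumes s: "\<And>q. s 4 q = 0" "s 5 0 = of_nat (2 * flows * flows)" "\<forall>e<2 * flows. \<forall>y<flows. emitted e y s"
  shows "outputs I s sched"
proof -
  have rate: "(\<exists>l::nat. of_nat l < s 5 0 \<and>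
      s 6 (of_nat l) = of_nat i \<and> s 7 (of_nat l) = of_nat j \<and> s 8 (of_nat l) = of_nat k \<and>
      real_of_rat (s 9 (of_nat l)) \<le> t \<and> t < real_of_rat (s 10 (of_nat l))) \<longleftrightarrow>
    (\<exists>e<2 * flows. \<exists>z<flows. src z = i \<and> dst z = j \<and> cof z = k \<and> z \<in> active e \<and> \<tau> e \<le> t \<and> t < \<tau> (Suc e))"
    (is "?L \<longleftrightarrow> ?R") for i j k t
  proof
    assume ?L
    then obtain l where l: "l < 2 * flows * flows" "s 6 (of_nat l) = of_nat i" "s 7 (of_nat l) = of_nat j"
      "s 8 (of_nat l) = of_nat k" "real_of_rat (s 9 (of_nat l)) \<le> t" "t < real_of_rat (s 10 (of_nat l))"
      unfolding s(2) of_nat_less_iff by blast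
    \<comment> \<open>Quotient and remainder recover event and flow from the slot.\<close>
    define e y where "e = l div flows" and "y = l mod flows"
    have "0 < flows" using l(1) by (cases flows) auto
    then have y: "y < flows" and e: "e < 2 * flows" and ley: "l = e * flows + y"
      using l(1) unfolding e_def y_def by (auto simp: div_less_iff_less_mult)
    have em: "emitted e y s" using s(3) e y by blast
    then have "src y = i" "dst y = j" "cof y = k" "s 9 (of_nat l) = time e"
      "s 10 (of_nat l) = (if y \<in> active e then time (Suc e) else time e)"
      using l(2-4) unfolding emitted_def ley by auto
    moreover from this have "y \<in> active e" using l(5,6) by (auto split: if_splits)
    ultimately show ?R using e y l(5,6) unfolding \<tau>_def by auto
  next
    assume ?R
    then obtain e z where ez: "e < 2 * flows" "z < flows" "src z = i" "dst z = j" "cof z = k" "z \<in> active e"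
      "\<tau> e \<le> t" "t < \<tau> (Suc e)" by blast
    have em: "emitted e z s" using s(3) ez by blast
    have "Suc e * flows \<le> 2 * flows * flows" using ez(1) by (intro mult_le_mono1) simp
    then have "e * flows + z < 2 * flows * flows" using ez(2) by simp
    then show ?L using em ez unfolding emitted_def \<tau>_def s(2)
      by (intro exI[of _ "e * flows + z"]) (simp del: of_nat_add of_nat_mult)
  qed
  show ?thesis unfolding outputs_def rate using s(1) by (simp add: sched_def)
qed

end

subsection \<open>The algorithm\<close>

definition algorithm :: prog where
  "algorithm = Seq loads_prog (Seq order_prog (Seq build_prog simulate_prog))"

lemma (in valid_coflow_instance) run_algorithm:
  "run M h algorithm (encode I) (\<lambda>t. \<exists>S. outputs I t S \<and> feasible I S \<and>
     objective I S \<le> (4 * real (cores I) + 1) * optimum I)"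
  unfolding algorithm_def
proof (rule run_Seq_spec[OF run_loads_prog])
  fix s1 assume s1: "all_fit h s1" "same_outside (writes loads_prog) (encode I) s1" "loads_stored s1"
  have e1: "s1 a = encode I a" if "a \<notin> {11, 20, 21, 22, 23}" for a
    using same_outsideD[OF s1(2)] that by simp
  show "run M h (Seq order_prog (Seq build_prog simulate_prog)) s1 (\<lambda>t. \<exists>S. outputs I t S \<and> feasible I S \<and>
     objective I S \<le> (4 * real (cores I) + 1) * optimum I)"
  proof (rule run_Seq_spec[OF run_order_prog[OF s1(1) _ _ s1(3)]])
    show "s1 0 1 = of_nat N" "s1 0 2 = of_nat n" "\<And>k. k < n \<Longrightarrow> s1 3 (of_nat k) = weight I k"
      using e1 encode_eqs by auto
    fix s2 assume s2: "all_fit h s2" "same_outside (writes order_prog) s1 s2" "order_found n s2"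
    have e2: "s2 a = encode I a" if "a \<notin> {11, 20, 21, 22, 23, 3, 13, 24, 25, 26, 27, 28, 29, 30, 39, 40, 41}" for a
      using same_outsideD[OF s2(2), of a] e1[of a] that by simp
    obtain \<pi> where \<pi>: "\<forall>x<n. s2 13 (of_nat x) = of_nat (\<pi> x)"
      "order_inv I 0 \<pi> (\<lambda>k. real_of_rat (s2 3 (of_nat k)))"
      using s2(3) unfolding order_found_def by auto
    interpret ordered_coflow_instance I \<pi>
      by unfold_locales (use valid \<pi>(2) in \<open>auto simp: order_inv_def\<close>)
    show "run M h (Seq build_prog simulate_prog) s2 (\<lambda>t. \<exists>S. outputs I t S \<and> feasible I S \<and>
       objective I S \<le> (4 * real (cores I) + 1) * optimum I)"
    proof (rule run_Seq_spec[OF run_build_prog[OF s2(1) _ _ _ \<pi>(1)]])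
      show "s2 0 1 = of_nat N" "s2 0 2 = of_nat n" "s2 1 = encode I 1" using e2 encode_eqs by auto
      fix s3 assume s3: "all_fit h s3" "same_outside (writes build_prog) s2 s3"
        "flows_stored flows s3 \<and> (\<forall>y<flows. s3 17 (of_nat y) = of_nat (size_of y))"
      have e3: "s3 a = encode I a" if "a \<notin> {11, 20, 21, 22, 23, 3, 13, 24, 25, 26, 27, 28, 29, 30, 39, 40, 41, 14, 15, 16, 17}" for a
        using same_outsideD[OF s3(2), of a] e2[of a] that by simp
      have sim: "run M h simulate_prog s3 (\<lambda>t. t 5 0 = of_nat (2 * flows * flows) \<and>
          (\<forall>e<2 * flows. \<forall>y<flows. emitted e y t))"
        using s3 e3 encode_eqs by (intro run_simulate_prog) auto
      show "run M h simulate_prog s3 (\<lambda>t. \<exists>S. outputs I t S \<and> feasible I S \<and>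
         objective I S \<le> (4 * real (cores I) + 1) * optimum I)"
      proof (rule run_conseq[OF sim])
        fix t assume t: "same_outside (writes simulate_prog) s3 t"
          "t 5 0 = of_nat (2 * flows * flows) \<and> (\<forall>e<2 * flows. \<forall>y<flows. emitted e y t)"
        have "t 4 q = 0" for q using same_outsideD[OF t(1), of 4] e3[of 4] encode_eqs(7)[of 4] by simp
        then have "outputs I t sched" using t(2) by (intro outputs_sched) auto
        then show "\<exists>S. outputs I t S \<and> feasible I S \<and> objective I S \<le> (4 * real (cores I) + 1) * optimum I"
          using feasible_sched objective_sched_le_optimum[OF \<pi>(2)] by blast
      qed
    qed
  qed
qed

text \<open>Natural coefficients are nonnegative.\<close>

lemma poly_nat_mono:
  fixes p :: "nat poly"
  assumes "x \<le> y"
  shows "poly p x \<le> poly p y"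
  by (induction p) (use assms in \<open>auto intro!: add_mono mult_mono\<close>)

text \<open>The count of operations serves twice: in terms of \<open>input_count\<close> by itself,
  and in terms of \<open>input_bits\<close>, which is at least as large, as a factor of the
  logarithmic cost.\<close>

lemma algorithm_exec:
  assumes "valid_instance I"
  obtains u b s where "exec algorithm (encode I) u b s" "u \<le> poly (ops_poly algorithm) (2 * input_count I)"
    "b \<le> prog_factor algorithm * (8 * (input_bits I + 2)\<^sup>2 + 1) * poly (ops_poly algorithm) (2 * input_bits I)"
    "\<exists>S. outputs I s S \<and> feasible I S \<and> objective I S \<le> (4 * real (cores I) + 1) * optimum I"
proof -
  interpret valid_coflow_instance I by unfold_locales (rule assms)
  obtain u b s where e: "exec algorithm (encode I) u b s" "u \<le> poly (ops_poly algorithm) M"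
    "b \<le> prog_factor algorithm * (h + 1) * u"
    "\<exists>S. outputs I s S \<and> feasible I S \<and> objective I S \<le> (4 * real (cores I) + 1) * optimum I"
    using run_algorithm unfolding run_def by blast
  have "u \<le> poly (ops_poly algorithm) (2 * input_bits I)"
    using e(2) poly_nat_mono[of M "2 * input_bits I" "ops_poly algorithm"] input_count_le
    unfolding M_def by linarith
  then have "prog_factor algorithm * (h + 1) * u
      \<le> prog_factor algorithm * (h + 1) * poly (ops_poly algorithm) (2 * input_bits I)"
    by (intro mult_left_mono) auto
  then have "b \<le> prog_factor algorithm * (8 * (input_bits I + 2)\<^sup>2 + 1) * poly (ops_poly algorithm) (2 * input_bits I)"
    using e(3) unfolding h_def by linarith
  then show thesis using that e(1,4) e(2)[unfolded M_def] by blast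
qed

theorem theorem3:
  "\<exists>A :: prog. combinatorial A \<and> polynomial_time A \<and>
     approximation_ratio A (\<lambda>I. 4 * real (cores I) + 1)"
proof (intro exI conjI)
  \<comment> \<open>The loop bound \<open>M\<close> is twice \<open>input_count\<close>, hence the
    composition with doubling.\<close>
  let ?p = "pcompose (ops_poly algorithm) [:0, 2:]"
  have p: "poly ?p x = poly (ops_poly algorithm) (2 * x)" for x
    by (simp add: poly_pcompose mult.commute)
  show "combinatorial algorithm" unfolding combinatorial_def
  proof (intro exI[of _ ?p] allI impI)
    fix I assume I: "valid_instance I"
    obtain u b s where "exec algorithm (encode I) u b s" "u \<le> poly (ops_poly algorithm) (2 * input_count I)"
      by (rule algorithm_exec[OF I])
    then show "\<exists>u b s. exec algorithm (encode I) u b s \<and> u \<le> poly ?p (input_count I)" unfolding p by blast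
  qed
  let ?q = "[:prog_factor algorithm:] * (8 * [:2, 1:]\<^sup>2 + 1) * ?p"
  have q: "poly ?q x = prog_factor algorithm * (8 * (x + 2)\<^sup>2 + 1) * poly (ops_poly algorithm) (2 * x)" for x
    unfolding p[symmetric] by (simp add: poly_power algebra_simps)
  show "polynomial_time algorithm" unfolding polynomial_time_def
  proof (intro exI[of _ ?q] allI impI)
    fix I assume I: "valid_instance I"
    obtain u b s where "exec algorithm (encode I) u b s"
      "b \<le> prog_factor algorithm * (8 * (input_bits I + 2)\<^sup>2 + 1) * poly (ops_poly algorithm) (2 * input_bits I)"
      by (rule algorithm_exec[OF I])
    then show "\<exists>u b s. exec algorithm (encode I) u b s \<and> b \<le> poly ?q (input_bits I)" unfolding q by blast
  qed
  show "approximation_ratio algorithm (\<lambda>I. 4 * real (cores I) + 1)" unfolding approximation_ratio_def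
  proof (intro allI impI)
    fix I assume I: "valid_instance I"
    obtain u b s where "exec algorithm (encode I) u b s"
      "\<exists>S. outputs I s S \<and> feasible I S \<and> objective I S \<le> (4 * real (cores I) + 1) * optimum I"
      by (rule algorithm_exec[OF I])
    then show "\<exists>u b s S. exec algorithm (encode I) u b s \<and> outputs I s S \<and> feasible I S \<and>
        objective I S \<le> (4 * real (cores I) + 1) * optimum I" by blast
  qed
qed

end
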